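(* Let $p$ be a prime and $n\ge 1$ an integer. Every Sylow $p$-subgroup of the symmetric group $S_{p^n}$ has the Maschke property.
   Context: All groups are finite. Maschke property: let $\pi$ be a set of primes. A $\pi$-group $V$ has the Maschke property if for every $\pi'$-group $G$ acting on $V$ by automorphisms the following holds: if $N$ is a $G$-invariant normal subgroup of $V$ which has a complement in $V$, then $N$ has a $G$-invariant complement in $V$. For a $p$-group $V$ one takes $\pi=\{p\}$. A complement of a normal subgroup $N\trianglelefteq V$ is a subgroup $L\le V$ with $NL=V$ and $N\cap L=1$. *)

theory Defs
  imports
    "HOL-Algebra.Sym_Groups"
    "HOL-Algebra.Bij"
    "HOL-Computational_Algebra.Primes"
begin

definition pi_group :: "nat set \<Rightarrow> ('a, 'm) monoid_scheme \<Rightarrow> bool" where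
  "pi_group \<pi> G \<longleftrightarrow>
     group G \<and> finite (carrier G) \<and>
     (\<forall>q. Factorial_Ring.prime q \<and> q dvd order G \<longrightarrow> q \<in> \<pi>)"

definition sylow_subgroup :: "nat \<Rightarrow> 'a set \<Rightarrow> ('a, 'm) monoid_scheme \<Rightarrow> bool" where
  "sylow_subgroup p P G \<longleftrightarrow>
     subgroup P G \<and> card P = p ^ multiplicity p (order G)"

definition acts_by_automorphisms ::
  "('g, 'm) monoid_scheme \<Rightarrow> ('v, 'n) monoid_scheme \<Rightarrow> ('g \<Rightarrow> 'v \<Rightarrow> 'v) \<Rightarrow> bool" where
  "acts_by_automorphisms G V \<phi> \<longleftrightarrow> group_hom G (AutoGroup V) \<phi>"

definition action_invariant ::
  "('g, 'm) monoid_scheme \<Rightarrow> ('g \<Rightarrow> 'v \<Rightarrow> 'v) \<Rightarrow> 'v set \<Rightarrow> bool" where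
  "action_invariant G \<phi> N \<longleftrightarrow> (\<forall>g\<in>carrier G. \<phi> g ` N = N)"

definition complement_in :: "'v set \<Rightarrow> 'v set \<Rightarrow> ('v, 'n) monoid_scheme \<Rightarrow> bool" where
  "complement_in L N V \<longleftrightarrow>
     subgroup L V \<and> N <#>\<^bsub>V\<^esub> L = carrier V \<and> N \<inter> L = {\<one>\<^bsub>V\<^esub>}"

text \<open>The acting groups range over all groups whose elements have type \<open>'g\<close>. A definition cannot
  quantify over types, so \<open>'g\<close> is passed explicitly; a theorem in which \<open>'g\<close> is a type variable
  covers every acting group.\<close>

definition maschke_property ::
  "'g itself \<Rightarrow> nat set \<Rightarrow> ('v, 'n) monoid_scheme \<Rightarrow> bool" where
  "maschke_property (_ :: 'g itself) \<pi> V \<longleftrightarrow>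
     pi_group \<pi> V \<and>
     (\<forall>(G :: 'g monoid) \<phi> N.
        pi_group ({q. Factorial_Ring.prime q} - \<pi>) G \<and> acts_by_automorphisms G V \<phi> \<and>
        N \<lhd> V \<and> action_invariant G \<phi> N \<and> (\<exists>L. complement_in L N V) \<longrightarrow>
        (\<exists>L. complement_in L N V \<and> action_invariant G \<phi> L))"

end

theory Submission
  imports Defs "HOL-Algebra.Group_Action" "HOL-Algebra.Multiplicative_Group"
    "HOL-Algebra.Zassenhaus" "HOL-Number_Theory.Cong"
begin

text \<open>
  A Sylow \<open>p\<close>-subgroup of the symmetric group on \<open>p ^ n\<close> points is an iterated wreath product \<open>V\<close> of
  cyclic groups of order \<open>p\<close>, acting on the \<open>p\<close>-ary tree of height \<open>n\<close>. Multiplying the digits of each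
  level by a unit modulo \<open>p\<close> gives a torus of automorphisms of \<open>V\<close>. Two facts yield the theorem.

  First, every group of automorphisms of order prime to \<open>p\<close> is conjugate in \<open>Aut V\<close> into the torus: it
  preserves the stabilizers \<open>K k\<close> of the levels of the tree, the automorphisms preserving all \<open>K k\<close>
  are the product of the torus with a normal \<open>p\<close>-subgroup, and the conjugacy part of the
  Schur-Zassenhaus theorem applies.

  Second, every complemented normal subgroup \<open>N\<close> of \<open>V\<close> has a torus-invariant complement. If \<open>k\<close> is
  maximal with \<open>N \<subseteq> K k\<close>, then \<open>N\<close> contains the product of the derived subgroups of the
  subtree groups below level \<open>k\<close>, so that \<open>N\<close> is governed by a submodule of a direct sum of copies of the
  permutation module on level \<open>k\<close>. A coordinate subspace complementing the coinvariants of that submodule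
  is torus-invariant and lifts to an explicit complement of \<open>N\<close>.
\<close>

section \<open>Finite groups\<close>

text \<open>Averaging over the acting group is not directly available, since \<open>N\<close> may be
  nonabelian. So the given complement \<open>L\<close> is discarded in the end: its existence only
  restricts \<open>N\<close> enough for a complement from one explicit family to be written down.
  This family has to be invariant under the whole torus at once. Nodes \<open>0...0a\<close> with
  \<open>a \<noteq> 0\<close> are chosen for its support because their \<open>p - 1\<close> equal
  labels \<open>c\<close> sum to \<open>-c\<close>, so a branch sum still detects \<open>c\<close>.

  The functionals \<open>lam [] j\<close> with \<open>j < n\<close> are coordinates on
  \<open>V\<close> modulo its derived subgroup. An automorphism preserving every \<open>K k\<close>
  acts there triangularly; the torus realizes all possible diagonal entries, and what remains is
  unipotent. The obstacle is the prime \<open>2\<close>: for odd \<open>p\<close> every automorphism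
  preserves the level stabilizers, while for \<open>p = 2\<close> coprimality is needed already at
  that point.\<close>

lemma (in group) inv_mult_cancel [simp]:
  "x \<in> carrier G \<Longrightarrow> y \<in> carrier G \<Longrightarrow> inv x \<otimes> (x \<otimes> y) = y"
  "x \<in> carrier G \<Longrightarrow> y \<in> carrier G \<Longrightarrow> x \<otimes> (inv x \<otimes> y) = y"
  by (metis inv_closed l_inv r_inv l_one m_assoc)+

section \<open>Counting orbits in finite groups\<close>

lemma (in group) group_actionI:
  assumes closed: "\<And>g x. g \<in> carrier G \<Longrightarrow> x \<in> E \<Longrightarrow> f g x \<in> E"
    and comp: "\<And>g h x. g \<in> carrier G \<Longrightarrow> h \<in> carrier G \<Longrightarrow> x \<in> E \<Longrightarrow> f (g \<otimes> h) x = f g (f h x)"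
    and one: "\<And>x. x \<in> E \<Longrightarrow> f \<one> x = x"
  shows "group_action G E (\<lambda>g. restrict (f g) E)"
proof -
  have inv1: "f (inv g) (f g x) = x" "f g (f (inv g) x) = x" if "g \<in> carrier G" "x \<in> E" for g x
    using comp[of "inv g" g x] comp[of g "inv g" x] that one by auto
  have bij: "restrict (f g) E \<in> Bij E" if g: "g \<in> carrier G" for g
  proof -
    have "bij_betw (f g) E E"
      by (rule bij_betw_byWitness[where f' = "f (inv g)"]) (use inv1 closed g in auto)
    then show ?thesis by (auto simp: Bij_def bij_betw_def inj_on_def)
  qed
  show ?thesis
    unfolding group_action_def group_hom_def group_hom_axioms_def hom_def
    using bij closed comp group_BijGroup[of E] is_group
    by (auto simp: BijGroup_def compose_def restrict_def fun_eq_iff)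
qed

text \<open>By orbit-stabilizer the numbers \<open>c\<close> are the orbit lengths. This form suits
  both later uses: orbits off the fixed points, where \<open>k = p\<close>, and free actions, where
  \<open>k\<close> is the group order.\<close>

lemma (in group) dvd_card_if_dvd_orbits:
  fixes f :: "'a \<Rightarrow> 'e \<Rightarrow> 'e"
  assumes fin: "finite E"
    and closed: "\<And>g x. g \<in> carrier G \<Longrightarrow> x \<in> E \<Longrightarrow> f g x \<in> E"
    and comp: "\<And>g h x. g \<in> carrier G \<Longrightarrow> h \<in> carrier G \<Longrightarrow> x \<in> E \<Longrightarrow> f (g \<otimes> h) x = f g (f h x)"
    and one: "\<And>x. x \<in> E \<Longrightarrow> f \<one> x = x"
    and k: "\<And>x c. x \<in> E \<Longrightarrow> c * card {g \<in> carrier G. f g x = x} = order G \<Longrightarrow> k dvd c"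
  shows "k dvd card E"
proof -
  interpret A: group_action G E "\<lambda>g. restrict (f g) E"
    by (rule group_actionI) (use assms in auto)
  have "k dvd card (\<Union> (orbits G E (\<lambda>g. restrict (f g) E)))"
  proof (rule dvd_partition)
    show "finite (\<Union> (orbits G E (\<lambda>g. restrict (f g) E)))"
      using fin A.orbits_coverture by simp
    show "\<forall>c\<in>orbits G E (\<lambda>g. restrict (f g) E). k dvd card c"
    proof
      fix c assume "c \<in> orbits G E (\<lambda>g. restrict (f g) E)"
      then obtain x where x: "x \<in> E" "c = orbit G (\<lambda>g. restrict (f g) E) x"
        unfolding orbits_def by blast
      have "stabilizer G (\<lambda>g. restrict (f g) E) x = {g \<in> carrier G. f g x = x}"
        using x by (auto simp: stabilizer_def)
      then show "k dvd card c" using A.orbit_stabilizer_theorem[OF x(1)] k[OF x(1)] x(2) by simp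
    qed
  qed (use A.disjoint_union in blast)
  then show ?thesis using A.orbits_coverture by simp
qed

text \<open>A nontrivial orbit of a \<open>p\<close>-group has length divisible by \<open>p\<close>,
  so only fixed points count modulo \<open>p\<close>. Centres, normalizers and Sylow conjugacy all
  come from this by a choice of \<open>E\<close>.\<close>

lemma (in group) p_group_fixed_points:
  fixes f :: "'a \<Rightarrow> 'e \<Rightarrow> 'e"
  assumes p: "Factorial_Ring.prime p" and ord: "order G = p ^ m" and fin: "finite E"
    and closed: "\<And>g x. g \<in> carrier G \<Longrightarrow> x \<in> E \<Longrightarrow> f g x \<in> E"
    and comp: "\<And>g h x. g \<in> carrier G \<Longrightarrow> h \<in> carrier G \<Longrightarrow> x \<in> E \<Longrightarrow> f (g \<otimes> h) x = f g (f h x)"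
    and one: "\<And>x. x \<in> E \<Longrightarrow> f \<one> x = x"
  shows "[card E = card {x \<in> E. \<forall>g\<in>carrier G. f g x = x}] (mod p)"
proof -
  let ?F = "{x \<in> E. \<forall>g\<in>carrier G. f g x = x}"
  have finG: "finite (carrier G)"
    using ord p order_gt_0_iff_finite by (simp add: prime_gt_0_nat)
  have cancel: "f (inv g) (f g x) = x" if "g \<in> carrier G" "x \<in> E" for g x
    using comp[of "inv g" g x] that one by auto
  have "p dvd card (E - ?F)"
  proof (rule dvd_card_if_dvd_orbits[where f = f])
    show "finite (E - ?F)" using fin by simp
  next
    fix g x assume g: "g \<in> carrier G" and x: "x \<in> E - ?F"
    have "f g x \<notin> ?F"
    proof
      assume F: "f g x \<in> ?F"
      have "f h x = x" if h: "h \<in> carrier G" for h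
      proof -
        have "f (inv g) (f g x) = f g x" using F g by auto
        then have "f g x = x" using cancel g x by auto
        then show ?thesis using F h by auto
      qed
      then show False using x by auto
    qed
    then show "f g x \<in> E - ?F" using closed g x by auto
  next
    fix x c assume x: "x \<in> E - ?F" and c: "c * card {g \<in> carrier G. f g x = x} = order G"
    have "c \<noteq> 1"
    proof
      assume "c = 1"
      then have "card {g \<in> carrier G. f g x = x} = card (carrier G)" using c by (simp add: order_def)
      then have "{g \<in> carrier G. f g x = x} = carrier G"
        using finG by (intro card_subset_eq) auto
      then show False using x by blast
    qed
    moreover have "c dvd p ^ m" using c ord by (metis dvd_triv_left)
    ultimately show "p dvd c" using p divides_primepow_nat
      by (metis dvd_refl dvd_power le_zero_eq neq0_conv power_0)
  qed (use comp one in auto)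
  moreover have "card E = card (E - ?F) + card ?F"
    using fin by (subst card_Diff_subset) (auto intro: card_mono simp: card_mono)
  ultimately show ?thesis by (simp add: cong_def mod_add_left_eq [symmetric])
qed

lemma (in group) order_dvd_card_if_free:
  fixes f :: "'a \<Rightarrow> 'e \<Rightarrow> 'e"
  assumes fin: "finite E"
    and closed: "\<And>g x. g \<in> carrier G \<Longrightarrow> x \<in> E \<Longrightarrow> f g x \<in> E"
    and comp: "\<And>g h x. g \<in> carrier G \<Longrightarrow> h \<in> carrier G \<Longrightarrow> x \<in> E \<Longrightarrow> f (g \<otimes> h) x = f g (f h x)"
    and one: "\<And>x. x \<in> E \<Longrightarrow> f \<one> x = x"
    and free: "\<And>g x. g \<in> carrier G \<Longrightarrow> x \<in> E \<Longrightarrow> f g x = x \<Longrightarrow> g = \<one>"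
  shows "order G dvd card E"
proof (rule dvd_card_if_dvd_orbits[OF fin closed comp one])
  fix x c assume "x \<in> E" and c: "c * card {g \<in> carrier G. f g x = x} = order G"
  then have "{g \<in> carrier G. f g x = x} = {\<one>}" using one free by auto
  then show "order G dvd c" using c by simp
qed

text \<open>Left multiplication by \<open>a\<close> is injective on the finite set \<open>H\<close>,
  hence onto, and so hits \<open>\<one>\<close>.\<close>

lemma (in group) subgroup_if_finite_closed:
  assumes "finite (carrier G)" "H \<subseteq> carrier G" "\<one> \<in> H"
    and cl: "\<And>x y. x \<in> H \<Longrightarrow> y \<in> H \<Longrightarrow> x \<otimes> y \<in> H"
  shows "subgroup H G"
proof (rule subgroupI)
  fix a assume a: "a \<in> H"
  have inj: "inj_on (\<lambda>x. a \<otimes> x) H" using a assms(2) by (auto simp: inj_on_def subset_iff)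
  have "(\<lambda>x. a \<otimes> x) ` H = H"
    using cl[OF a] inj finite_subset[OF assms(2,1)] by (intro endo_inj_surj) auto
  then obtain b where "b \<in> H" "\<one> = a \<otimes> b" using assms(3) by blast
  then show "inv a \<in> H" using a assms(2) by (metis inv_equality inv_inv inv_closed subsetD)
qed (use assms(2,3) cl in blast)+

section \<open>Subgroups of finite p-groups\<close>

lemma (in group) order_subgroup_prime_power:
  assumes p: "Factorial_Ring.prime p" and "order G = p ^ m" and H: "subgroup H G"
  shows "\<exists>l. card H = p ^ l"
proof -
  have "card H dvd order G" using lagrange_finite[OF _ H] assms
    by (metis dvd_triv_right lagrange[OF H])
  then show ?thesis using assms divides_primepow_nat by metis
qed

text \<open>\<open>G\<close> acts on \<open>D\<close> by conjugation. The number of central elements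
  in \<open>D\<close> is divisible by \<open>p\<close>, and positive because of
  \<open>\<one>\<close>, so there is another one.\<close>

lemma (in group) normal_meets_center:
  assumes p: "Factorial_Ring.prime p" and ord: "order G = p ^ m"
    and D: "D \<lhd> G" and "D \<noteq> {\<one>}"
  obtains z where "z \<in> D" "z \<noteq> \<one>" "\<And>g. g \<in> carrier G \<Longrightarrow> g \<otimes> z = z \<otimes> g"
proof -
  interpret D: normal D G by (rule D)
  have Dsub: "subgroup D G" by (rule D.subgroup_axioms)
  let ?f = "\<lambda>g x. g \<otimes> x \<otimes> inv g"
  let ?F = "{x \<in> D. \<forall>g\<in>carrier G. ?f g x = x}"
  have finG: "finite (carrier G)"
    using ord p order_gt_0_iff_finite by (simp add: prime_gt_0_nat)
  have fin: "finite D" using finG D.subset finite_subset by blast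
  have c: "[card D = card ?F] (mod p)"
    by (rule p_group_fixed_points[OF p ord fin])
       (use D.inv_op_closed2 D.mem_carrier in \<open>auto simp: m_assoc inv_mult_group\<close>)
  obtain l where l: "card D = p ^ l" using order_subgroup_prime_power[OF p ord Dsub] by blast
  have "l \<noteq> 0"
  proof
    assume "l = 0"
    then have "card D = 1" using l by simp
    then show False using \<open>D \<noteq> {\<one>}\<close> D.one_closed by (metis card_1_singletonE singletonD)
  qed
  then have "p dvd card D" using l by simp
  then have "p dvd card ?F" using c by (simp add: cong_dvd_iff)
  have oneF: "\<one> \<in> ?F" using D.one_closed by auto
  moreover have "finite ?F" using fin by simp
  ultimately have "card ?F > 0" unfolding card_gt_0_iff by blast
  with \<open>p dvd card ?F\<close> have "card ?F \<ge> p" by (rule dvd_imp_le)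
  then have "card ?F > 1" using prime_gt_1_nat[OF p] by linarith
  then have "\<not> ?F \<subseteq> {\<one>}" using card_mono[of "{\<one>}" ?F] by auto
  then obtain z where z: "z \<in> ?F" "z \<noteq> \<one>" by blast
  have "g \<otimes> z = z \<otimes> g" if g: "g \<in> carrier G" for g
  proof -
    have zc: "z \<in> carrier G" using z D.mem_carrier by blast
    have "g \<otimes> z \<otimes> inv g \<otimes> g = z \<otimes> g" using z g by simp
    then show ?thesis using zc g by (simp add: m_assoc)
  qed
  with z that show thesis by blast
qed

text \<open>The group \<open>X\<close> acts on its own cosets by right multiplication and fixes the
  coset \<open>X\<close>. As the index is divisible by \<open>p\<close>, a second coset
  \<open>X #> a\<close> is fixed, and then \<open>a\<close> normalizes \<open>X\<close>.\<close>

lemma (in group) proper_subgroup_normalizer: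
  assumes p: "Factorial_Ring.prime p" and ord: "order G = p ^ m"
    and X: "subgroup X G" and "X \<noteq> carrier G"
  obtains g where "g \<in> carrier G" "g \<notin> X" "\<And>x. x \<in> X \<Longrightarrow> g \<otimes> x \<otimes> inv g \<in> X"
proof -
  have finG: "finite (carrier G)"
    using ord p order_gt_0_iff_finite by (simp add: prime_gt_0_nat)
  interpret X: subgroup X G by fact
  let ?E = "rcosets X"
  let ?f = "\<lambda>g R. R #> inv g"
  let ?GX = "G\<lparr>carrier := X\<rparr>"
  interpret GX: group ?GX using X by (rule subgroup_imp_group)
  obtain l where l: "card X = p ^ l" using order_subgroup_prime_power[OF p ord X] by blast
  have ordX: "order ?GX = p ^ l" using l by (simp add: order_def)
  have fin: "finite ?E"
    using finG X by (simp add: RCOSETS_def)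
  have sub: "R \<subseteq> carrier G" if "R \<in> ?E" for R
    using that X X.rcosets_carrier is_group by blast
  let ?F = "{R \<in> ?E. \<forall>g\<in>carrier ?GX. ?f g R = R}"
  have c: "[card ?E = card ?F] (mod p)"
  proof (rule GX.p_group_fixed_points[OF p ordX fin])
    fix g R assume g: "g \<in> carrier ?GX" and R: "R \<in> ?E"
    then obtain a where a: "a \<in> carrier G" "R = X #> a" by (auto simp: RCOSETS_def)
    then have "R #> inv g = X #> (a \<otimes> inv g)" using g by (simp add: coset_mult_assoc X.subset)
    then show "?f g R \<in> ?E" using a g X.mem_carrier by (auto intro!: rcosetsI simp: X.subset)
  next
    fix g h R assume g: "g \<in> carrier ?GX" "h \<in> carrier ?GX" and R: "R \<in> ?E"
    then show "?f (g \<otimes>\<^bsub>?GX\<^esub> h) R = ?f g (?f h R)"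
      using sub[OF R] by (simp add: coset_mult_assoc inv_mult_group)
  next
    fix R assume R: "R \<in> ?E"
    then show "?f \<one>\<^bsub>?GX\<^esub> R = R" using sub[OF R] by (simp add: coset_mult_one)
  qed
  have "card ?E * card X = order G" by (rule lagrange[OF X])
  then have dE: "card ?E dvd p ^ m" using ord by (metis dvd_triv_left)
  have "card ?E \<noteq> 1"
  proof
    assume "card ?E = 1"
    then have "card X = card (carrier G)" using \<open>card ?E * card X = order G\<close> by (simp add: order_def)
    then show False using \<open>X \<noteq> carrier G\<close> card_subset_eq[OF finG X.subset] by simp
  qed
  then have "p dvd card ?E" using dE p divides_primepow_nat
    by (metis dvd_refl dvd_power le_zero_eq neq0_conv power_0)
  then have "p dvd card ?F" using c by (simp add: cong_dvd_iff)
  have oneF: "X \<in> ?F"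
    using X coset_join2[OF _ X] X.m_inv_closed X.mem_carrier X.subset
    by (auto simp: X.subgroup_in_rcosets is_group)
  moreover have "finite ?F" using fin by simp
  ultimately have "card ?F > 0" unfolding card_gt_0_iff by blast
  with \<open>p dvd card ?F\<close> have "card ?F \<ge> p" by (rule dvd_imp_le)
  then have "card ?F > 1" using prime_gt_1_nat[OF p] by linarith
  then have "\<not> ?F \<subseteq> {X}" using card_mono[of "{X}" ?F] by auto
  then obtain R where R: "R \<in> ?F" "R \<noteq> X" by blast
  then obtain a where a: "a \<in> carrier G" "R = X #> a" by (auto simp: RCOSETS_def)
  have "a \<notin> X" using R(2) a coset_join2[OF _ X] by auto
  moreover have "a \<otimes> x \<otimes> inv a \<in> X" if x: "x \<in> X" for x
  proof -
    have "\<forall>g\<in>X. R #> inv g = R" using R(1) by simp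
    then have "R #> inv (inv x) = R" using X.m_inv_closed[OF x] by blast
    then have "R #> x = R" using x X.mem_carrier by simp
    moreover have "a \<in> R" using a X by (metis rcos_self)
    then have "a \<otimes> x \<in> R #> x" unfolding r_coset_def by blast
    ultimately have "a \<otimes> x \<in> X #> a" using a by simp
    then obtain y where "y \<in> X" "a \<otimes> x = y \<otimes> a" by (auto simp: r_coset_def)
    then show ?thesis using a x X.mem_carrier by (simp add: m_assoc)
  qed
  ultimately show thesis using that a(1) by blast
qed

text \<open>A maximal proper \<open>X\<close> above \<open>Y\<close> has a larger normalizer, hence
  is normal. By maximality again \<open>G\<close> is \<open>X\<close> times the powers of one
  element \<open>g\<close>, so the quotient is cyclic and commutators die in it.\<close>

lemma (in group) proper_subgroup_le_normal:
  assumes p: "Factorial_Ring.prime p" and ord: "order G = p ^ m"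
    and Y: "subgroup Y G" and "Y \<noteq> carrier G"
  obtains X where "X \<lhd> G" "Y \<subseteq> X" "X \<noteq> carrier G"
    "\<And>x y. x \<in> carrier G \<Longrightarrow> y \<in> carrier G \<Longrightarrow> x \<otimes> y \<otimes> inv x \<otimes> inv y \<in> X"
proof -
  have finG: "finite (carrier G)"
    using ord p order_gt_0_iff_finite by (simp add: prime_gt_0_nat)
  define C where "C = {X. subgroup X G \<and> Y \<subseteq> X \<and> X \<noteq> carrier G}"
  have "finite C" by (rule finite_subset[of _ "Pow (carrier G)"])
    (use finG subgroup.subset in \<open>auto simp: C_def\<close>)
  moreover have "Y \<in> C" using Y assms by (simp add: C_def)
  ultimately obtain X where X: "X \<in> C" and max: "\<And>Z. Z \<in> C \<Longrightarrow> X \<subseteq> Z \<Longrightarrow> Z = X"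
    using finite_has_maximal[of C] by (metis empty_iff)
  have Xs: "subgroup X G" "Y \<subseteq> X" "X \<noteq> carrier G" using X by (auto simp: C_def)
  interpret X: subgroup X G by fact
  obtain g where g: "g \<in> carrier G" "g \<notin> X" "\<And>x. x \<in> X \<Longrightarrow> g \<otimes> x \<otimes> inv g \<in> X"
    using proper_subgroup_normalizer[OF p ord Xs(1,3)] by blast
  define Z where "Z = {h \<in> carrier G. \<forall>x\<in>X. h \<otimes> x \<otimes> inv h \<in> X}"
  have Zs: "subgroup Z G"
  proof (rule subgroup_if_finite_closed[OF finG])
    fix a b assume ab: "a \<in> Z" "b \<in> Z"
    have "a \<otimes> b \<otimes> x \<otimes> inv (a \<otimes> b) = a \<otimes> (b \<otimes> x \<otimes> inv b) \<otimes> inv a" if "x \<in> X" for x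
      using ab that X.mem_carrier by (simp add: Z_def m_assoc inv_mult_group)
    then show "a \<otimes> b \<in> Z" using ab by (simp add: Z_def)
  qed (use X.mem_carrier in \<open>auto simp: Z_def\<close>)
  have "X \<subseteq> Z" using X.mem_carrier by (auto simp: Z_def)
  moreover have "g \<in> Z" using g by (simp add: Z_def)
  ultimately have "Z = carrier G" using max[of Z] Zs Xs(2) g(2) by (auto simp: C_def)
  then have Xn: "X \<lhd> G" using Xs(1) by (auto simp: normal_inv_iff Z_def)
  interpret Xn: normal X G by (rule Xn)
  \<comment> \<open>Natural exponents suffice, as a finite set closed under products is a
    subgroup.\<close>
  define W where "W = {x \<otimes> g [^] i | x (i::nat). x \<in> X}"
  have prod: "\<exists>z\<in>X. (x \<otimes> g [^] i) \<otimes> (y \<otimes> g [^] j) = z \<otimes> g [^] (i + j)"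
    if "x \<in> X" "y \<in> X" for x y and i j :: nat
  proof (rule bexI)
    show "x \<otimes> (g [^] i \<otimes> y \<otimes> inv (g [^] i)) \<in> X"
      using that g(1) Xn.inv_op_closed2 by simp
    show "x \<otimes> g [^] i \<otimes> (y \<otimes> g [^] j) = x \<otimes> (g [^] i \<otimes> y \<otimes> inv (g [^] i)) \<otimes> g [^] (i + j)"
      using that g(1) X.mem_carrier by (simp add: m_assoc nat_pow_mult[symmetric])
  qed
  have "subgroup W G"
  proof (rule subgroup_if_finite_closed[OF finG])
    show "W \<subseteq> carrier G" using g(1) X.mem_carrier by (auto simp: W_def)
    have "\<one> = \<one> \<otimes> g [^] (0::nat)" by simp
    then show "\<one> \<in> W" unfolding W_def using X.one_closed by blast
    show "a \<otimes> b \<in> W" if ab: "a \<in> W" "b \<in> W" for a b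
    proof -
      obtain x y and i j :: nat where *: "x \<in> X" "y \<in> X" "a = x \<otimes> g [^] i" "b = y \<otimes> g [^] j"
        using ab unfolding W_def by blast
      show ?thesis using prod[OF *(1,2), of i j] unfolding *(3,4) W_def by blast
    qed
  qed
  moreover have "X \<subseteq> W"
  proof
    fix x assume "x \<in> X"
    then have "x = x \<otimes> g [^] (0::nat)" using X.mem_carrier by simp
    then show "x \<in> W" using \<open>x \<in> X\<close> unfolding W_def by blast
  qed
  moreover have "g = \<one> \<otimes> g [^] (1::nat)" using g(1) by simp
  then have "g \<in> W" unfolding W_def using X.one_closed by blast
  ultimately have W: "W = carrier G" using max[of W] Xs(2) g(2) by (auto simp: C_def)
  have "x \<otimes> y \<otimes> inv x \<otimes> inv y \<in> X" if xy: "x \<in> carrier G" "y \<in> carrier G" for x y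
  proof -
    obtain a b and i j :: nat where ab: "a \<in> X" "b \<in> X" "x = a \<otimes> g [^] i" "y = b \<otimes> g [^] j"
      using xy unfolding W[symmetric] W_def by blast
    obtain s t where st: "s \<in> X" "t \<in> X" "x \<otimes> y = s \<otimes> g [^] (i + j)" "y \<otimes> x = t \<otimes> g [^] (i + j)"
      using prod[OF ab(1,2), of i j] prod[OF ab(2,1), of j i] ab by (metis add.commute)
    have "x \<otimes> y \<otimes> inv x \<otimes> inv y = x \<otimes> y \<otimes> inv (y \<otimes> x)"
      using xy by (simp add: m_assoc inv_mult_group)
    also have "\<dots> = s \<otimes> inv t"
      unfolding st using st(1,2) g(1) X.mem_carrier by (simp add: m_assoc inv_mult_group)
    finally show ?thesis using st by simp
  qed
  with Xn Xs that show thesis by blast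
qed

section \<open>Conjugacy theorems of Sylow and Schur-Zassenhaus\<close>

lemma (in group) sylow_subgroups_iso:
  assumes p: "Factorial_Ring.prime p" and fin: "finite (carrier G)"
    and P: "subgroup P G" "card P = p ^ multiplicity p (order G)"
    and Q: "subgroup Q G" "card Q = p ^ multiplicity p (order G)"
  shows "G\<lparr>carrier := Q\<rparr> \<cong> G\<lparr>carrier := P\<rparr>"
proof -
  interpret P: subgroup P G by fact
  interpret Q: subgroup Q G by fact
  let ?E = "rcosets P"
  let ?f = "\<lambda>g R. R #> inv g"
  let ?GX = "G\<lparr>carrier := Q\<rparr>"
  interpret GX: group ?GX using Q(1) by (rule subgroup_imp_group)
  have ordX: "order ?GX = p ^ multiplicity p (order G)" using Q by (simp add: order_def)
  have finE: "finite ?E"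
    using fin P by (simp add: RCOSETS_def)
  have sub: "R \<subseteq> carrier G" if "R \<in> ?E" for R
    using that P.rcosets_carrier is_group by blast
  let ?F = "{R \<in> ?E. \<forall>g\<in>carrier ?GX. ?f g R = R}"
  have c: "[card ?E = card ?F] (mod p)"
  proof (rule GX.p_group_fixed_points[OF p ordX finE])
    fix g R assume g: "g \<in> carrier ?GX" and R: "R \<in> ?E"
    then obtain a where a: "a \<in> carrier G" "R = P #> a" by (auto simp: RCOSETS_def)
    then have "R #> inv g = P #> (a \<otimes> inv g)" using g by (simp add: coset_mult_assoc P.subset)
    then show "?f g R \<in> ?E" using a g Q.mem_carrier by (auto intro!: rcosetsI simp: P.subset)
  next
    fix g h R assume g: "g \<in> carrier ?GX" "h \<in> carrier ?GX" and R: "R \<in> ?E"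
    then show "?f (g \<otimes>\<^bsub>?GX\<^esub> h) R = ?f g (?f h R)"
      using sub[OF R] by (simp add: coset_mult_assoc inv_mult_group)
  next
    fix R assume R: "R \<in> ?E"
    then show "?f \<one>\<^bsub>?GX\<^esub> R = R" using sub[OF R] by (simp add: coset_mult_one)
  qed
  \<comment> \<open>The index of a Sylow subgroup is prime to \<open>p\<close>, so \<open>Q\<close>
    fixes some coset \<open>P #> a\<close>; conjugation by \<open>a\<close> then carries
    \<open>Q\<close> into \<open>P\<close>.\<close>
  have "\<not> p dvd card ?E"
  proof
    assume "p dvd card ?E"
    then have "p * p ^ multiplicity p (order G) dvd order G"
      using lagrange[OF P(1)] P(2) by (metis dvd_refl mult_dvd_mono)
    then have "p ^ Suc (multiplicity p (order G)) dvd order G" by simp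
    moreover have "order G \<noteq> 0" using fin order_gt_0_iff_finite by simp
    ultimately have "Suc (multiplicity p (order G)) \<le> multiplicity p (order G)"
      using p by (intro multiplicity_geI) (auto simp: not_prime_unit)
    then show False by simp
  qed
  then have "?F \<noteq> {}" using c by (metis card.empty cong_0_iff)
  then obtain R where R: "R \<in> ?E" "\<And>g. g \<in> Q \<Longrightarrow> R #> inv g = R" by auto
  then obtain a where a: "a \<in> carrier G" "R = P #> a" by (auto simp: RCOSETS_def)
  have conj_P: "a \<otimes> x \<otimes> inv a \<in> P" if x: "x \<in> Q" for x
  proof -
    have "R #> inv (inv x) = R" using R(2)[of "inv x"] x by blast
    then have "R #> x = R" using x Q.mem_carrier by simp
    moreover have "a \<in> R" using a P by (metis rcos_self)
    then have "a \<otimes> x \<in> R #> x" unfolding r_coset_def by blast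
    ultimately have "a \<otimes> x \<in> P #> a" using a by simp
    then obtain y where "y \<in> P" "a \<otimes> x = y \<otimes> a" by (auto simp: r_coset_def)
    then show ?thesis using a x P.mem_carrier by (simp add: m_assoc)
  qed
  let ?h = "\<lambda>x. a \<otimes> x \<otimes> inv a"
  have inj: "inj_on ?h Q" using a Q.mem_carrier by (auto simp: inj_on_def)
  moreover have "?h ` Q = P"
    by (rule card_subset_eq)
      (use conj_P P Q inj finite_subset[OF P.subset fin] in \<open>auto simp: card_image\<close>)
  moreover have "?h (x \<otimes> y) = ?h x \<otimes> ?h y" if "x \<in> Q" "y \<in> Q" for x y
    using a that Q.mem_carrier by (simp add: m_assoc)
  ultimately have "?h \<in> iso (G\<lparr>carrier := Q\<rparr>) (G\<lparr>carrier := P\<rparr>)"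
    using conj_P by (auto simp: iso_def hom_def bij_betw_def)
  then show ?thesis by (rule is_isoI)
qed

text \<open>The conjugating element is obtained by averaging the cocycle \<open>x \<mapsto> m\<close> given by \<open>x = m \<otimes> b\<close> over \<open>A\<close>.\<close>

lemma (in group) coprime_conjugate_abelian_step:
  assumes fin: "finite (carrier G)" and M: "M \<lhd> G" and q: "q \<in> hom (G\<lparr>carrier := M\<rparr>) Q" "comm_group Q"
    and A: "subgroup A G" "coprime (card A) (card M)" and B: "subgroup B G" "B \<inter> M = {\<one>}"
    and AB: "\<And>x. x \<in> A \<Longrightarrow> \<exists>m\<in>M. \<exists>b\<in>B. x = m \<otimes> b"
    and ker: "\<And>a x. a \<in> A \<Longrightarrow> x \<in> M \<Longrightarrow> q x = \<one>\<^bsub>Q\<^esub> \<Longrightarrow> q (a \<otimes> x \<otimes> inv a) = \<one>\<^bsub>Q\<^esub>"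
  shows "\<exists>u\<in>M. \<forall>x\<in>A. \<exists>m\<in>M. \<exists>b\<in>B. q m = \<one>\<^bsub>Q\<^esub> \<and> u \<otimes> x \<otimes> inv u = m \<otimes> b"
proof -
  interpret M: normal M G by (rule M)
  interpret A: subgroup A G by fact
  interpret B: subgroup B G by fact
  interpret Q: comm_group Q by fact
  have finA: "finite A" using A.subset fin finite_subset by blast
  have qM: "q x \<in> carrier Q" if "x \<in> M" for x using q that by (auto simp: hom_def)
  have qmult: "q (x \<otimes> y) = q x \<otimes>\<^bsub>Q\<^esub> q y" if "x \<in> M" "y \<in> M" for x y
    using q that by (auto simp: hom_def)
  have qone: "q \<one> = \<one>\<^bsub>Q\<^esub>"
    using qmult[of \<one> \<one>] qM[of \<one>] by (simp add: Q.r_cancel_one)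
  have qinv: "q (inv x) = inv\<^bsub>Q\<^esub> q x" if "x \<in> M" for x
    using qmult[of "inv x" x] that qone qM M.mem_carrier by (simp add: Q.inv_equality)
  have qpow: "q (x [^] (k::nat)) = q x [^]\<^bsub>Q\<^esub> k" if "x \<in> M" for x k
  proof -
    have "x [^] k \<in> M" for k :: nat
      using that M.subgroup_axioms by (induction k) (auto simp: M.m_closed)
    then show ?thesis using that by (induction k) (auto simp: qone qmult)
  qed
  have Mpow: "x [^] (k::nat) \<in> M" if "x \<in> M" for x k
    using that by (induction k) auto
  have Mconj: "a \<otimes> x \<otimes> inv a \<in> M" if "a \<in> A" "x \<in> M" for a x
    using that M.inv_op_closed2 A.mem_carrier by blast
  obtain c b where c: "\<And>x. x \<in> A \<Longrightarrow> c x \<in> M" "\<And>x. x \<in> A \<Longrightarrow> b x \<in> B"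
    "\<And>x. x \<in> A \<Longrightarrow> x = c x \<otimes> b x"
    using AB by metis
  have uniq: "m = m'" if "m \<in> M" "m' \<in> M" "d \<in> B" "d' \<in> B" "m \<otimes> d = m' \<otimes> d'" for m m' d d'
  proof -
    have "inv m' \<otimes> m = d' \<otimes> inv d"
      using that M.mem_carrier B.mem_carrier
      by (metis inv_closed inv_solve_left inv_solve_right' m_assoc m_closed)
    moreover have "inv m' \<otimes> m \<in> M" "d' \<otimes> inv d \<in> B" using that by auto
    ultimately have "inv m' \<otimes> m = \<one>" using B(2) by auto
    then show ?thesis using that M.mem_carrier by (metis inv_closed inv_equality inv_inv)
  qed
  \<comment> \<open>The \<open>M\<close>-components of the elements of \<open>A\<close> form a
    crossed homomorphism; this is the identity that averaging exploits.\<close>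
  have cc: "c (x \<otimes> y) = (x \<otimes> c y \<otimes> inv x) \<otimes> c x" if "x \<in> A" "y \<in> A" for x y
  proof (rule uniq)
    have carr: "x \<in> carrier G" "y \<in> carrier G" "c x \<in> carrier G" "c y \<in> carrier G"
      "b x \<in> carrier G" "b y \<in> carrier G"
      using that c M.mem_carrier A.mem_carrier B.mem_carrier by auto
    have "x \<otimes> y = x \<otimes> (c y \<otimes> b y)" using c(3)[OF that(2)] by metis
    also have "\<dots> = (x \<otimes> c y \<otimes> inv x) \<otimes> (x \<otimes> b y)"
      using carr by (simp add: m_assoc)
    also have "x \<otimes> b y = c x \<otimes> b x \<otimes> b y" using c(3)[OF that(1)] by metis
    finally have "x \<otimes> y = (x \<otimes> c y \<otimes> inv x) \<otimes> c x \<otimes> (b x \<otimes> b y)"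
      using carr by (simp add: m_assoc)
    then show "c (x \<otimes> y) \<otimes> b (x \<otimes> y) = (x \<otimes> c y \<otimes> inv x) \<otimes> c x \<otimes> (b x \<otimes> b y)"
      by (rule trans[OF c(3)[OF A.m_closed[OF that], symmetric]])
  qed (use that c(1,2) Mconj in auto)
  \<comment> \<open>\<open>M\<close> need not be commutative, so a product of the \<open>c y\<close>
    depends on the order of its factors. Only its image under \<open>q\<close>, and that of its
    conjugates, is prescribed; one \<open>D\<close> has to serve all \<open>a\<close> at
    once.\<close>
  have "\<exists>D\<in>M. \<forall>a\<in>A. q (a \<otimes> D \<otimes> inv a) = finprod Q (\<lambda>y. q (a \<otimes> c y \<otimes> inv a)) F"
    if "finite F" "F \<subseteq> A" for F
    using that
  proof (induction F)
    case empty
    show ?case by (rule bexI[of _ \<one>]) (use qone A.mem_carrier in auto)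
  next
    case (insert y F)
    have "F \<subseteq> A" using insert.prems by blast
    from insert.IH[OF this] obtain D where D: "D \<in> M"
      "\<forall>a\<in>A. q (a \<otimes> D \<otimes> inv a) = finprod Q (\<lambda>y. q (a \<otimes> c y \<otimes> inv a)) F" by blast
    show ?case
    proof (intro bexI[of _ "c y \<otimes> D"] ballI)
      fix a assume a: "a \<in> A"
      have cy: "c y \<in> M" using c(1) insert.prems by blast
      have "a \<otimes> (c y \<otimes> D) \<otimes> inv a = (a \<otimes> c y \<otimes> inv a) \<otimes> (a \<otimes> D \<otimes> inv a)"
        using a cy D(1) A.mem_carrier M.mem_carrier by (simp add: m_assoc)
      then have "q (a \<otimes> (c y \<otimes> D) \<otimes> inv a) = q (a \<otimes> c y \<otimes> inv a) \<otimes>\<^bsub>Q\<^esub> q (a \<otimes> D \<otimes> inv a)"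
        using qmult[OF Mconj[OF a cy] Mconj[OF a D(1)]] by simp
      also have "\<dots> = finprod Q (\<lambda>y. q (a \<otimes> c y \<otimes> inv a)) (insert y F)"
      proof -
        have "(\<lambda>y. q (a \<otimes> c y \<otimes> inv a)) \<in> F \<rightarrow> carrier Q"
          using insert.prems c(1) Mconj a qM by auto
        moreover have "q (a \<otimes> c y \<otimes> inv a) \<in> carrier Q" using cy Mconj a qM by auto
        ultimately show ?thesis using insert.hyps D a by (simp add: Q.finprod_insert)
      qed
      finally show "q (a \<otimes> (c y \<otimes> D) \<otimes> inv a) = finprod Q (\<lambda>y. q (a \<otimes> c y \<otimes> inv a)) (insert y F)" .
    next
      show "c y \<otimes> D \<in> M" using c(1) insert.prems D(1) by blast
    qed
  qed
  from this[OF finA] obtain D where D: "D \<in> M"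
    "\<And>a. a \<in> A \<Longrightarrow> q (a \<otimes> D \<otimes> inv a) = finprod Q (\<lambda>y. q (a \<otimes> c y \<otimes> inv a)) A" by blast
  have qD: "q D = q (a \<otimes> D \<otimes> inv a) \<otimes>\<^bsub>Q\<^esub> q (c a) [^]\<^bsub>Q\<^esub> card A" if a: "a \<in> A" for a
  proof -
    have bij: "bij_betw (\<lambda>y. a \<otimes> y) A A"
      by (rule bij_betw_byWitness[where f' = "\<lambda>y. inv a \<otimes> y"])
        (use a A.mem_carrier in \<open>auto simp: m_assoc[symmetric]\<close>)
    have "q D = q (\<one> \<otimes> D \<otimes> inv \<one>)" using D(1) M.mem_carrier by simp
    also have "\<dots> = finprod Q (\<lambda>y. q (c y)) A"
      using D(2)[OF A.one_closed] c(1) M.mem_carrier qM by (auto intro!: Q.finprod_cong)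
    also have "\<dots> = finprod Q (\<lambda>y. q (c y)) ((\<lambda>y. a \<otimes> y) ` A)" using bij by (simp add: bij_betw_def)
    also have "\<dots> = finprod Q (\<lambda>y. q (c (a \<otimes> y))) A"
      using bij c(1) qM a by (subst Q.finprod_reindex) (auto simp: bij_betw_def)
    also have "\<dots> = finprod Q (\<lambda>y. q (a \<otimes> c y \<otimes> inv a) \<otimes>\<^bsub>Q\<^esub> q (c a)) A"
      using cc a qmult c(1) Mconj qM by (intro Q.finprod_cong) (auto simp: simp_implies_def)
    also have "\<dots> = finprod Q (\<lambda>y. q (a \<otimes> c y \<otimes> inv a)) A \<otimes>\<^bsub>Q\<^esub> finprod Q (\<lambda>y. q (c a)) A"
      using a c(1) Mconj qM by (intro Q.finprod_multf) auto
    also have "finprod Q (\<lambda>y. q (c a)) A = q (c a) [^]\<^bsub>Q\<^esub> card A"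
      using a c(1) qM by (simp add: Q.finprod_const)
    finally show ?thesis using D(2)[OF a] by simp
  qed
  \<comment> \<open>Raising to the power \<open>k\<close> divides by \<open>card A\<close>, which
    turns the relation for \<open>D\<close> into one for \<open>d\<close> without the
    exponent.\<close>
  obtain k where k: "[card A * k = 1] (mod card M)"
    using cong_solve_coprime_nat[OF A(2)] by auto
  have powk: "x [^] (card A * k) = x" if x: "x \<in> M" for x
  proof -
    interpret GM: group "G\<lparr>carrier := M\<rparr>" using M.subgroup_axioms by (rule subgroup_imp_group)
    have "x [^] card M = \<one>"
      using GM.pow_order_eq_1[of x] x nat_pow_consistent[of x "card M" M] by (simp add: order_def)
    then have "x [^] (card M * l) = \<one>" for l
      using x M.mem_carrier by (simp add: nat_pow_pow[symmetric])
    moreover have "M \<noteq> {}" "finite M" using x M.subset fin finite_subset by auto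
    then have "card M > 0" by (simp add: card_gt_0_iff)
    ultimately have md: "x [^] (l mod card M) = x [^] l" for l
      using x M.mem_carrier
      by (metis (no_types, lifting) div_mult_mod_eq l_one mult.commute nat_pow_closed nat_pow_mult)
    show ?thesis using md[of "card A * k"] md[of 1] k x M.mem_carrier by (simp add: cong_def)
  qed
  define d where "d = D [^] k"
  have d: "d \<in> M" using D Mpow by (simp add: d_def)
  have qd: "q d = q (a \<otimes> d \<otimes> inv a) \<otimes>\<^bsub>Q\<^esub> q (c a)" if a: "a \<in> A" for a
  proof -
    have "q d = q D [^]\<^bsub>Q\<^esub> k" using qpow D by (simp add: d_def)
    also have "\<dots> = q (a \<otimes> D \<otimes> inv a) [^]\<^bsub>Q\<^esub> k \<otimes>\<^bsub>Q\<^esub> (q (c a) [^]\<^bsub>Q\<^esub> card A) [^]\<^bsub>Q\<^esub> k"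
      using qD[OF a] a qM Mconj D(1) c(1) by (simp add: Q.nat_pow_distrib)
    also have "(q (c a) [^]\<^bsub>Q\<^esub> card A) [^]\<^bsub>Q\<^esub> k = q (c a)"
      using a qM c(1) powk qpow[of "c a" "card A * k"] by (simp add: Q.nat_pow_pow)
    also have "q (a \<otimes> D \<otimes> inv a) [^]\<^bsub>Q\<^esub> k = q ((a \<otimes> D \<otimes> inv a) [^] k)"
      using qpow a D Mconj by simp
    also have "(a \<otimes> D \<otimes> inv a) [^] k = a \<otimes> d \<otimes> inv a"
    proof -
      have "(a \<otimes> D \<otimes> inv a) [^] k = a \<otimes> D [^] k \<otimes> inv a" for k :: nat
        using a D A.mem_carrier M.mem_carrier by (induction k) (auto simp: m_assoc)
      then show ?thesis by (simp add: d_def)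
    qed
    finally show ?thesis .
  qed
  show ?thesis
  proof (rule bexI[of _ "inv d"], rule ballI)
    fix x assume x: "x \<in> A"
    have carr: "x \<in> carrier G" "d \<in> carrier G" "c x \<in> carrier G" "b x \<in> carrier G"
      using x d c(1,2) A.mem_carrier M.mem_carrier B.mem_carrier by auto
    let ?m = "inv d \<otimes> ((x \<otimes> d \<otimes> inv x) \<otimes> c x)"
    have "q ?m = inv\<^bsub>Q\<^esub> q d \<otimes>\<^bsub>Q\<^esub> (q (x \<otimes> d \<otimes> inv x) \<otimes>\<^bsub>Q\<^esub> q (c x))"
      using x d c(1) Mconj qmult qinv by simp
    also have "\<dots> = \<one>\<^bsub>Q\<^esub>" using qd[OF x] qM d by (simp flip: qd[OF x])
    finally have "q ?m = \<one>\<^bsub>Q\<^esub>" .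
    moreover have "?m \<otimes> b x = inv d \<otimes> (x \<otimes> d \<otimes> inv x) \<otimes> (c x \<otimes> b x)"
      using carr by (simp add: m_assoc)
    then have "?m \<otimes> b x = inv d \<otimes> x \<otimes> inv (inv d)"
      using carr c(3)[OF x, symmetric] by (simp add: m_assoc)
    moreover have "?m \<in> M" using x d c(1) Mconj by simp
    ultimately show "\<exists>m\<in>M. \<exists>b\<in>B. q m = \<one>\<^bsub>Q\<^esub> \<and> inv d \<otimes> x \<otimes> inv (inv d) = m \<otimes> b"
      using c(2)[OF x] by metis
  qed (use d in simp)
qed

text \<open>The proof descends along the derived series: a conjugation inside \<open>M\<close> moves
  \<open>A\<close> from the product of \<open>M\<close> and \<open>B\<close> into that of
  \<open>M1\<close> and \<open>B\<close>, where \<open>M1\<close> is the derived subgroup of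
  \<open>M\<close> and the abelian step is applied to the quotient. A nontrivial
  \<open>p\<close>-group is larger than its derived subgroup, so the descent ends at the trivial
  group.\<close>

lemma (in group) coprime_conjugate_into_complement:
  assumes p: "Factorial_Ring.prime p" and fin: "finite (carrier G)"
    and U: "U \<lhd> G" "card U = p ^ e"
    and A: "subgroup A G" "coprime (card A) p" and B: "subgroup B G" "B \<inter> U = {\<one>}"
    and AB: "\<And>x. x \<in> A \<Longrightarrow> \<exists>m\<in>U. \<exists>b\<in>B. x = m \<otimes> b"
  shows "\<exists>u\<in>U. \<forall>x\<in>A. u \<otimes> x \<otimes> inv u \<in> B"
proof -
  have "\<exists>u\<in>M. \<forall>x\<in>A. u \<otimes> x \<otimes> inv u \<in> B"
    if "M \<lhd> G" "M \<subseteq> U" "subgroup A G" "coprime (card A) p"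
      "\<And>x. x \<in> A \<Longrightarrow> \<exists>m\<in>M. \<exists>b\<in>B. x = m \<otimes> b" for M A
    using that
  proof (induction "card M" arbitrary: M A rule: less_induct)
    case (less M A)
    interpret M: normal M G by (rule less.prems(1))
    interpret A: subgroup A G by (rule less.prems(3))
    interpret B: subgroup B G by (rule B(1))
    interpret GM: group "G\<lparr>carrier := M\<rparr>" using M.subgroup_axioms by (rule subgroup_imp_group)
    interpret GU: group "G\<lparr>carrier := U\<rparr>"
      using U(1) normal_imp_subgroup subgroup_imp_group by blast
    have "subgroup M (G\<lparr>carrier := U\<rparr>)"
      using M.subgroup_axioms U(1) less.prems(2) normal_imp_subgroup subgroup_incl by blast
    then obtain l where l: "card M = p ^ l"
      using GU.order_subgroup_prime_power[OF p, of e] U(2) by (auto simp: order_def)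
    show ?case
    proof (cases "M = {\<one>}")
      case True
      then have "x \<in> B" if "x \<in> A" for x using less.prems(5)[OF that] B.mem_carrier by auto
      then show ?thesis using True A.mem_carrier by (intro bexI[of _ \<one>]) auto
    next
      case False
      define M1 where "M1 = derived G M"
      have M1: "M1 \<lhd> G" unfolding M1_def by (rule derived_is_normal[OF less.prems(1)])
      interpret M1: normal M1 G by (rule M1)
      have M1M: "M1 \<subseteq> M" unfolding M1_def using derived_incl[OF _ M.subgroup_axioms] by blast
      have M1': "M1 = derived (G\<lparr>carrier := M\<rparr>) M"
        unfolding M1_def using derived_consistent[OF _ M.subgroup_axioms] by simp
      \<comment> \<open>A proper normal subgroup containing all commutators of \<open>M\<close>
        shows that \<open>M1\<close> is smaller than \<open>M\<close>.\<close>
      obtain X where X: "X \<lhd> G\<lparr>carrier := M\<rparr>" "X \<noteq> M"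
        "\<And>x y. x \<in> M \<Longrightarrow> y \<in> M \<Longrightarrow> x \<otimes> y \<otimes> inv x \<otimes> inv y \<in> X"
      proof -
        have "subgroup {\<one>} (G\<lparr>carrier := M\<rparr>)" using GM.triv_subgroup by simp
        moreover have "{\<one>} \<noteq> carrier (G\<lparr>carrier := M\<rparr>)" using False by simp
        moreover have "order (G\<lparr>carrier := M\<rparr>) = p ^ l" using l by (simp add: order_def)
        ultimately obtain X where "X \<lhd> G\<lparr>carrier := M\<rparr>" "{\<one>} \<subseteq> X" "X \<noteq> carrier (G\<lparr>carrier := M\<rparr>)"
          "\<And>x y. x \<in> M \<Longrightarrow> y \<in> M \<Longrightarrow>
            x \<otimes>\<^bsub>G\<lparr>carrier := M\<rparr>\<^esub> y \<otimes>\<^bsub>G\<lparr>carrier := M\<rparr>\<^esub> inv\<^bsub>G\<lparr>carrier := M\<rparr>\<^esub> x \<otimes>\<^bsub>G\<lparr>carrier := M\<rparr>\<^esub> inv\<^bsub>G\<lparr>carrier := M\<rparr>\<^esub> y \<in> X"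
          using GM.proper_subgroup_le_normal[OF p, of l "{\<one>}"] by auto
        then show thesis using that by (simp add: m_inv_consistent[OF M.subgroup_axioms])
      qed
      have "M1 \<subseteq> X" unfolding M1_def derived_def
      proof (rule generate_subgroup_incl)
        show "subgroup X G"
          using X(1) incl_subgroup[OF M.subgroup_axioms] normal_imp_subgroup by blast
      qed (use X(3) in auto)
      moreover have "X \<subseteq> M" using X(1) normal_imp_subgroup subgroup.subset by fastforce
      ultimately have "M1 \<subset> M" using X(2) M1M by blast
      moreover have finM: "finite M" using M.subset fin finite_subset by blast
      ultimately have cM1: "card M1 < card M" by (simp add: psubset_card_mono)
      define Q where "Q = G\<lparr>carrier := M\<rparr> Mod M1"
      define q where "q = (\<lambda>x. M1 #>\<^bsub>G\<lparr>carrier := M\<rparr>\<^esub> x)"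
      have Q: "comm_group Q" using GM.derived_quot_is_comm_group by (simp add: Q_def M1')
      have nM1: "M1 \<lhd> G\<lparr>carrier := M\<rparr>"
        using normal_restrict_supergroup[OF M.subgroup_axioms M1 M1M] .
      have q: "q \<in> hom (G\<lparr>carrier := M\<rparr>) Q"
        unfolding q_def Q_def by (rule normal.r_coset_hom_Mod[OF nM1])
      have qker: "q x = \<one>\<^bsub>Q\<^esub> \<longleftrightarrow> x \<in> M1" if "x \<in> M" for x
      proof -
        have "q x = \<one>\<^bsub>Q\<^esub> \<longleftrightarrow> M1 #> x = M1" by (simp add: q_def Q_def FactGroup_def r_coset_def)
        also have "\<dots> \<longleftrightarrow> x \<in> M1"
          using M1.subgroup_axioms coset_join1 coset_join2 M1.subset M.mem_carrier that
          by (metis rcos_self)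
        finally show ?thesis .
      qed
      have "\<exists>u\<in>M. \<forall>x\<in>A. \<exists>m\<in>M. \<exists>b\<in>B. q m = \<one>\<^bsub>Q\<^esub> \<and> u \<otimes> x \<otimes> inv u = m \<otimes> b"
      proof (rule coprime_conjugate_abelian_step[OF fin less.prems(1) q Q less.prems(3) _ B(1) _ less.prems(5)])
        show "coprime (card A) (card M)" using less.prems(4) l by simp
        show "B \<inter> M = {\<one>}" using B less.prems(2) B.one_closed M.one_closed by blast
        show "q (a \<otimes> x \<otimes> inv a) = \<one>\<^bsub>Q\<^esub>" if "a \<in> A" "x \<in> M" "q x = \<one>\<^bsub>Q\<^esub>" for a x
        proof -
          have "a \<otimes> x \<otimes> inv a \<in> M1" using that qker M1.inv_op_closed2 A.mem_carrier by blast
          then show ?thesis using qker M1M by blast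
        qed
      qed
      then obtain u where u: "u \<in> M" "\<And>x. x \<in> A \<Longrightarrow> \<exists>m\<in>M1. \<exists>b\<in>B. u \<otimes> x \<otimes> inv u = m \<otimes> b"
        using qker by metis
      have uc: "u \<in> carrier G" using u M.mem_carrier by blast
      let ?c = "\<lambda>x. u \<otimes> x \<otimes> inv u"
      have inj: "inj_on ?c A" using uc A.mem_carrier by (auto simp: inj_on_def)
      have "subgroup (?c ` A) G"
      proof (rule subgroup_if_finite_closed[OF fin])
        show "\<one> \<in> ?c ` A" using uc A.one_closed by (auto intro!: image_eqI[of _ _ \<one>])
        fix x y assume "x \<in> ?c ` A" "y \<in> ?c ` A"
        then obtain a b where ab: "a \<in> A" "b \<in> A" "x = ?c a" "y = ?c b" by blast
        then have "x \<otimes> y = ?c (a \<otimes> b)" using uc A.mem_carrier by (simp add: m_assoc)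
        then show "x \<otimes> y \<in> ?c ` A" using ab by blast
      qed (use uc A.mem_carrier in auto)
      moreover have "coprime (card (?c ` A)) p" using inj less.prems(4) by (simp add: card_image)
      moreover have "\<exists>m\<in>M1. \<exists>b\<in>B. y = m \<otimes> b" if "y \<in> ?c ` A" for y using that u(2) by blast
      moreover have "M1 \<subseteq> U" using M1M less.prems(2) by blast
      ultimately have "\<exists>v\<in>M1. \<forall>x\<in>?c ` A. v \<otimes> x \<otimes> inv v \<in> B"
        by (intro less.hyps[OF cM1 M1])
      then obtain v where v: "v \<in> M1" "\<And>x. x \<in> ?c ` A \<Longrightarrow> v \<otimes> x \<otimes> inv v \<in> B" by blast
      show ?thesis
      proof (intro bexI[of _ "v \<otimes> u"] ballI)
        fix x assume x: "x \<in> A"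
        have "v \<otimes> u \<otimes> x \<otimes> inv (v \<otimes> u) = v \<otimes> ?c x \<otimes> inv v"
          using x uc v(1) M1.mem_carrier A.mem_carrier by (simp add: m_assoc inv_mult_group)
        then show "v \<otimes> u \<otimes> x \<otimes> inv (v \<otimes> u) \<in> B" using v(2) x by simp
      qed (use u v M1M in auto)
    qed
  qed
  from this[OF U(1) _ A AB] show ?thesis by blast
qed

section \<open>Portraits\<close>

locale portraits =
  fixes p n :: nat
  assumes prime_p: "Factorial_Ring.prime p"
begin

lemma p_gt_1: "1 < p" using prime_gt_1_nat[OF prime_p] .
lemma p_pos [simp]: "0 < p" using p_gt_1 by simp

text \<open>Integer digits let shifts be subtracted and negated before they are reduced modulo
  \<open>p\<close>.\<close>

definition word :: "nat \<Rightarrow> int list set" where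
  "word j = {v. length v = j \<and> set v \<subseteq> {0..<int p}}"

definition nodes :: "int list set" where
  "nodes = (\<Union>j<n. word j)"

text \<open>Labels are read off along the original word, not along its image. Hence composition
  produces the label \<open>h v + g (act h v)\<close>, which is the formula in
  \<open>mul\<close>.\<close>

fun act :: "(int list \<Rightarrow> int) \<Rightarrow> int list \<Rightarrow> int list" where
  "act g [] = []"
| "act g (d # v) = ((d + g []) mod int p) # act (\<lambda>w. g (d # w)) v"

text \<open>
  A portrait assigns to each node (a word of fewer than \<open>n\<close> digits) the shift to be applied to the
  next digit. Portraits vanish outside the nodes, so that equal group elements are equal functions.
\<close>

definition V :: "(int list \<Rightarrow> int) set" where
  "V = {g. (\<forall>v\<in>nodes. g v \<in> {0..<int p}) \<and> (\<forall>v. v \<notin> nodes \<longrightarrow> g v = 0)}"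

definition mul :: "(int list \<Rightarrow> int) \<Rightarrow> (int list \<Rightarrow> int) \<Rightarrow> int list \<Rightarrow> int" where
  "mul g h = (\<lambda>v. if v \<in> nodes then (h v + g (act h v)) mod int p else 0)"

definition VG :: "(int list \<Rightarrow> int) monoid" where
  "VG = \<lparr>carrier = V, mult = mul, one = (\<lambda>_. 0)\<rparr>"

lemma VG_simps [simp]: "carrier VG = V" "mult VG = mul" "one VG = (\<lambda>_. 0)"
  by (simp_all add: VG_def)

lemma length_act [simp]: "length (act g v) = length v"
  by (induction v arbitrary: g) auto

lemma act_append: "act g (u @ v) = act g u @ act (\<lambda>w. g (u @ w)) v"
  by (induction u arbitrary: g) auto

lemma act_snoc: "act g (v @ [d]) = act g v @ [(d + g v) mod int p]"
  by (simp add: act_append)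

lemma act_take: "take i (act g v) = act g (take i v)"
  by (induction v arbitrary: i g) (auto simp: take_Cons')

lemma length_word: "v \<in> word j \<Longrightarrow> length v = j"
  by (simp add: word_def)

lemma act_word [intro]: "v \<in> word j \<Longrightarrow> act g v \<in> word j"
proof (induction v arbitrary: j g)
  case (Cons d v)
  then have "act (\<lambda>w. g (d # w)) v \<in> word (length v)" by (simp add: word_def)
  then show ?case using Cons.prems by (auto simp: word_def)
qed (simp add: word_def)

lemma word_append: "u \<in> word k \<Longrightarrow> v \<in> word j \<Longrightarrow> u @ v \<in> word (k + j)"
  by (auto simp: word_def)

lemma word_appendD: "u @ v \<in> word j \<Longrightarrow> u \<in> word (length u) \<and> v \<in> word (length v)"
  by (auto simp: word_def)

lemma word_take: "v \<in> word j \<Longrightarrow> i \<le> j \<Longrightarrow> take i v \<in> word i"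
  by (auto simp: word_def dest: in_set_takeD)

lemma word_drop: "v \<in> word j \<Longrightarrow> drop i v \<in> word (j - i)"
  by (auto simp: word_def dest: in_set_dropD)

lemma word_0: "word 0 = {[]}" by (auto simp: word_def)

lemma finite_word [simp]: "finite (word j)"
  unfolding word_def using finite_lists_length_eq[of "{0..<int p}" j] by (simp add: conj_commute)

lemma card_word: "card (word j) = p ^ j"
  unfolding word_def using card_lists_length_eq[of "{0..<int p}" j] by (simp add: conj_commute)

lemma zeros_word [intro, simp]: "replicate j 0 \<in> word j"
  by (auto simp: word_def)

lemma word_nodes: "v \<in> word j \<Longrightarrow> v \<in> nodes \<longleftrightarrow> j < n"
  by (auto simp: nodes_def word_def)

lemma nodesD: "v \<in> nodes \<Longrightarrow> v \<in> word (length v) \<and> length v < n"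
  by (auto simp: nodes_def word_def)

lemma act_cong: "(\<And>i. i < length v \<Longrightarrow> g (take i v) = h (take i v)) \<Longrightarrow> act g v = act h v"
proof (induction v arbitrary: g h)
  case (Cons d v)
  have "g [] = h []" using Cons.prems[of 0] by simp
  moreover have "act (\<lambda>w. g (d # w)) v = act (\<lambda>w. h (d # w)) v"
    by (rule Cons.IH) (use Cons.prems[of "Suc _"] in simp)
  ultimately show ?case by simp
qed simp

lemma act_0: "v \<in> word j \<Longrightarrow> act (\<lambda>_. 0) v = v"
  by (induction v arbitrary: j) (auto simp: word_def)

lemma act_fix: "v \<in> word j \<Longrightarrow> (\<And>i. i < j \<Longrightarrow> g (take i v) = 0) \<Longrightarrow> act g v = v"
  using act_cong[of v g "\<lambda>_. 0"] act_0[of v j] by (simp add: length_word)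

lemma shift_mod_inj:
  assumes "d \<in> {0..<int p}" "e \<in> {0..<int p}" "(d + c) mod int p = (e + c) mod int p"
  shows "d = e"
proof -
  have "[d + c = e + c] (mod int p)" using assms(3) by (simp add: cong_def)
  then have "[d = e] (mod int p)" by (simp add: cong_add_rcancel)
  then show ?thesis using assms(1,2) by (simp add: cong_def)
qed

lemma act_inj: "u \<in> word j \<Longrightarrow> v \<in> word j \<Longrightarrow> act g u = act g v \<Longrightarrow> u = v"
proof (induction u arbitrary: j v g)
  case (Cons d u)
  then obtain e v' where v: "v = e # v'" by (cases v) (auto simp: word_def)
  have "d = e" by (rule shift_mod_inj[of _ _ "g []"]) (use Cons.prems v in \<open>auto simp: word_def\<close>)
  moreover have "u = v'"
    by (rule Cons.IH[of "length u" v' "\<lambda>w. g (d # w)"])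
      (use Cons.prems v \<open>d = e\<close> in \<open>auto simp: word_def\<close>)
  ultimately show ?case using v by simp
qed (auto simp: word_def)

lemma bij_act: "bij_betw (act g) (word j) (word j)"
proof -
  have inj: "inj_on (act g) (word j)" using act_inj by (auto simp: inj_on_def)
  moreover have "act g ` word j = word j"
    by (rule endo_inj_surj) (use inj in auto)
  ultimately show ?thesis by (simp add: bij_betw_def)
qed

lemma V_nonnode: "g \<in> V \<Longrightarrow> v \<notin> nodes \<Longrightarrow> g v = 0"
  by (simp add: V_def)

lemma V_range: "g \<in> V \<Longrightarrow> g v \<in> {0..<int p}"
  using p_pos by (cases "v \<in> nodes") (auto simp: V_def)

lemma V_mod [simp]: "g \<in> V \<Longrightarrow> g v mod int p = g v"
  using V_range[of g v] by simp

lemma V_eqI: "g \<in> V \<Longrightarrow> h \<in> V \<Longrightarrow> (\<And>v j. j < n \<Longrightarrow> v \<in> word j \<Longrightarrow> [g v = h v] (mod int p)) \<Longrightarrow> g = h"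
  by (rule ext) (metis V_mod V_nonnode cong_def nodesD)

lemma mul_apply: "g \<in> V \<Longrightarrow> h \<in> V \<Longrightarrow> v \<in> word j \<Longrightarrow> mul g h v = (h v + g (act h v)) mod int p"
  using word_nodes[OF act_word, of v j h] word_nodes[of v j] by (auto simp: mul_def V_nonnode)

lemma mul_closed [simp, intro]: "g \<in> V \<Longrightarrow> h \<in> V \<Longrightarrow> mul g h \<in> V"
  by (auto simp: V_def mul_def)

lemma zero_V [simp, intro]: "(\<lambda>_. 0) \<in> V" by (simp add: V_def)

lemma act_mul: "v \<in> word j \<Longrightarrow> j \<le> n \<Longrightarrow> act (mul g h) v = act g (act h v)"
proof (induction v arbitrary: j rule: rev_induct)
  case (snoc d v)
  have v: "v \<in> word (length v)" "length v < n" using snoc.prems by (auto simp: word_def)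
  then have "v \<in> nodes" by (simp add: word_nodes)
  then show ?case using snoc.IH[OF v(1)] v
    by (simp add: act_snoc mul_def mod_simps ac_simps)
qed simp

lemma VG_group: "group VG"
proof (rule groupI)
  fix a b c assume *: "a \<in> carrier VG" "b \<in> carrier VG" "c \<in> carrier VG"
  show "a \<otimes>\<^bsub>VG\<^esub> b \<otimes>\<^bsub>VG\<^esub> c = a \<otimes>\<^bsub>VG\<^esub> (b \<otimes>\<^bsub>VG\<^esub> c)"
  proof (rule V_eqI)
    fix v j assume "j < n" "v \<in> word j"
    then show "[(a \<otimes>\<^bsub>VG\<^esub> b \<otimes>\<^bsub>VG\<^esub> c) v = (a \<otimes>\<^bsub>VG\<^esub> (b \<otimes>\<^bsub>VG\<^esub> c)) v] (mod int p)"
      using * by (simp add: mul_apply[where j = j] act_word act_mul[where j = j] cong_def mod_simps ac_simps)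
  qed (use * in auto)
next
  fix g assume g: "g \<in> carrier VG"
  show "\<one>\<^bsub>VG\<^esub> \<otimes>\<^bsub>VG\<^esub> g = g"
    by (rule V_eqI) (use g in \<open>auto simp: mul_apply cong_def\<close>)
  \<comment> \<open>The inverse is determined by the equation
    \<open>h (act g v) = - g v\<close>.\<close>
  define h where "h = (\<lambda>v. if v \<in> nodes then (- g (inv_into (word (length v)) (act g) v)) mod int p else 0)"
  have h: "h \<in> V" by (auto simp: h_def V_def)
  have "mul h g = (\<lambda>_. 0)"
  proof (rule V_eqI)
    fix v j assume v: "j < n" "v \<in> word j"
    have "inv_into (word j) (act g) (act g v) = v"
      using bij_act[of g j] v by (auto simp: bij_betw_def)
    moreover have "act g v \<in> nodes" using v act_word word_nodes by blast
    ultimately have "h (act g v) = (- g v) mod int p" using v by (simp add: h_def length_word)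
    then show "[mul h g v = 0] (mod int p)"
      using v h g by (simp add: mul_apply cong_def mod_simps)
  qed (use h g in auto)
  then show "\<exists>y\<in>carrier VG. y \<otimes>\<^bsub>VG\<^esub> g = \<one>\<^bsub>VG\<^esub>" using h by auto
qed auto

lemma V_alt: "V = (\<lambda>f v. if v \<in> nodes then f v else 0) ` (nodes \<rightarrow>\<^sub>E {0..<int p})"
proof (intro subset_antisym subsetI)
  fix g assume g: "g \<in> V"
  then have "g = (\<lambda>v. if v \<in> nodes then restrict g nodes v else 0)" by (auto simp: V_def)
  moreover have "restrict g nodes \<in> nodes \<rightarrow>\<^sub>E {0..<int p}" using g by (auto simp: V_def)
  ultimately show "g \<in> (\<lambda>f v. if v \<in> nodes then f v else 0) ` (nodes \<rightarrow>\<^sub>E {0..<int p})" by blast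
qed (auto simp: V_def PiE_iff)

lemma finite_nodes [simp]: "finite nodes" by (simp add: nodes_def)

lemma finite_V [simp]: "finite V"
  unfolding V_alt by (intro finite_imageI finite_PiE) auto

lemma card_V: "card V = p ^ (\<Sum>j<n. p ^ j)"
proof -
  have "card V = card (nodes \<rightarrow>\<^sub>E {0..<int p})"
    unfolding V_alt
  proof (rule card_image, rule inj_onI)
    fix f g assume fg: "f \<in> nodes \<rightarrow>\<^sub>E {0..<int p}" "g \<in> nodes \<rightarrow>\<^sub>E {0..<int p}"
      and eq: "(\<lambda>v. if v \<in> nodes then f v else 0) = (\<lambda>v. if v \<in> nodes then g v else 0)"
    show "f = g"
    proof (rule PiE_ext[OF fg])
      fix v assume "v \<in> nodes"
      then show "f v = g v" using fun_cong[OF eq, of v] by simp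
    qed
  qed
  also have "\<dots> = p ^ card nodes" by (simp add: card_PiE)
  also have "card nodes = (\<Sum>j<n. p ^ j)"
    unfolding nodes_def by (subst card_UN_disjoint) (auto simp: card_word dest: length_word)
  finally show ?thesis .
qed

lemma order_VG: "order VG = p ^ (\<Sum>j<n. p ^ j)"
  by (simp add: order_def card_V)

sublocale VG: group VG by (rule VG_group)

section \<open>Level stabilizers and branch sums\<close>

definition K :: "nat \<Rightarrow> (int list \<Rightarrow> int) set" where
  "K k = {g \<in> V. \<forall>v. length v < k \<longrightarrow> g v = 0}"

lemma K_V: "g \<in> K k \<Longrightarrow> g \<in> V" by (simp add: K_def)
lemma K_0: "K 0 = V" by (auto simp: K_def)
lemma K_n: "K n = {\<lambda>_. 0}"
proof -
  have "g = (\<lambda>_. 0)" if g: "g \<in> K n" for g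
  proof
    fix v show "g v = 0" using g nodesD[of v] by (cases "v \<in> nodes") (auto simp: K_def V_nonnode)
  qed
  then show ?thesis by (auto simp: K_def)
qed
lemma K_mono: "k \<le> l \<Longrightarrow> K l \<subseteq> K k" by (auto simp: K_def)
lemma K_vanish: "g \<in> K k \<Longrightarrow> length v < k \<Longrightarrow> g v = 0" by (simp add: K_def)
lemma K_SucI: "g \<in> K k \<Longrightarrow> (\<And>v. v \<in> word k \<Longrightarrow> g v = 0) \<Longrightarrow> g \<in> K (Suc k)"
  using V_nonnode nodesD by (auto simp: K_def less_Suc_eq)
lemma K_act: "g \<in> K k \<Longrightarrow> v \<in> word j \<Longrightarrow> j \<le> k \<Longrightarrow> act g v = v"
  by (rule act_fix) (auto simp: K_def word_def)

text \<open>The label at a node \<open>v\<close> reappears as the last digit of the image of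
  \<open>v @ [0]\<close>, and \<open>v @ [0]\<close> extends to a word of length
  \<open>k\<close>.\<close>

lemma K_if_act_fix:
  assumes "g \<in> V" "k \<le> n" "\<And>v. v \<in> word k \<Longrightarrow> act g v = v"
  shows "g \<in> K k"
proof -
  have "g v = 0" if v: "length v < k" for v
  proof (cases "v \<in> nodes")
    case True
    define w where "w = v @ replicate (k - length v) 0"
    have w: "w \<in> word k" using word_append[of v "length v"] nodesD[OF True] v
      by (metis le_add_diff_inverse nat_less_le w_def zeros_word)
    have "take (Suc (length v)) w = v @ [0]"
      using v by (simp add: w_def take_Cons' replicate_length_same) 
    moreover have "act g (take (Suc (length v)) w) = take (Suc (length v)) w"
      using assms(3)[OF w] act_take[of "Suc (length v)" g w] by simp
    ultimately have "g v mod int p = 0" by (simp add: act_snoc)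
    then show ?thesis using assms(1) by simp
  qed (use assms(1) V_nonnode in simp)
  then show ?thesis using assms(1) by (simp add: K_def)
qed

lemma K_subgroup: "subgroup (K k) VG"
proof (rule VG.subgroup_if_finite_closed)
  fix x y assume xy: "x \<in> K k" "y \<in> K k"
  have "mul x y v = 0" if "length v < k" for v
  proof (cases "v \<in> nodes")
    case True
    then show ?thesis using xy that nodesD[OF True]
      by (simp add: mul_apply[where j = "length v"] K_V K_vanish)
  qed (simp add: mul_def)
  then show "x \<otimes>\<^bsub>VG\<^esub> y \<in> K k" using xy by (simp add: K_def)
qed (auto simp: K_def)

lemma mul_eqD:
  assumes "mul a b = mul c d" "a \<in> V" "b \<in> V" "c \<in> V" "d \<in> V" "v \<in> word j"
  shows "[b v + a (act b v) = d v + c (act d v)] (mod int p)"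
  using fun_cong[OF assms(1), of v] assms(2-) by (simp add: mul_apply cong_def)

definition conjugate :: "(int list \<Rightarrow> int) \<Rightarrow> (int list \<Rightarrow> int) \<Rightarrow> int list \<Rightarrow> int" where
  "conjugate a g = mul (mul a g) (inv\<^bsub>VG\<^esub> a)"

lemma inv_V [simp, intro]: "a \<in> V \<Longrightarrow> inv\<^bsub>VG\<^esub> a \<in> V"
  using VG.inv_closed by simp

lemma conj_V [simp, intro]: "a \<in> V \<Longrightarrow> g \<in> V \<Longrightarrow> conjugate a g \<in> V"
  by (simp add: conjugate_def)

lemma mul_conj: "a \<in> V \<Longrightarrow> g \<in> V \<Longrightarrow> mul (conjugate a g) a = mul a g"
  using VG.inv_solve_right[of "conjugate a g" "mul a g" a] by (simp add: conjugate_def)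

text \<open>This is \<open>mul_conj\<close> evaluated at \<open>v\<close>. Keeping
  \<open>act a v\<close> as the argument of the conjugate avoids inverting
  \<open>act a\<close>.\<close>

lemma conj_apply:
  assumes "a \<in> V" "g \<in> V" "v \<in> word j"
  shows "[a v + conjugate a g (act a v) = g v + a (act g v)] (mod int p)"
  using mul_eqD[OF mul_conj[OF assms(1,2)] _ _ _ _ assms(3)] assms by simp

text \<open>For \<open>j = k < n\<close> this makes \<open>K k\<close> modulo
  \<open>K (Suc k)\<close> the permutation module of \<open>V\<close> on level
  \<open>k\<close>.\<close>

lemma conj_level:
  assumes "a \<in> V" "g \<in> K k" "v \<in> word j" "j \<le> k"
  shows "conjugate a g (act a v) = g v"
proof -
  have "[conjugate a g (act a v) = g v] (mod int p)"
    using conj_apply[OF assms(1) _ assms(3), of g] K_act[OF assms(2-4)] K_V[OF assms(2)]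
    by (simp add: cong_add_lcancel add.commute[of "g v"])
  then show ?thesis using assms by (simp add: K_V cong_def)
qed

lemma conj_K: "a \<in> V \<Longrightarrow> g \<in> K k \<Longrightarrow> conjugate a g \<in> K k"
proof -
  assume a: "a \<in> V" and g: "g \<in> K k"
  have "conjugate a g v = 0" if v: "length v < k" for v
  proof (cases "v \<in> nodes")
    case True
    then have "v \<in> act a ` word (length v)"
      using bij_act[of a "length v"] nodesD by (simp add: bij_betw_def)
    then obtain w where w: "w \<in> word (length v)" "v = act a w" by blast
    have "conjugate a g v = g w" using conj_level[OF a g w(1)] v w(2) by simp
    also have "\<dots> = 0" using K_vanish[OF g] v length_word[OF w(1)] by simp
    finally show ?thesis .
  qed (use a g K_V V_nonnode conj_V in blast)
  then show "conjugate a g \<in> K k" using a g by (simp add: K_def)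
qed

lemma K_normal: "K k \<lhd> VG"
  using K_subgroup conj_K by (simp add: VG.normal_inv_iff conjugate_def)

text \<open>
  On \<open>K k\<close> the maps \<open>lam u j\<close> with \<open>u \<in> word k\<close> are homomorphisms modulo \<open>p\<close>. Their common kernel is the
  product of the derived subgroups of the subtree groups below level \<open>k\<close>.
\<close>

definition lam :: "int list \<Rightarrow> nat \<Rightarrow> (int list \<Rightarrow> int) \<Rightarrow> int" where
  "lam u j g = (\<Sum>v\<in>word j. g (u @ v)) mod int p"

lemma lam_mod [simp]: "lam u j g mod int p = lam u j g" by (simp add: lam_def)

lemma sum_act: "(\<Sum>v\<in>word j. f (act g v)) = (\<Sum>v\<in>word j. f v)"
  by (rule sum.reindex_bij_betw[OF bij_act])

text \<open>Since \<open>h\<close> fixes \<open>u\<close>, it permutes the words below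
  \<open>u\<close>, so the displaced labels of \<open>g\<close> contribute the same sum.\<close>

lemma lam_mul:
  assumes "g \<in> V" "h \<in> V" "u \<in> word k" "act h u = u"
  shows "lam u j (mul g h) = (lam u j g + lam u j h) mod int p"
proof -
  have "[(\<Sum>v\<in>word j. mul g h (u @ v)) = (\<Sum>v\<in>word j. h (u @ v) + g (u @ act (\<lambda>w. h (u @ w)) v))] (mod int p)"
    by (rule cong_sum)
      (use mul_apply[OF assms(1,2) word_append[OF assms(3)]] assms(4) in \<open>auto simp: act_append cong_def\<close>)
  also have "(\<Sum>v\<in>word j. h (u @ v) + g (u @ act (\<lambda>w. h (u @ w)) v)) =
      (\<Sum>v\<in>word j. h (u @ v)) + (\<Sum>v\<in>word j. g (u @ v))"
    by (simp add: sum.distrib sum_act[of "\<lambda>v. g (u @ v)"])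
  finally show ?thesis by (simp add: lam_def cong_def mod_simps ac_simps)
qed

text \<open>Both sides of \<open>conj_apply\<close> are summed over the branch below
  \<open>u\<close>. The labels of \<open>a\<close> occur on both sides, in two orders, and
  cancel.\<close>

lemma lam_conj:
  assumes a: "a \<in> V" and g: "g \<in> V" and u: "u \<in> word k" "act g u = u"
  shows "lam (act a u) j (conjugate a g) = lam u j g"
proof -
  let ?a = "\<lambda>w. a (u @ w)" and ?g = "\<lambda>w. g (u @ w)"
  have "[(\<Sum>v\<in>word j. a (u @ v) + conjugate a g (act a u @ act ?a v)) =
      (\<Sum>v\<in>word j. g (u @ v) + a (u @ act ?g v))] (mod int p)"
  proof (rule cong_sum)
    fix v assume v: "v \<in> word j"
    show "[a (u @ v) + conjugate a g (act a u @ act ?a v) = g (u @ v) + a (u @ act ?g v)] (mod int p)"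
      using conj_apply[OF a g word_append[OF u(1) v]] u(2) by (simp add: act_append)
  qed
  then have "[(\<Sum>v\<in>word j. a (u @ v)) + (\<Sum>v\<in>word j. conjugate a g (act a u @ v)) =
      (\<Sum>v\<in>word j. a (u @ v)) + (\<Sum>v\<in>word j. g (u @ v))] (mod int p)"
    using sum_act[of "\<lambda>v. conjugate a g (act a u @ v)" ?a j] sum_act[of "\<lambda>v. a (u @ v)" ?g j]
    by (simp add: sum.distrib add.commute)
  then show ?thesis by (simp add: cong_add_lcancel lam_def cong_def[symmetric])
qed

lemma lam_zero [simp]: "lam u j (\<lambda>_. 0) = 0" by (simp add: lam_def)

section \<open>Portraits on one level and along one path\<close>

definition lev :: "nat \<Rightarrow> (int list \<Rightarrow> int) \<Rightarrow> int list \<Rightarrow> int" where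
  "lev j f = (\<lambda>v. if j < n \<and> v \<in> word j then f v mod int p else 0)"

lemma lev_K [intro]: "lev j f \<in> K j"
  by (auto simp: lev_def K_def V_def word_nodes word_def)

lemma lev_V [simp, intro]: "lev j f \<in> V" using lev_K K_V by blast

lemma lev_add: "mul (lev j f) (lev j f') = lev j (\<lambda>v. f v + f' v)"
proof (rule V_eqI)
  fix v i assume v: "i < n" "v \<in> word i"
  show "[mul (lev j f) (lev j f') v = lev j (\<lambda>v. f v + f' v) v] (mod int p)"
  proof (cases "i = j")
    case True
    then show ?thesis using v K_act[OF lev_K[of j f'] v(2)]
      using mul_apply[OF lev_V lev_V v(2), of j f j f']
      by (simp add: lev_def cong_def mod_simps ac_simps)
  next
    case False
    then have "act (lev j f') v \<notin> word j" "v \<notin> word j" using v by (auto simp: word_def)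
    then show ?thesis using v by (simp add: mul_apply) (simp add: lev_def cong_def)
  qed
qed auto

text \<open>The labels sit on the prefixes of \<open>x\<close>, each the difference of the next
  digits. A word that leaves the path of \<open>x\<close> meets only zero labels from then
  on.\<close>

definition move :: "int list \<Rightarrow> int list \<Rightarrow> int list \<Rightarrow> int" where
  "move x y = (\<lambda>v. if v \<in> nodes \<and> length v < length x \<and> take (length v) x = v
     then (y ! length v - x ! length v) mod int p else 0)"

lemma move_V [simp, intro]: "move x y \<in> V" by (auto simp: move_def V_def)

lemma act_move:
  assumes x: "x \<in> word j" and y: "y \<in> word j" and j: "j \<le> n"
  shows "act (move x y) x = y"
proof -
  have "act (move x y) (take i x) = take i y" if "i \<le> j" for i
    using that
  proof (induction i)
    case (Suc i)
    have l: "length x = j" "length y = j" using x y by (auto simp: word_def)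
    have "take i x \<in> nodes" using word_take[OF x, of i] word_nodes Suc.prems j by auto
    then have "move x y (take i x) = (y ! i - x ! i) mod int p"
      using Suc.prems l by (simp add: move_def)
    moreover have "y ! i \<in> set y" using Suc.prems l by simp
    then have "y ! i \<in> {0..<int p}" using y by (auto simp: word_def)
    ultimately show ?case using Suc l
      by (simp add: take_Suc_conv_app_nth act_snoc mod_simps)
  qed simp
  from this[of j] show ?thesis using x y by (simp add: word_def)
qed

text \<open>Before position \<open>m\<close> all labels met by \<open>w\<close> are zero or
  differences of equal digits; afterwards \<open>w\<close> has left the path of
  \<open>x\<close>.\<close>

lemma act_move_fix:
  assumes w: "w \<in> word j" and m: "\<And>i. i < m \<Longrightarrow> i < length x \<Longrightarrow> x ! i = y ! i"
    and neq: "take m w \<noteq> take m x" 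
  shows "act (move x y) w = w"
proof (rule act_fix[OF w])
  fix i assume i: "i < j"
  show "move x y (take i w) = 0"
  proof (cases "i < m")
    case True
    then show ?thesis using i w m[of i] by (auto simp: move_def word_def)
  next
    case False
    have "take i x \<noteq> take i w"
    proof
      assume "take i x = take i w"
      then have "take m (take i x) = take m (take i w)" by simp
      then show False using neq False by (simp add: min_absorb1)
    qed
    then show ?thesis using i w by (auto simp: move_def word_def)
  qed
qed

section \<open>Normal subgroups\<close>

lemma sum_word_append:
  "(\<Sum>u\<in>word k. \<Sum>v\<in>word j. f (u @ v)) = (\<Sum>w\<in>word (k + j). f w)"
proof -
  have "(\<Sum>u\<in>word k. \<Sum>v\<in>word j. f (u @ v)) = (\<Sum>(u, v)\<in>word k \<times> word j. f (u @ v))"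
    by (rule sum.cartesian_product)
  also have "\<dots> = (\<Sum>w\<in>word (k + j). f w)"
    by (rule sum.reindex_bij_witness[where i = "\<lambda>w. (take k w, drop k w)" and j = "\<lambda>(u, v). u @ v"])
      (auto simp: word_append length_word dest: word_take[where i = k] word_drop[where i = k])
  finally show ?thesis .
qed

lemma sum_word_prefix:
  assumes u: "u \<in> word k"
  shows "(\<Sum>w\<in>{w \<in> word (k + j). take k w = u}. f w) = (\<Sum>v\<in>word j. f (u @ v))"
proof (rule sum.reindex_bij_witness[where i = "\<lambda>v. u @ v" and j = "drop k"])
  fix w assume w: "w \<in> {w \<in> word (k + j). take k w = u}"
  then have *: "u @ drop k w = w" by (metis (mono_tags, lifting) append_take_drop_id mem_Collect_eq)
  then show "u @ drop k w = w" .
  show "drop k w \<in> word j" using w word_drop[of w "k + j" k] by simp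
  show "f (u @ drop k w) = f w" using * by simp
qed (use u in \<open>auto simp: word_append length_word\<close>)

lemma lam_Nil_split: "lam [] (k + j) g = (\<Sum>u\<in>word k. lam u j g) mod int p"
  by (simp add: lam_def sum_word_append[symmetric] mod_sum_eq)

text \<open>Each point mass is replaced by its difference with the mass at a representative of its
  branch; the correction collected at the representative is the branch sum, which vanishes modulo
  \<open>p\<close>. \<open>Q\<close> is abstract because it will express that a function is realized
  on one level by an element of \<open>N\<close>.\<close>

lemma span_differences:
  assumes zero: "Q (\<lambda>_. 0)" and add: "\<And>f g. Q f \<Longrightarrow> Q g \<Longrightarrow> Q (\<lambda>v. f v + g v)"
    and cong: "\<And>f g. Q f \<Longrightarrow> (\<And>v. v \<in> word (k + j) \<Longrightarrow> [f v = g v] (mod int p)) \<Longrightarrow> Q g"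
    and diff: "\<And>w w'. w \<in> word (k + j) \<Longrightarrow> w' \<in> word (k + j) \<Longrightarrow> take k w = take k w' \<Longrightarrow>
      Q (\<lambda>v. of_bool (v = w) - of_bool (v = w'))"
    and f: "\<And>u. u \<in> word k \<Longrightarrow> [(\<Sum>v\<in>word j. f (u @ v)) = 0] (mod int p)"
  shows "Q f"
proof -
  define r where "r w = take k w @ replicate j (0::int)" for w
  have r: "r w \<in> word (k + j)" "take k (r w) = take k w" if "w \<in> word (k + j)" for w
  proof -
    have "take k w \<in> word k" using that by (rule word_take) simp
    then show "r w \<in> word (k + j)" "take k (r w) = take k w"
      using word_append[of "take k w" k "replicate j 0" j] length_word[of "take k w" k]
      by (simp_all add: r_def)
  qed
  have mult: "Q (\<lambda>v. int m * h v)" if "Q h" for m h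
  proof (induction m)
    case (Suc m)
    then show ?case using add[OF that Suc] by (simp add: algebra_simps)
  qed (simp add: zero)
  \<comment> \<open>The coefficients are natural numbers because \<open>Q\<close> is only known to
    be closed under sums.\<close>
  have "Q (\<lambda>v. \<Sum>w\<in>S. int (nat (f w mod int p)) * (of_bool (v = w) - of_bool (v = r w)))"
    if "finite S" "S \<subseteq> word (k + j)" for S
    using that
  proof (induction S)
    case (insert w S)
    have "Q (\<lambda>v. int (nat (f w mod int p)) * (of_bool (v = w) - of_bool (v = r w)))"
      by (rule mult, rule diff) (use insert.prems r in auto)
    from add[OF this insert.IH] show ?case using insert by simp
  qed (simp add: zero)
  from this[of "word (k + j)"]
  have "Q (\<lambda>v. \<Sum>w\<in>word (k + j). int (nat (f w mod int p)) * (of_bool (v = w) - of_bool (v = r w)))"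
    by simp
  then show ?thesis
  proof (rule cong)
    fix v assume v: "v \<in> word (k + j)"
    have "(\<Sum>w\<in>word (k + j). int (nat (f w mod int p)) * (of_bool (v = w) - of_bool (v = r w))) =
      (\<Sum>w\<in>word (k + j). (f w mod int p) * of_bool (v = w)) -
      (\<Sum>w\<in>word (k + j). (f w mod int p) * of_bool (v = r w))"
      by (simp add: right_diff_distrib sum_subtractf)
    also have "(\<Sum>w\<in>word (k + j). (f w mod int p) * of_bool (v = w)) = f v mod int p"
      using v by (simp add: of_bool_def if_distrib[of "\<lambda>x. _ * x"] cong: if_cong)
    also have "[f v mod int p - (\<Sum>w\<in>word (k + j). (f w mod int p) * of_bool (v = r w)) = f v - 0] (mod int p)"
    proof (rule cong_diff)
      have "[(\<Sum>w\<in>word (k + j). (f w mod int p) * of_bool (v = r w)) =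
        (\<Sum>w\<in>word (k + j). f w * of_bool (v = r w))] (mod int p)"
        by (rule cong_sum) (simp add: cong_def mod_simps)
      also have "[(\<Sum>w\<in>word (k + j). f w * of_bool (v = r w)) = 0] (mod int p)"
      proof (cases "v = r v")
        case True
        have "v = r w \<longleftrightarrow> take k w = take k v" if w: "w \<in> word (k + j)" for w
        proof
          assume "v = r w" then show "take k w = take k v" using r(2)[OF w] by simp
        next
          assume "take k w = take k v"
          then have "r w = r v" by (simp add: r_def)
          then show "v = r w" using True by simp
        qed
        then have "(\<Sum>w\<in>word (k + j). f w * of_bool (v = r w)) =
            (\<Sum>w\<in>word (k + j). if take k w = take k v then f w else 0)"
          by (intro sum.cong) auto
        also have "\<dots> = (\<Sum>w\<in>{w \<in> word (k + j). take k w = take k v}. f w)"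
          by (simp add: sum.inter_filter)
        also have "\<dots> = (\<Sum>x\<in>word j. f (take k v @ x))"
          by (rule sum_word_prefix) (use v word_take in auto)
        also have "[\<dots> = 0] (mod int p)" by (rule f) (use v word_take in auto)
        finally show ?thesis .
      next
        case False
        have "v \<noteq> r w" if w: "w \<in> word (k + j)" for w
        proof
          assume "v = r w"
          then have "r v = r w" using r(2)[OF w] by (simp add: r_def)
          then show False using False \<open>v = r w\<close> by simp
        qed
        then have "(\<Sum>w\<in>word (k + j). f w * of_bool (v = r w)) = 0" by (intro sum.neutral) auto
        then show ?thesis by simp
      qed
      finally show "[(\<Sum>w\<in>word (k + j). (f w mod int p) * of_bool (v = r w)) = 0] (mod int p)" .
    qed (simp add: cong_def)
    finally show "[(\<Sum>w\<in>word (k + j). int (nat (f w mod int p)) * (of_bool (v = w) - of_bool (v = r w))) = f v] (mod int p)"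
      by simp
  qed
qed

section \<open>Elements forced into a normal subgroup\<close>

lemma solve_mod:
  assumes "\<not> [a = 0] (mod int p)"
  obtains m :: nat where "0 < m" "[int m * a = b] (mod int p)"
proof -
  have "\<not> int p dvd a" using assms by (simp add: cong_0_iff)
  then have "coprime a (int p)"
    using prime_p by (metis coprime_commute prime_imp_coprime prime_nat_int_transfer)
  then obtain x where x: "[a * x = 1] (mod int p)" using cong_solve_coprime_int by auto
  \<comment> \<open>Adding \<open>p\<close> keeps \<open>m\<close> positive even when
    \<open>b\<close> vanishes, as a later induction over positive multiples requires.\<close>
  define m where "m = nat ((x * b) mod int p) + p"
  have "int m = (x * b) mod int p + int p" by (simp add: m_def)
  then have "[int m = x * b] (mod int p)" by (simp add: cong_def)
  then have "[int m * a = x * b * a] (mod int p)" by (rule cong_scalar_right)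
  also have "x * b * a = (a * x) * b" by simp
  also have "[(a * x) * b = 1 * b] (mod int p)" using x by (rule cong_scalar_right)
  finally have "[int m * a = b] (mod int p)" by simp
  moreover have "m > 0" by (simp add: m_def)
  ultimately show thesis using that by blast
qed

lemma inv_lev: "inv\<^bsub>VG\<^esub> (lev j f) = lev j (\<lambda>v. - f v)"
proof (rule VG.inv_equality)
  show "lev j (\<lambda>v. - f v) \<otimes>\<^bsub>VG\<^esub> lev j f = \<one>\<^bsub>VG\<^esub>"
    by (simp add: lev_add) (simp add: lev_def fun_eq_iff)
qed auto

lemma normal_conj: "N \<lhd> VG \<Longrightarrow> t \<in> V \<Longrightarrow> h \<in> N \<Longrightarrow> conjugate t h \<in> N"
  using normal.inv_op_closed2[of N VG] by (simp add: conjugate_def)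

lemma normal_commutator:
  assumes N: "N \<lhd> VG" and g: "g \<in> N" and t: "t \<in> V"
  shows "mul (conjugate g t) (inv\<^bsub>VG\<^esub> t) \<in> N"
proof -
  interpret N: normal N VG by fact
  have gV: "g \<in> V" using g N.mem_carrier by simp
  have "mul (conjugate g t) (inv\<^bsub>VG\<^esub> t) = g \<otimes>\<^bsub>VG\<^esub> (t \<otimes>\<^bsub>VG\<^esub> inv\<^bsub>VG\<^esub> g \<otimes>\<^bsub>VG\<^esub> inv\<^bsub>VG\<^esub> t)"
    using gV t VG.m_assoc by (simp add: conjugate_def)
  also have "\<dots> \<in> N" using g t N.m_closed[OF g N.inv_op_closed2[of t "inv\<^bsub>VG\<^esub> g"]] by simp
  finally show ?thesis .
qed

lemma conj_lev_single:
  assumes g: "g \<in> V" and w: "w \<in> word j" and v: "v \<in> word j" and j: "j < n"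
  shows "conjugate g (lev j (\<lambda>v. of_bool (v = w))) v = of_bool (v = act g w)"
proof -
  obtain x where x: "x \<in> word j" "v = act g x"
    using v bij_act[of g j] by (auto simp: bij_betw_def)
  have "conjugate g (lev j (\<lambda>v. of_bool (v = w))) v = lev j (\<lambda>v. of_bool (v = w)) x"
    using conj_level[OF g lev_K x(1)] x by simp
  also have "\<dots> = of_bool (x = w)" using x j p_gt_1 by (simp add: lev_def)
  also have "x = w \<longleftrightarrow> v = act g w" using x w act_inj by blast
  finally show ?thesis .
qed

lemma commutator_lev_single:
  assumes g: "g \<in> V" and w: "w \<in> word j" and v: "v \<in> word j" and j: "j < n"
  shows "[mul (conjugate g (lev j (\<lambda>v. of_bool (v = w)))) (inv\<^bsub>VG\<^esub> (lev j (\<lambda>v. of_bool (v = w)))) v =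
    of_bool (v = act g w) - of_bool (v = w)] (mod int p)"
proof -
  let ?d = "lev j (\<lambda>v. of_bool (v = w))" and ?e = "lev j (\<lambda>v. - of_bool (v = w))"
  have "mul (conjugate g ?d) ?e v = (?e v + conjugate g ?d (act ?e v)) mod int p"
    using g v by (intro mul_apply) auto
  moreover have "act ?e v = v" using K_act[OF lev_K v] by simp
  moreover have "[?e v = - of_bool (v = w)] (mod int p)" using v j by (simp add: lev_def cong_def)
  ultimately have "[mul (conjugate g ?d) ?e v = - of_bool (v = w) + of_bool (v = act g w)] (mod int p)"
    using conj_lev_single[OF assms] by (simp add: cong_def mod_simps cong_add)
  then show ?thesis by (simp add: inv_lev)
qed

text \<open>
  Descending induction on the level \<open>j\<close>: modulo deeper levels, the commutator of \<open>g\<close> with the portrait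
  supported at a single node \<open>w\<close> below \<open>u\<close> is the difference of the single-node portraits at \<open>g w\<close> and \<open>w\<close>,
  and conjugating by elements that fix \<open>w\<close> moves \<open>g w\<close> freely within its branch below \<open>u\<close>.
\<close>

lemma normal_contains_lam_kernel:
  assumes N: "N \<lhd> VG" "N \<subseteq> K k" and g: "g \<in> N" "u \<in> word k" "g u \<noteq> 0"
    and h: "h \<in> K k" "\<And>u i. u \<in> word k \<Longrightarrow> lam u i h = 0"
  shows "h \<in> N"
proof -
  interpret N: normal N VG by (rule N(1))
  have gK: "g \<in> K k" and gV: "g \<in> V" using g N(2) K_V by auto
  have kn: "k < n" using V_nonnode[OF gV, of u] g(2,3) word_nodes by blast
  have "h \<in> N" if "k \<le> j" "j \<le> n" "h \<in> K j" "\<forall>u\<in>word k. \<forall>i. lam u i h = 0" for j h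
    using that
  proof (induction "n - j" arbitrary: j h)
    case 0
    then have "h = (\<lambda>_. 0)" using K_n by simp
    then show ?case using N.one_closed by simp
  next
    case (Suc x)
    then have jn: "j < n" and x: "x = n - Suc j" by auto
    note IH = Suc.hyps(1)[OF x]
    show ?case
    \<comment> \<open>On level \<open>k\<close> itself \<open>lam v 0\<close> is the label at
      \<open>v\<close>, so the hypothesis already pushes \<open>h\<close> one level down. Only
      deeper levels call for elements of \<open>N\<close>.\<close>
    proof (cases "j = k")
      case True
      have "h \<in> K (Suc j)"
      proof (rule K_SucI[OF Suc.prems(3)])
        fix v assume "v \<in> word j"
        then have "lam v 0 h = 0" using Suc.prems(4) True by simp
        then show "h v = 0" using K_V[OF Suc.prems(3)] by (simp add: lam_def word_0)
      qed
      then show ?thesis using IH[of h] Suc.prems jn by simp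
    next
      case False
      then obtain j' where j': "j = k + Suc j'" using Suc.prems(1)
        by (metis add_Suc_right less_imp_Suc_add nat_less_le)
      have kj: "k \<le> j" using j' by simp
      \<comment> \<open>Requiring vanishing \<open>lam\<close> of the realizing element keeps the
        induction hypothesis available after \<open>h\<close> has been corrected by it.\<close>
      define Q where "Q f \<longleftrightarrow> (\<exists>h\<in>N. h \<in> K j \<and> (\<forall>u\<in>word k. \<forall>i. lam u i h = 0) \<and>
        (\<forall>v\<in>word j. [h v = f v] (mod int p)))" for f
      have Q0: "Q (\<lambda>_. 0)"
        unfolding Q_def by (rule bexI[of _ "\<lambda>_. 0"]) (use N.one_closed in \<open>auto simp: K_def\<close>)
      have Qadd: "Q (\<lambda>v. f v + f' v)" if "Q f" "Q f'" for f f'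
      proof -
        obtain a where a: "a \<in> N" "a \<in> K j" "\<forall>u\<in>word k. \<forall>i. lam u i a = 0" "\<forall>v\<in>word j. [a v = f v] (mod int p)"
          using \<open>Q f\<close> unfolding Q_def by blast
        obtain b where b: "b \<in> N" "b \<in> K j" "\<forall>u\<in>word k. \<forall>i. lam u i b = 0" "\<forall>v\<in>word j. [b v = f' v] (mod int p)"
          using \<open>Q f'\<close> unfolding Q_def by blast
        show ?thesis unfolding Q_def
        proof (intro bexI[of _ "mul a b"] conjI ballI allI)
          show "mul a b \<in> N" using N.m_closed[OF a(1) b(1)] by simp
          show "mul a b \<in> K j" using subgroup.m_closed[OF K_subgroup a(2) b(2)] by simp
          show "lam u i (mul a b) = 0" if "u \<in> word k" for u i
            using lam_mul[OF K_V[OF a(2)] K_V[OF b(2)] that K_act[OF b(2) that kj]] a b that by simp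
          show "[mul a b v = f v + f' v] (mod int p)" if "v \<in> word j" for v
          proof -
            have "mul a b v = (b v + a v) mod int p"
              using mul_apply[OF K_V[OF a(2)] K_V[OF b(2)] that] K_act[OF b(2) that] by simp
            also have "[\<dots> = f' v + f v] (mod int p)"
              using a(4) b(4) that by (simp add: cong_add)
            finally show ?thesis by (simp add: add.commute)
          qed
        qed
      qed
      have Qcong: "Q f'" if "Q f" "\<And>v. v \<in> word j \<Longrightarrow> [f v = f' v] (mod int p)" for f f'
        using that unfolding Q_def by (meson cong_trans)
      have Qconj: "Q (\<lambda>v. of_bool (v = act t w) - of_bool (v = act t w'))"
        if Q: "Q (\<lambda>v. of_bool (v = w) - of_bool (v = w'))" and t: "t \<in> V" and w: "w \<in> word j" "w' \<in> word j" for t w w'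
      proof -
        obtain a where a: "a \<in> N" "a \<in> K j" "\<forall>u\<in>word k. \<forall>i. lam u i a = 0"
          "\<forall>v\<in>word j. [a v = of_bool (v = w) - of_bool (v = w')] (mod int p)"
          using Q unfolding Q_def by blast
        show ?thesis unfolding Q_def
        proof (intro bexI[of _ "conjugate t a"] conjI ballI allI)
          show "conjugate t a \<in> N" using normal_conj[OF N(1) t a(1)] .
          show "conjugate t a \<in> K j" using conj_K[OF t a(2)] .
          show "lam u i (conjugate t a) = 0" if u: "u \<in> word k" for u i
          proof -
            obtain u' where u': "u' \<in> word k" "u = act t u'"
              using u bij_act[of t k] by (auto simp: bij_betw_def)
            show ?thesis using lam_conj[OF t K_V[OF a(2)] u'(1) K_act[OF a(2) u'(1) kj]] a(3) u' by simp
          qed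
          show "[conjugate t a v = of_bool (v = act t w) - of_bool (v = act t w')] (mod int p)" if v: "v \<in> word j" for v
          proof -
            obtain v' where v': "v' \<in> word j" "v = act t v'"
              using v bij_act[of t j] by (auto simp: bij_betw_def)
            have "v' = w \<longleftrightarrow> v = act t w" "v' = w' \<longleftrightarrow> v = act t w'" using v' w act_inj by blast+
            then show ?thesis using conj_level[OF t a(2) v'(1)] a(4) v' by auto
          qed
        qed
      qed
      define D where "D w w' \<longleftrightarrow> Q (\<lambda>v. of_bool (v = w) - of_bool (v = w'))" for w w'
      have Dtrans: "D x z" if "D x y" "D y z" for x y z
        using Qadd[OF that[unfolded D_def]] by (simp add: D_def)
      have Dg: "D (act g w) w" if w: "w \<in> word j" for w
        unfolding D_def Q_def
      proof (intro bexI conjI ballI allI)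
        let ?d = "lev j (\<lambda>v. of_bool (v = w))"
        let ?b = "mul (conjugate g ?d) (inv\<^bsub>VG\<^esub> ?d)"
        show "?b \<in> N" by (rule normal_commutator[OF N(1) g(1)]) simp
        have *: "conjugate g ?d \<in> K j" "inv\<^bsub>VG\<^esub> ?d \<in> K j"
          using conj_K[OF gV lev_K] by (auto simp: inv_lev)
        then show "?b \<in> K j" using subgroup.m_closed[OF K_subgroup] by fastforce
        show "lam u i ?b = 0" if u: "u \<in> word k" for u i
        proof -
          have "lam u i ?b = (lam u i (conjugate g ?d) + lam u i (inv\<^bsub>VG\<^esub> ?d)) mod int p"
            by (rule lam_mul) (use * K_V u K_act[OF *(2) u kj] in auto)
          also have "lam u i (conjugate g ?d) = lam u i ?d"
            using lam_conj[OF gV lev_V u K_act[OF lev_K u kj], of i] K_act[OF gK u] by simp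
          also have "(lam u i ?d + lam u i (inv\<^bsub>VG\<^esub> ?d)) mod int p = lam u i (mul ?d (inv\<^bsub>VG\<^esub> ?d))"
            by (rule lam_mul[symmetric]) (use * K_V u K_act[OF *(2) u kj] in auto)
          also have "mul ?d (inv\<^bsub>VG\<^esub> ?d) = (\<lambda>_. 0)" using VG.r_inv[of ?d] by simp
          finally show ?thesis by simp
        qed
        show "[?b v = of_bool (v = act g w) - of_bool (v = w)] (mod int p)" if "v \<in> word j" for v
          by (rule commutator_lev_single[OF gV w that jn])
      qed
      have Dconj: "D (act t x) (act t y)" if "D x y" "t \<in> V" "x \<in> word j" "y \<in> word j" for t x y
        using Qconj that unfolding D_def by blast
      have ug: "take k w = u \<Longrightarrow> w \<in> word j \<Longrightarrow> take (Suc k) (act g w) = u @ [(w ! k + g u) mod int p]" for w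
        using act_take[of "Suc k" g w] j' K_act[OF gK g(2)]
        by (simp add: take_Suc_conv_app_nth length_word act_snoc)
      \<comment> \<open>From \<open>Dg\<close> alone the digit at position \<open>k\<close> shifts
        by exactly \<open>g u\<close>. The portrait \<open>?t\<close> fixes \<open>w\<close> and
        brings the remaining digits of \<open>act g w\<close> to those of \<open>x\<close>.\<close>
      have D1: "D x w" if w: "w \<in> word j" "take k w = u" and x: "x \<in> word j" "take k x = u"
        and xk: "x ! k = (w ! k + g u) mod int p" for x w
      proof -
        let ?t = "move (act g w) x"
        have lw: "length w = j" "length x = j" using w x by (auto simp: length_word)
        have tk: "take (Suc k) (act g w) = take (Suc k) x"
          using ug[OF w(2,1)] x xk lw j' by (simp add: take_Suc_conv_app_nth)
        have "act ?t (act g w) = x" using act_move[of "act g w" j x] w x jn by auto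
        moreover have "act ?t w = w"
        proof (rule act_move_fix[OF w(1), where m = "Suc k"])
          show "act g w ! i = x ! i" if "i < Suc k" for i
            using arg_cong[OF tk, of "\<lambda>l. l ! i"] that by simp
          have "w ! k \<noteq> (w ! k + g u) mod int p"
          proof
            assume eq: "w ! k = (w ! k + g u) mod int p"
            have "w ! k \<in> set w" using lw j' by simp
            then have "(w ! k + 0) mod int p = (w ! k + g u) mod int p"
              using eq w(1) by (auto simp: word_def)
            then have "[0 = g u] (mod int p)" by (metis cong_add_lcancel cong_def)
            then show False using g(3) gV by (simp add: cong_def)
          qed
          then show "take (Suc k) w \<noteq> take (Suc k) (act g w)"
            using ug[OF w(2,1)] w lw j' by (simp add: take_Suc_conv_app_nth)
        qed
        moreover have "D (act ?t (act g w)) (act ?t w)" by (rule Dconj) (use Dg w in auto)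
        ultimately show ?thesis by simp
      qed
      have D2: "D x w" if w: "w \<in> word j" "take k w = u" and x: "x \<in> word j" "take k x = u"
        and xk: "x ! k = (w ! k + int (Suc m) * g u) mod int p" for x w m
        using x xk
      proof (induction m arbitrary: x)
        case 0
        then show ?case using D1[OF w] by simp
      next
        case (Suc m)
        define y where "y = u @ ((w ! k + int (Suc m) * g u) mod int p) # replicate j' 0"
        have "((w ! k + int (Suc m) * g u) mod int p) # replicate j' 0 \<in> word (Suc j')"
          by (auto simp: word_def)
        then have "y \<in> word j" using word_append[OF g(2)] j' by (simp only: y_def)
        moreover have lu: "length u = k" using g(2) by (simp add: length_word)
        then have y2: "take k y = u" "y ! k = (w ! k + int (Suc m) * g u) mod int p"
          by (auto simp: y_def nth_append)
        ultimately have "D y w" using Suc.IH by blast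
        moreover have "D x y"
        proof (rule D1)
          show "x ! k = (y ! k + g u) mod int p" using Suc.prems y2 by (simp add: mod_simps algebra_simps)
        qed (use Suc.prems \<open>y \<in> word j\<close> y2 in auto)
        ultimately show ?case using Dtrans by blast
      qed
      \<comment> \<open>As \<open>p\<close> is prime, positive multiples of \<open>g u\<close> reach
        every digit at position \<open>k\<close>, including the unchanged one.\<close>
      have D3: "D x w" if w: "w \<in> word j" "take k w = u" and x: "x \<in> word j" "take k x = u" for x w
      proof -
        have "\<not> [g u = 0] (mod int p)" using g(3) gV by (simp add: cong_def)
        from solve_mod[OF this, of "x ! k - w ! k"]
        obtain m :: nat where m: "0 < m" "[int m * g u = x ! k - w ! k] (mod int p)" by blast
        have "[w ! k + int m * g u = w ! k + (x ! k - w ! k)] (mod int p)"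
          by (rule cong_add[OF cong_refl m(2)])
        then have "[w ! k + int m * g u = x ! k] (mod int p)" by simp
        moreover have "length x = j" using x length_word by simp
        then have "x ! k \<in> set x" using j' by simp
        then have "x ! k mod int p = x ! k" using x by (auto simp: word_def)
        ultimately have "x ! k = (w ! k + int m * g u) mod int p" by (simp add: cong_def)
        then show ?thesis using D2[OF w x, of "m - 1"] m(1) by simp
      qed
      \<comment> \<open>Conjugation carries the branch below \<open>u\<close> to any other branch at
        level \<open>k\<close>; \<open>u\<close> is distinguished only through
        \<open>g u \<noteq> 0\<close>.\<close>
      have D4: "D x w" if w: "w \<in> word j" and x: "x \<in> word j" and eq: "take k x = take k w" for x w
      proof -
        let ?t = "move u (take k w)"
        have tw: "take k w \<in> word k" using w kj word_take by blast
        obtain w' where w': "w' \<in> word j" "w = act ?t w'"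
          using w bij_act[of ?t j] by (auto simp: bij_betw_def)
        obtain x' where x': "x' \<in> word j" "x = act ?t x'"
          using x bij_act[of ?t j] by (auto simp: bij_betw_def)
        have au: "act ?t u = take k w" using act_move[OF g(2) tw] kn by simp
        have "act ?t (take k w') = act ?t u" using act_take[of k ?t w'] w' au by simp
        then have "take k w' = u" using act_inj word_take[OF w'(1) kj] g(2) by blast
        moreover have "act ?t (take k x') = act ?t u" using act_take[of k ?t x'] x' au eq by simp
        then have "take k x' = u" using act_inj word_take[OF x'(1) kj] g(2) by blast
        ultimately have "D x' w'" using D3 w' x' by blast
        then show ?thesis using Dconj[of x' w' ?t] w' x' by simp
      qed
      \<comment> \<open>The branch sums of \<open>h\<close> vanish, so \<open>N\<close> contains an
        element cancelling \<open>h\<close> on level \<open>j\<close>, and the product lies one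
        level deeper.\<close>
      have "Q (\<lambda>v. - h v)"
      proof (rule span_differences[where Q = Q and k = k and j = "Suc j'"])
        show "[(\<Sum>v\<in>word (Suc j'). - h (u @ v)) = 0] (mod int p)" if "u \<in> word k" for u
        proof -
          have "lam u (Suc j') h = 0" using Suc.prems(4) that by simp
          then show ?thesis by (simp add: lam_def sum_negf cong_def mod_eq_0_iff_dvd)
        qed
      qed (use Q0 Qadd Qcong D4 D_def j' in auto)
      then obtain b where b: "b \<in> N" "b \<in> K j" "\<forall>u\<in>word k. \<forall>i. lam u i b = 0"
          "\<forall>v\<in>word j. [b v = - h v] (mod int p)"
        unfolding Q_def by blast
      have hV: "h \<in> V" and bV: "b \<in> V" using Suc.prems(3) b(2) K_V by auto
      have hb: "mul h b \<in> K j" using subgroup.m_closed[OF K_subgroup Suc.prems(3) b(2)] by simp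
      have "mul h b \<in> N"
      proof (rule IH)
        show "mul h b \<in> K (Suc j)"
        proof (rule K_SucI[OF hb])
          fix v assume v: "v \<in> word j"
          have "mul h b v = (b v + h v) mod int p"
            using mul_apply[OF hV bV v] K_act[OF b(2) v] by simp
          also have "[b v + h v = - h v + h v] (mod int p)" using b(4) v by (intro cong_add) auto
          then have "(b v + h v) mod int p = 0" by (simp add: cong_def)
          finally show "mul h b v = 0" .
        qed
        show "\<forall>u\<in>word k. \<forall>i. lam u i (mul h b) = 0"
          using lam_mul[OF hV bV _ K_act[OF b(2) _ kj]] Suc.prems(4) b(3) by simp
      qed (use jn kj in auto)
      then have "mul h b \<otimes>\<^bsub>VG\<^esub> inv\<^bsub>VG\<^esub> b \<in> N" using b(1) N.m_closed by blast
      moreover have "mul h b \<otimes>\<^bsub>VG\<^esub> inv\<^bsub>VG\<^esub> b = h"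
        using VG.inv_solve_right'[of h "mul h b" b] hV bV by simp
      ultimately show ?thesis by simp
    qed
  qed
  from this[of k h] h kn show ?thesis by simp
qed

section \<open>Generating V through its abelianization\<close>

lemma lam_beyond: "g \<in> V \<Longrightarrow> u \<in> word k \<Longrightarrow> n \<le> k + j \<Longrightarrow> lam u j g = 0"
  unfolding lam_def using V_nonnode word_nodes word_append
  by (metis (no_types, lifting) mod_0 not_less sum.neutral)

lemma lam_Nil_mul: "g \<in> V \<Longrightarrow> h \<in> V \<Longrightarrow> lam [] j (mul g h) = (lam [] j g + lam [] j h) mod int p"
  by (rule lam_mul[of _ _ _ 0]) (auto simp: word_0)

lemma lam_Nil_pow: "g \<in> V \<Longrightarrow> lam [] j (g [^]\<^bsub>VG\<^esub> (m::nat)) = (int m * lam [] j g) mod int p"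
proof (induction m)
  case (Suc m)
  have "g [^]\<^bsub>VG\<^esub> m \<in> V" using VG.nat_pow_closed[of g m] Suc.prems by simp
  then show ?case using Suc by (simp add: lam_Nil_mul mod_simps algebra_simps)
qed simp

text \<open>A Frattini argument. A proper \<open>Y\<close> lies in a proper normal \<open>X\<close>.
  The element for \<open>j = 0\<close> has a nonzero root label, so \<open>X\<close> contains the
  common kernel of all \<open>lam [] i\<close>. Modulo that kernel the given elements form a
  triangular system, which makes \<open>X\<close> everything.\<close>

lemma subgroup_eq_V_if_lam:
  assumes Y: "subgroup Y VG"
    and y: "\<And>j. j < n \<Longrightarrow> \<exists>y\<in>Y. (\<forall>i<j. lam [] i y = 0) \<and> lam [] j y \<noteq> 0"
  shows "Y = V"
proof (rule ccontr)
  assume neq: "Y \<noteq> V"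
  then obtain X where X: "X \<lhd> VG" "Y \<subseteq> X" "X \<noteq> V"
    using VG.proper_subgroup_le_normal[OF prime_p order_VG Y] unfolding VG_simps by metis
  interpret X: normal X VG by (rule X(1))
  have XV: "X \<subseteq> V" using X.subset by simp
  have n0: "n \<noteq> 0"
  proof
    assume "n = 0"
    then have "V = {\<lambda>_. 0}" using K_0 K_n by simp
    then show False using neq subgroup.one_closed[OF Y] subgroup.subset[OF Y] by auto
  qed
  obtain y0 where y0: "y0 \<in> Y" "lam [] 0 y0 \<noteq> 0" using y[of 0] n0 by auto
  have y0': "y0 [] \<noteq> 0" using y0(2) by (auto simp: lam_def word_0)
  have ker: "h \<in> X" if "h \<in> V" "\<And>i. lam [] i h = 0" for h
    by (rule normal_contains_lam_kernel[OF X(1), of 0 y0 "[]"])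
      (use XV X(2) y0 y0' that in \<open>auto simp: K_0 word_0\<close>)
  have "v \<in> X" if "j \<le> n" "v \<in> V" "\<forall>i<j. lam [] i v = 0" for j v
    using that
  proof (induction "n - j" arbitrary: j v)
    case 0
    have "lam [] i v = 0" for i
      using 0 lam_beyond[of v "[]" 0 i] by (cases "i < n") (auto simp: word_0)
    then show ?case using ker 0 by blast
  next
    case (Suc x)
    then have j: "j < n" "x = n - Suc j" by auto
    obtain z where z: "z \<in> Y" "\<forall>i<j. lam [] i z = 0" "lam [] j z \<noteq> 0" using y[OF j(1)] by blast
    have zX: "z \<in> X" and zV: "z \<in> V" using z X(2) XV by auto
    have "\<not> [lam [] j z = 0] (mod int p)" using z(3) by (simp add: cong_def)
    from solve_mod[OF this, of "- lam [] j v"]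
    obtain m :: nat where m: "[int m * lam [] j z = - lam [] j v] (mod int p)" by blast
    let ?z = "z [^]\<^bsub>VG\<^esub> m"
    have zmX: "?z \<in> X" by (induction m) (use zX X.one_closed X.m_closed in auto)
    then have zmV: "?z \<in> V" using XV by blast
    have "mul v ?z \<in> X"
    proof (rule Suc.hyps(1)[OF j(2)])
      show "\<forall>i<Suc j. lam [] i (mul v ?z) = 0"
      proof (intro allI impI)
        fix i assume "i < Suc j"
        then consider "i < j" | "i = j" by linarith
        then show "lam [] i (mul v ?z) = 0"
        proof cases
          case 2
          have "[lam [] j v + int m * lam [] j z = lam [] j v + - lam [] j v] (mod int p)"
            using m by (intro cong_add) auto
          then show ?thesis using 2 zmV zV Suc.prems
            by (simp add: lam_Nil_mul lam_Nil_pow mod_simps cong_def)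
        qed (use z zmV zV Suc.prems in \<open>auto simp: lam_Nil_mul lam_Nil_pow\<close>)
      qed
    qed (use j Suc.prems zmV in auto)
    then have "mul v ?z \<otimes>\<^bsub>VG\<^esub> inv\<^bsub>VG\<^esub> ?z \<in> X" using zmX X.m_closed by blast
    moreover have "mul v ?z \<otimes>\<^bsub>VG\<^esub> inv\<^bsub>VG\<^esub> ?z = v"
      using VG.inv_solve_right'[of v "mul v ?z" ?z] zmV Suc.prems by simp
    ultimately show ?case by simp
  qed
  from this[of 0] have "V \<subseteq> X" by auto
  then show False using X(3) XV by blast
qed

section \<open>Translations of a level\<close>

definition word_add :: "int list \<Rightarrow> int list \<Rightarrow> int list" where
  "word_add u s = map2 (\<lambda>a b. (a + b) mod int p) u s"

text \<open>Labels depend only on the depth. For \<open>s\<close> in \<open>word k\<close> with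
  \<open>k \<le> n\<close> these portraits act on level \<open>k\<close> by adding \<open>s\<close>,
  hence regularly, and a sum over them is a sum over the level.\<close>

definition translation :: "int list \<Rightarrow> int list \<Rightarrow> int" where
  "translation s = (\<lambda>v. if v \<in> nodes \<and> length v < length s then (s ! length v) mod int p else 0)"

lemma translation_V [simp, intro]: "translation s \<in> V"
  by (auto simp: translation_def V_def)

lemma trans_vanish: "length s \<le> length v \<Longrightarrow> translation s v = 0"
  by (simp add: translation_def)

lemma set_map2_mod: "set (map2 (\<lambda>a b. (a + b) mod int p) u s) \<subseteq> {0..<int p}"
  by (induction u s rule: list_induct2') auto

lemma add_word: "u \<in> word k \<Longrightarrow> s \<in> word k \<Longrightarrow> word_add u s \<in> word k"
  using set_map2_mod by (simp add: word_add_def word_def)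

lemma act_trans:
  assumes u: "u \<in> word k" and s: "s \<in> word k" and k: "k \<le> n"
  shows "act (translation s) u = word_add u s"
proof -
  have "act (translation s) (take i u) = take i (word_add u s)" if "i \<le> k" for i
    using that
  proof (induction i)
    case (Suc i)
    have l: "length u = k" "length s = k" using u s by (auto simp: word_def)
    have "take i u \<in> nodes" using word_take[OF u, of i] word_nodes Suc.prems k by auto
    then show ?case using Suc l
      by (simp add: take_Suc_conv_app_nth act_snoc mod_simps translation_def word_add_def)
  qed simp
  from this[of k] show ?thesis using length_word[OF u] length_word[OF add_word[OF u s]] by simp
qed

lemma bij_add: assumes u: "u \<in> word k" shows "bij_betw (word_add u) (word k) (word k)"
proof -
  have "inj_on (word_add u) (word k)"
  proof (rule inj_onI)
    fix s t assume st: "s \<in> word k" "t \<in> word k" "word_add u s = word_add u t"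
    have l: "length u = k" "length s = k" "length t = k" using u st by (auto simp: word_def)
    show "s = t"
    proof (rule nth_equalityI)
      fix i assume i: "i < length s"
      have "word_add u s ! i = word_add u t ! i" using st by simp
      then have "(s ! i + u ! i) mod int p = (t ! i + u ! i) mod int p"
        using i l by (simp add: word_add_def add.commute)
      moreover have "s ! i \<in> set s" "t ! i \<in> set t" using i l by auto
      then have "s ! i \<in> {0..<int p}" "t ! i \<in> {0..<int p}" using st(1,2) by (auto simp: word_def)
      ultimately show "s ! i = t ! i" using shift_mod_inj by blast
    qed (use l in simp)
  qed
  moreover from this have "word_add u ` word k = word k"
    by (intro endo_inj_surj) (use add_word[OF u] in auto)
  ultimately show ?thesis by (simp add: bij_betw_def)
qed

lemma add_zeros: "s \<in> word k \<Longrightarrow> word_add (replicate k 0) s = s"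
  unfolding word_add_def by (rule nth_equalityI) (auto simp: word_def dest!: nth_mem)

text \<open>Multiplying the translates of \<open>d\<close> gives an element whose branch sums are
  the same at every node of level \<open>k\<close>. The hypothesis \<open>inv\<close> speaks of
  branch sums rather than normality, so that it also covers \<open>L \<inter> K k\<close>.\<close>

lemma lam_sum_translates:
  assumes D: "subgroup D VG" "D \<subseteq> K k" and kn: "k \<le> n"
    and inv: "\<And>d t. d \<in> D \<Longrightarrow> t \<in> V \<Longrightarrow> \<exists>d'\<in>D. \<forall>u\<in>word k. \<forall>i. lam (act t u) i d' = lam u i d"
    and d: "d \<in> D"
  shows "\<exists>d'\<in>D. \<forall>u\<in>word k. \<forall>i. lam u i d' = (\<Sum>u'\<in>word k. lam u' i d) mod int p"
proof -
  interpret D: subgroup D VG by fact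
  have single: "\<exists>d'\<in>D. \<forall>u\<in>word k. \<forall>i. lam u i d' = lam (word_add u s) i d" if s: "s \<in> word k" for s
  proof -
    let ?t = "inv\<^bsub>VG\<^esub> (translation s)"
    obtain d' where d': "d' \<in> D" "\<And>u i. u \<in> word k \<Longrightarrow> lam (act ?t u) i d' = lam u i d"
      using inv[OF d, of ?t] by auto
    have "lam u i d' = lam (word_add u s) i d" if u: "u \<in> word k" for u i
    proof -
      have "act ?t (word_add u s) = act (mul ?t (translation s)) u"
        using act_mul[OF u kn] act_trans[OF u s kn] by simp
      also have "mul ?t (translation s) = (\<lambda>_. 0)" using VG.l_inv[of "translation s"] by simp
      finally have "act ?t (word_add u s) = u" using act_0[OF u] by simp
      then show ?thesis using d'(2)[OF add_word[OF u s], of i] by simp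
    qed
    then show ?thesis using d'(1) by blast
  qed
  have "\<exists>d'\<in>D. \<forall>u\<in>word k. \<forall>i. lam u i d' = (\<Sum>s\<in>S. lam (word_add u s) i d) mod int p"
    if "finite S" "S \<subseteq> word k" for S
    using that
  proof (induction S)
    case empty
    show ?case by (rule bexI[of _ "\<lambda>_. 0"]) (use D.one_closed in auto)
  next
    case (insert s S)
    obtain a where a: "a \<in> D" "\<forall>u\<in>word k. \<forall>i. lam u i a = (\<Sum>s\<in>S. lam (word_add u s) i d) mod int p"
      using insert by auto
    obtain b where b: "b \<in> D" "\<forall>u\<in>word k. \<forall>i. lam u i b = lam (word_add u s) i d"
      using single[of s] insert.prems by blast
    have ab: "a \<in> K k" "b \<in> K k" using a b D(2) by auto
    show ?case
    proof (intro bexI[of _ "mul a b"] ballI allI)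
      show "mul a b \<in> D" using D.m_closed[OF a(1) b(1)] by simp
      show "lam u i (mul a b) = (\<Sum>s\<in>insert s S. lam (word_add u s) i d) mod int p" if u: "u \<in> word k" for u i
        using lam_mul[OF K_V[OF ab(1)] K_V[OF ab(2)] u K_act[OF ab(2) u]] a(2) b(2) u insert.hyps
        by (simp add: mod_simps add.commute)
    qed
  qed
  from this[of "word k"] obtain d' where d': "d' \<in> D"
    "\<forall>u\<in>word k. \<forall>i. lam u i d' = (\<Sum>s\<in>word k. lam (word_add u s) i d) mod int p" by auto
  have "(\<Sum>s\<in>word k. lam (word_add u s) i d) = (\<Sum>u'\<in>word k. lam u' i d)" if "u \<in> word k" for u i
    by (rule sum.reindex_bij_betw[OF bij_add[OF that]])
  then show ?thesis using d' by auto
qed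

end

section \<open>Consequences of having a complement\<close>

locale complemented = portraits +
  fixes N L :: "(int list \<Rightarrow> int) set" and k :: nat
  assumes normal_N: "N \<lhd> VG" and sub_L: "subgroup L VG"
    and prod_NL: "\<And>x. x \<in> V \<Longrightarrow> \<exists>m\<in>N. \<exists>l\<in>L. x = mul m l"
    and int_NL: "N \<inter> L = {\<lambda>_. 0}"
    and N_K: "N \<subseteq> K k" and N_not_K: "\<not> N \<subseteq> K (Suc k)" and k_n: "k < n"
begin

sublocale N: normal N VG by (rule normal_N)
sublocale L: subgroup L VG by (rule sub_L)

lemma N_V: "x \<in> N \<Longrightarrow> x \<in> V" using N.mem_carrier by simp
lemma L_V: "x \<in> L \<Longrightarrow> x \<in> V" using L.mem_carrier by simp

lemma lam_kernel: "h \<in> K k \<Longrightarrow> (\<And>u i. u \<in> word k \<Longrightarrow> lam u i h = 0) \<Longrightarrow> h \<in> N"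
proof -
  obtain g where g: "g \<in> N" "g \<notin> K (Suc k)" using N_not_K by blast
  then obtain u where u: "u \<in> word k" "g u \<noteq> 0" using K_SucI[of g k] N_K by blast
  show "h \<in> K k \<Longrightarrow> (\<And>u i. u \<in> word k \<Longrightarrow> lam u i h = 0) \<Longrightarrow> h \<in> N"
    by (rule normal_contains_lam_kernel[OF normal_N N_K g(1) u])
qed

lemma eq_lam_N:
  assumes "a \<in> K k" "b \<in> K k" "\<And>u i. u \<in> word k \<Longrightarrow> lam u i a = lam u i b"
  shows "mul a (inv\<^bsub>VG\<^esub> b) \<in> N"
proof (rule lam_kernel)
  have ab: "a \<in> V" "b \<in> V" using assms K_V by auto
  have h: "mul a (inv\<^bsub>VG\<^esub> b) \<in> K k"
    using subgroup.m_closed[OF K_subgroup assms(1) subgroup.m_inv_closed[OF K_subgroup assms(2)]] by simp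
  then show "mul a (inv\<^bsub>VG\<^esub> b) \<in> K k" .
  fix u i assume u: "u \<in> word k"
  have "mul (mul a (inv\<^bsub>VG\<^esub> b)) b = a" using VG.inv_solve_right[of "mul a (inv\<^bsub>VG\<^esub> b)" a b] ab by simp
  then have "lam u i a = (lam u i (mul a (inv\<^bsub>VG\<^esub> b)) + lam u i b) mod int p"
    using lam_mul[OF K_V[OF h] ab(2) u K_act[OF assms(2) u]] by simp
  then have "[lam u i (mul a (inv\<^bsub>VG\<^esub> b)) + lam u i b = 0 + lam u i b] (mod int p)"
    using assms(3)[OF u, of i] by (simp add: cong_def)
  then have "[lam u i (mul a (inv\<^bsub>VG\<^esub> b)) = 0] (mod int p)" by (simp only: cong_add_rcancel)
  then show "lam u i (mul a (inv\<^bsub>VG\<^esub> b)) = 0" by (simp add: cong_def)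
qed

lemma N_translates:
  "d \<in> N \<Longrightarrow> t \<in> V \<Longrightarrow> \<exists>d'\<in>N. \<forall>u\<in>word k. \<forall>i. lam (act t u) i d' = lam u i d"
  using normal_conj[OF normal_N, of t d] lam_conj[of t d] K_act[of d k] N_V N_K
  by (intro bexI[of _ "conjugate t d"]) auto

text \<open>\<open>L\<close> need not be normal, but \<open>t = mul m l\<close> with
  \<open>m \<in> N\<close> acts on level \<open>k\<close> as \<open>l\<close> does, because
  \<open>N\<close> lies in \<open>K k\<close>; and conjugating by \<open>l\<close> keeps
  \<open>d\<close> in \<open>L\<close>.\<close>

lemma L_translates:
  assumes d: "d \<in> L \<inter> K k" and t: "t \<in> V"
  shows "\<exists>d'\<in>L \<inter> K k. \<forall>u\<in>word k. \<forall>i. lam (act t u) i d' = lam u i d"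
proof -
  obtain m l where ml: "m \<in> N" "l \<in> L" "t = mul m l" using prod_NL[OF t] by blast
  show ?thesis
  proof (intro bexI[of _ "conjugate l d"] ballI allI)
    fix u i assume u: "u \<in> word k"
    have "act t u = act m (act l u)" using act_mul[OF u] k_n ml(3) by simp
    also have "\<dots> = act l u" using K_act[of m k] ml(1) N_K u by blast
    finally show "lam (act t u) i (conjugate l d) = lam u i d"
      using lam_conj[OF L_V[OF ml(2)] _ u, of d i] K_act[of d k] d u K_V by auto
  next
    have "conjugate l d \<in> L" using ml(2) d L.m_closed[of "mul l d" "inv\<^bsub>VG\<^esub> l"] L.m_closed[of l d]
      by (simp add: conjugate_def)
    then show "conjugate l d \<in> L \<inter> K k" using conj_K[OF L_V[OF ml(2)]] d by blast
  qed
qed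

lemma subgroup_LK: "subgroup (L \<inter> K k) VG"
  by (rule VG.subgroups_Inter_pair[OF sub_L K_subgroup])

text \<open>
  Split the part of \<open>z\<close> below the first node of level \<open>k\<close> along \<open>N\<close> and \<open>L\<close>, and sum its translates over
  level \<open>k\<close>: the \<open>L\<close>-part of the sum lies in \<open>N \<inter> L\<close>, so it contributes nothing.
\<close>

lemma norm_in_N:
  assumes z: "z \<in> N" and const: "\<And>u i. u \<in> word k \<Longrightarrow> lam u i z = lam (replicate k 0) i z"
  shows "\<exists>m\<in>N. \<forall>i. lam [] (k + i) m = lam (replicate k 0) i z"
proof -
  let ?o = "replicate k (0::int)"
  have zK: "z \<in> K k" and zV: "z \<in> V" using z N_K N_V by auto
  define b where "b = (\<lambda>v. if take k v = ?o then z v else 0)"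
  have bV: "b \<in> V" using V_range[OF zV] zV by (auto simp: b_def V_def)
  then have bK: "b \<in> K k" using zK by (auto simp: b_def K_def)
  have lamb: "lam u i b = (if u = ?o then lam ?o i z else 0)" if "u \<in> word k" for u i
    using that by (auto simp: lam_def b_def length_word)
  obtain m a where ma: "m \<in> N" "a \<in> L" "b = mul m a" using prod_NL[OF bV] by blast
  have mK: "m \<in> K k" using ma N_K by blast
  have "a = mul (inv\<^bsub>VG\<^esub> m) b"
    using VG.inv_solve_left[of a m b] ma N_V L_V bV by auto
  then have aK: "a \<in> K k"
    using subgroup.m_closed[OF K_subgroup subgroup.m_inv_closed[OF K_subgroup mK] bK] by simp
  have kn: "k \<le> n" using k_n by simp
  obtain m2 where m2: "m2 \<in> N" "\<forall>u\<in>word k. \<forall>i. lam u i m2 = (\<Sum>u'\<in>word k. lam u' i m) mod int p"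
    using lam_sum_translates[OF N.subgroup_axioms N_K kn N_translates ma(1)] by blast
  obtain a2 where a2: "a2 \<in> L" "a2 \<in> K k" "\<forall>u\<in>word k. \<forall>i. lam u i a2 = (\<Sum>u'\<in>word k. lam u' i a) mod int p"
    using lam_sum_translates[OF subgroup_LK _ kn L_translates, of a] aK ma(2) by blast
  have sum: "((\<Sum>u'\<in>word k. lam u' i m) + (\<Sum>u'\<in>word k. lam u' i a)) mod int p = lam ?o i z" for i
  proof -
    have "lam u i b = (lam u i m + lam u i a) mod int p" if "u \<in> word k" for u
      using lam_mul[OF N_V[OF ma(1)] L_V[OF ma(2)] that K_act[OF aK that]] ma(3) by simp
    then have "(\<Sum>u\<in>word k. lam u i b) = (\<Sum>u\<in>word k. (lam u i m + lam u i a) mod int p)"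
      by (intro sum.cong) auto
    then have "(\<Sum>u\<in>word k. lam u i b) mod int p = ((\<Sum>u'\<in>word k. lam u' i m) + (\<Sum>u'\<in>word k. lam u' i a)) mod int p"
      by (simp add: mod_sum_eq sum.distrib)
    moreover have "(\<Sum>u\<in>word k. lam u i b) = lam ?o i z" using lamb by (simp add: sum.delta)
    ultimately show ?thesis by simp
  qed
  have m2K: "m2 \<in> K k" using m2 N_K by blast
  have m2a2: "mul m2 a2 \<in> K k" using subgroup.m_closed[OF K_subgroup m2K a2(2)] by simp
  \<comment> \<open>\<open>mul m2 a2\<close> and \<open>z\<close> have equal branch sums, so they
    agree modulo \<open>N\<close>. Hence \<open>a2\<close> lies in \<open>N\<close> as well as in
    \<open>L\<close>.\<close>
  have "mul (mul m2 a2) (inv\<^bsub>VG\<^esub> z) \<in> N"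
  proof (rule eq_lam_N[OF m2a2 zK])
    fix u i assume u: "u \<in> word k"
    have "lam u i (mul m2 a2) = (lam u i m2 + lam u i a2) mod int p"
      by (rule lam_mul[OF _ _ u]) (use m2K a2 K_V K_act u in auto)
    then show "lam u i (mul m2 a2) = lam u i z" using m2(2) a2(3) u sum const[OF u] by (simp add: mod_simps)
  qed
  then have "mul (mul (mul m2 a2) (inv\<^bsub>VG\<^esub> z)) z \<in> N" using N.m_closed z by fastforce
  moreover have "mul (mul (mul m2 a2) (inv\<^bsub>VG\<^esub> z)) z = mul m2 a2"
    using VG.inv_solve_right[of "mul (mul m2 a2) (inv\<^bsub>VG\<^esub> z)" "mul m2 a2" z] zV K_V[OF m2a2] by simp
  ultimately have "mul m2 a2 \<in> N" by simp
  then have "mul (inv\<^bsub>VG\<^esub> m2) (mul m2 a2) \<in> N"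
    using N.m_closed[OF N.m_inv_closed[OF m2(1)]] by simp
  moreover have "mul (inv\<^bsub>VG\<^esub> m2) (mul m2 a2) = a2"
    using VG.inv_mult_cancel(1)[of m2 a2] K_V[OF m2K] K_V[OF a2(2)] by simp
  ultimately have "a2 = (\<lambda>_. 0)" using a2(1) int_NL by auto
  then have "(\<Sum>u'\<in>word k. lam u' i a) mod int p = 0" for i
    using a2(3) zeros_word[of k] by (metis lam_zero)
  then have "(\<Sum>u'\<in>word k. lam u' i m) mod int p = lam ?o i z" for i
    using sum[of i] by (metis add.right_neutral mod_add_right_eq)
  then show ?thesis using ma(1) by (intro bexI[of _ m]) (auto simp: lam_Nil_split)
qed

text \<open>A nontrivial intersection would contain a nontrivial central element \<open>z\<close> of
  the \<open>p\<close>-group \<open>C\<close>. Commuting with the translations makes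
  \<open>z\<close> look the same below every node of level \<open>k\<close>, so
  \<open>norm_in_N\<close> applies and supplies \<open>m\<close>. Only the final contradiction
  depends on the form of \<open>C\<close>, hence the hypothesis \<open>zero\<close>.\<close>

lemma trivial_intersection:
  assumes C: "subgroup C VG" and tC: "\<And>s. s \<in> word k \<Longrightarrow> translation s \<in> C"
    and zero: "\<And>z m. z \<in> N \<inter> C \<Longrightarrow> m \<in> N \<Longrightarrow> (\<And>i. lam [] (k + i) m = lam (replicate k 0) i z) \<Longrightarrow>
      (\<And>u w. u \<in> word k \<Longrightarrow> z (u @ w) = z (replicate k 0 @ w)) \<Longrightarrow> z = (\<lambda>_. 0)"
  shows "N \<inter> C = {\<lambda>_. 0}"
proof (rule ccontr)
  assume neq: "N \<inter> C \<noteq> {\<lambda>_. 0}"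
  interpret C: subgroup C VG by fact
  let ?C = "VG\<lparr>carrier := C\<rparr>"
  interpret CG: group ?C using C by (rule VG.subgroup_imp_group)
  obtain l where "card C = p ^ l" using VG.order_subgroup_prime_power[OF prime_p order_VG C] by blast
  then have ord: "order ?C = p ^ l" by (simp add: order_def)
  have "N \<inter> C \<lhd> ?C"
    using VG.normal_Int_subgroup[OF C normal_N] by (simp add: Int_commute)
  moreover have "N \<inter> C \<noteq> {\<one>\<^bsub>?C\<^esub>}" using neq by simp
  ultimately obtain z where z: "z \<in> N \<inter> C" "z \<noteq> \<one>\<^bsub>?C\<^esub>"
    "\<And>g. g \<in> carrier ?C \<Longrightarrow> g \<otimes>\<^bsub>?C\<^esub> z = z \<otimes>\<^bsub>?C\<^esub> g"
    using CG.normal_meets_center[OF prime_p ord] by blast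
  have zV: "z \<in> V" and zK: "z \<in> K k" using z N_V N_K by auto
  have const: "z (u @ w) = z (replicate k 0 @ w)" if u: "u \<in> word k" for u w
  proof (cases "w \<in> word (length w)")
    case True
    let ?x = "replicate k (0::int) @ w"
    have x: "?x \<in> word (k + length w)" using word_append[OF zeros_word True] .
    have "mul (translation u) z = mul z (translation u)" using z(3)[of "translation u"] tC[OF u] by simp
    from mul_eqD[OF this translation_V zV zV translation_V x]
    have "[z ?x + translation u (act z ?x) = translation u ?x + z (act (translation u) ?x)] (mod int p)" .
    moreover have "translation u ?x = 0" "translation u (act z ?x) = 0"
      by (rule trans_vanish, simp add: length_word[OF u])+
    moreover have "act (translation u) ?x = u @ w"
    proof -
      have "act (\<lambda>v. translation u (replicate k 0 @ v)) w = w"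
        by (rule act_fix[OF True]) (simp add: trans_vanish length_word[OF u])
      then show ?thesis using act_trans[OF zeros_word u] k_n add_zeros[OF u] by (simp add: act_append)
    qed
    ultimately have "[z ?x = z (u @ w)] (mod int p)" by simp
    then show ?thesis using zV by (simp add: cong_def)
  next
    case False
    then have "u' @ w \<notin> nodes" for u' using nodesD word_appendD by blast
    then show ?thesis using V_nonnode[OF zV] by simp
  qed
  have lamc: "lam u i z = lam (replicate k 0) i z" if "u \<in> word k" for u i
    unfolding lam_def by (simp only: const[OF that])
  obtain m where m: "m \<in> N" "\<And>i. lam [] (k + i) m = lam (replicate k 0) i z"
    using norm_in_N[OF IntD1[OF z(1)] lamc] by blast
  have "z = (\<lambda>_. 0)" by (rule zero[OF z(1) m const])
  then show False using z(2) by simp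
qed

end

context portraits
begin

section \<open>Standard complements\<close>

definition special :: "int list \<Rightarrow> bool" where
  "special w \<longleftrightarrow> (\<exists>i. \<exists>a\<in>{1..<int p}. w = replicate i 0 @ [a])"

text \<open>
  Below a node of level \<open>k\<close> only the pairwise incomparable nodes \<open>0 \<dots> 0 a\<close> with \<open>a \<noteq> 0\<close> carry a value, so
  these values commute; taking them independent of \<open>a\<close> makes the set invariant under the torus.
\<close>

definition std_comp :: "nat \<Rightarrow> nat set \<Rightarrow> (int list \<Rightarrow> int) set" where
  "std_comp k J = {g \<in> V.
     (\<forall>u\<in>word k. \<forall>w. g (u @ w) \<noteq> 0 \<longrightarrow> special w \<and> k + length w \<in> J) \<and>
     (\<forall>u\<in>word k. \<forall>i. \<forall>a\<in>{1..<int p}. g (u @ replicate i 0 @ [a]) = g (u @ replicate i 0 @ [1]))}"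

lemma special_snoc: "a \<in> {1..<int p} \<Longrightarrow> special (x @ [a]) \<longleftrightarrow> (\<exists>i. x = replicate i 0)"
  by (auto simp: special_def)

lemma special_word: "special w \<Longrightarrow> w \<in> word (length w)"
  by (auto simp: special_def word_def)

lemma not_special_zeros: "\<not> special (replicate i 0)"
proof
  assume "special (replicate i 0)"
  then obtain m a where a: "a \<in> {1..<int p}" "replicate i 0 = replicate m 0 @ [a]"
    by (auto simp: special_def)
  then have "a \<in> set (replicate i (0::int))" by simp
  then show False using a(1) by (simp split: if_splits)
qed

text \<open>There are \<open>p - 1\<close> special words of each positive length, and
  \<open>p - 1\<close> is \<open>-1\<close> modulo \<open>p\<close>. Thus the sum detects the common
  label \<open>c\<close>.\<close>

lemma sum_special:
  assumes "\<And>w. w \<in> word (Suc i) \<Longrightarrow> f w = (if special w then c else 0)"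
  shows "[(\<Sum>w\<in>word (Suc i). f w) = - c] (mod int p)"
proof -
  have eq: "{w \<in> word (Suc i). special w} = (\<lambda>a. replicate i 0 @ [a]) ` {1..<int p}"
    by (auto simp: special_def word_def)
  have "(\<Sum>w\<in>word (Suc i). f w) = (\<Sum>w\<in>word (Suc i). if special w then c else 0)"
    by (rule sum.cong) (auto simp: assms)
  also have "\<dots> = (\<Sum>w\<in>{w \<in> word (Suc i). special w}. c)"
    by (rule sum.inter_filter[symmetric]) simp
  also have "\<dots> = int (card ((\<lambda>a. replicate i (0::int) @ [a]) ` {1..<int p})) * c"
    by (simp add: eq)
  also have "card ((\<lambda>a. replicate i (0::int) @ [a]) ` {1..<int p}) = nat (int p - 1)"
    by (subst card_image) (auto simp: inj_on_def)
  also have "int (nat (int p - 1)) * c = int p * c - c" using p_gt_1 by (simp add: algebra_simps)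
  finally show ?thesis by (simp add: cong_def mod_diff_left_eq[symmetric])
qed

lemma comp_V: "g \<in> std_comp k J \<Longrightarrow> g \<in> V" by (simp add: std_comp_def)

lemma comp_low: "g \<in> V \<Longrightarrow> (\<And>v. k \<le> length v \<Longrightarrow> g v = 0) \<Longrightarrow> g \<in> std_comp k J"
  by (auto simp: std_comp_def length_word)

lemma comp_empty: "std_comp k {} = {g \<in> V. \<forall>v. k \<le> length v \<longrightarrow> g v = 0}"
proof (intro subset_antisym subsetI)
  fix g assume g: "g \<in> std_comp k {}"
  have "g v = 0" if "k \<le> length v" for v
  proof (cases "v \<in> nodes")
    case True
    then have "take k v \<in> word k" using nodesD word_take that by blast
    then have "g (take k v @ drop k v) = 0" using g unfolding std_comp_def by blast
    then show ?thesis by simp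
  qed (use g comp_V V_nonnode in blast)
  then show "g \<in> {g \<in> V. \<forall>v. k \<le> length v \<longrightarrow> g v = 0}" using g comp_V by blast
qed (auto intro: comp_low)

text \<open>The proper prefixes of a special word are zero words; these are not special, so
  \<open>h\<close> has label \<open>0\<close> there.\<close>

lemma comp_fix:
  assumes h: "h \<in> std_comp k J" and u: "u \<in> word k" and w: "special w"
  shows "act (\<lambda>v. h (u @ v)) w = w"
proof (rule act_fix[OF special_word[OF w]])
  fix m assume m: "m < length w"
  obtain i a where "w = replicate i 0 @ [a]" using w by (auto simp: special_def)
  then have "take m w = replicate m 0" using m by (simp add: min_def)
  then have "\<not> special (take m w)" using not_special_zeros by simp
  then show "h (u @ take m w) = 0" using h u unfolding std_comp_def by blast
qed

lemma comp_special_iff: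
  assumes h: "h \<in> std_comp k J" and u: "u \<in> word k" and w: "w \<in> word j"
  shows "special (act (\<lambda>v. h (u @ v)) w) \<longleftrightarrow> special w"
proof
  let ?h = "\<lambda>v. h (u @ v)"
  assume s: "special (act ?h w)"
  then have "act ?h (act ?h w) = act ?h w" by (rule comp_fix[OF h u])
  then have "act ?h w = w" using act_inj[OF act_word[OF w] w] by blast
  then show "special w" using s by simp
qed (use comp_fix[OF h u] in simp)

text \<open>Below a node of level \<open>k\<close> special words are fixed and nonspecial ones stay
  nonspecial, so in a product the labels at corresponding special nodes simply add.\<close>

lemma comp_subgroup: "subgroup (std_comp k J) VG"
proof (rule VG.subgroup_if_finite_closed)
  fix g h assume gh: "g \<in> std_comp k J" "h \<in> std_comp k J"
  have V: "g \<in> V" "h \<in> V" using gh comp_V by auto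
  have app: "mul g h (u @ w) = (h (u @ w) + g (act h u @ act (\<lambda>v. h (u @ v)) w)) mod int p"
    if "u \<in> word k" "w \<in> word j" for u w j
    using mul_apply[OF V word_append[OF that]] by (simp add: act_append)
  have "mul g h \<in> std_comp k J"
    unfolding std_comp_def
  proof (intro CollectI conjI ballI allI impI)
    show "mul g h \<in> V" using V by blast
    fix u assume u: "u \<in> word k"
    have u': "act h u \<in> word k" using u by (rule act_word)
    {
      fix w assume nz: "mul g h (u @ w) \<noteq> 0"
      have "u @ w \<in> nodes" by (rule ccontr) (use nz in \<open>simp add: mul_def\<close>)
      then have w: "w \<in> word (length w)" using nodesD word_appendD by blast
      let ?w = "act (\<lambda>v. h (u @ v)) w"
      have "h (u @ w) \<noteq> 0 \<or> g (act h u @ ?w) \<noteq> 0" using nz app[OF u w] by auto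
      then have "special w \<and> k + length w \<in> J \<or> special ?w \<and> k + length ?w \<in> J"
        using gh u u' unfolding std_comp_def by blast
      then have "special w \<and> k + length w \<in> J" using comp_special_iff[OF gh(2) u w] by simp
      then show "special w" "k + length w \<in> J" by auto
    }
    fix i and a assume a: "a \<in> {1..<int p}"
    have one: "1 \<in> {1..<int p}" using p_gt_1 by simp
    have eq: "mul g h (u @ replicate i 0 @ [b]) =
        (h (u @ replicate i 0 @ [b]) + g (act h u @ replicate i 0 @ [b])) mod int p"
      if b: "b \<in> {1..<int p}" for b
    proof -
      have sp: "special (replicate i 0 @ [b])" using b by (auto simp: special_def)
      show ?thesis using app[OF u special_word[OF sp]] comp_fix[OF gh(2) u sp] by simp
    qed
    have "h (u @ replicate i 0 @ [a]) = h (u @ replicate i 0 @ [1])"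
      "g (act h u @ replicate i 0 @ [a]) = g (act h u @ replicate i 0 @ [1])"
      using gh u u' a unfolding std_comp_def by blast+
    then show "mul g h (u @ replicate i 0 @ [a]) = mul g h (u @ replicate i 0 @ [1])"
      using eq[OF a] eq[OF one] by simp
  qed
  then show "g \<otimes>\<^bsub>VG\<^esub> h \<in> std_comp k J" by simp
qed (auto simp: std_comp_def)

lemma lev_comp: "j < k \<Longrightarrow> lev j f \<in> std_comp k J"
  by (rule comp_low[OF lev_V]) (auto simp: lev_def word_def)

lemma trans_comp: "s \<in> word m \<Longrightarrow> m \<le> k \<Longrightarrow> translation s \<in> std_comp k J"
  by (rule comp_low[OF translation_V]) (auto simp: translation_def word_def)

text \<open>Since \<open>k < length v\<close>, the support lies below the zero word of level
  \<open>k\<close>. By \<open>lam_spread\<close> these portraits realize, up to sign, prescribed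
  coordinates \<open>lam [] j\<close> for \<open>j \<in> J\<close> inside
  \<open>std_comp k J\<close>.\<close>

definition spread :: "nat \<Rightarrow> nat set \<Rightarrow> (nat \<Rightarrow> int) \<Rightarrow> int list \<Rightarrow> int" where
  "spread k J f = (\<lambda>v. if v \<in> nodes \<and> k < length v \<and> length v \<in> J \<and> special v
     then f (length v) mod int p else 0)"

lemma spread_V [simp, intro]: "spread k J f \<in> V"
  by (auto simp: spread_def V_def)

lemma spread_comp: "spread k J f \<in> std_comp k J"
  unfolding std_comp_def
proof (intro CollectI conjI ballI allI impI)
  fix u assume u: "u \<in> word k"
  {
    fix w assume nz: "spread k J f (u @ w) \<noteq> 0"
    have lu: "length u = k" using u by (rule length_word)
    have *: "k < length (u @ w)" "length (u @ w) \<in> J" "special (u @ w)"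
      using nz by (auto simp: spread_def split: if_splits)
    then obtain i a where a: "a \<in> {1..<int p}" "u @ w = replicate i 0 @ [a]" by (auto simp: special_def)
    have "length (u @ w) = Suc i" using a(2) by simp
    then have "k \<le> i" using *(1) by simp
    then have "w = replicate (i - k) 0 @ [a]"
      using arg_cong[OF a(2), of "drop k"] lu by simp
    then show "special w" using a(1) by (auto simp: special_def)
    show "k + length w \<in> J" using *(2) lu by simp
  }
  fix i a assume a: "a \<in> {1..<int p}"
  have one: "1 \<in> {1..<int p}" using p_gt_1 by simp
  have "u @ replicate i 0 @ [b] \<in> nodes \<longleftrightarrow> k + Suc i < n" if "b \<in> {1..<int p}" for b
  proof -
    have "special (replicate i 0 @ [b])" using that by (auto simp: special_def)
    from word_nodes[OF word_append[OF u special_word[OF this]]] show ?thesis by simp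
  qed
  from this[OF a] this[OF one]
  show "spread k J f (u @ replicate i 0 @ [a]) = spread k J f (u @ replicate i 0 @ [1])"
    using special_snoc[OF a, of "u @ replicate i 0"] special_snoc[OF one, of "u @ replicate i 0"]
    by (auto simp: spread_def)
qed simp

lemma lam_spread:
  "[lam [] j (spread k J f) = (if k < j \<and> j < n \<and> j \<in> J then - f j else 0)] (mod int p)"
proof (cases "k < j \<and> j < n \<and> j \<in> J")
  case True
  then obtain i where i: "j = Suc i" by (cases j) auto
  have "[(\<Sum>w\<in>word (Suc i). spread k J f w) = - (f j mod int p)] (mod int p)"
    by (rule sum_special) (use True i in \<open>auto simp: spread_def word_nodes length_word\<close>)
  then show ?thesis using True i by (simp add: lam_def cong_def mod_minus_eq)
next
  case False
  have "spread k J f v = 0" if "v \<in> word j" for v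
    using False that by (auto simp: spread_def word_nodes length_word)
  then have "lam [] j (spread k J f) = 0" by (simp add: lam_def)
  then show ?thesis using False by auto
qed

lemma inj_on_mul:
  assumes A: "subgroup A VG" and B: "subgroup B VG" and AB: "A \<inter> B = {\<lambda>_. 0}"
  shows "inj_on (\<lambda>(a, b). mul a b) (A \<times> B)"
proof (rule inj_onI, clarify)
  interpret A: subgroup A VG by fact
  interpret B: subgroup B VG by fact
  fix a b a' b' assume ab: "a \<in> A" "b \<in> B" "a' \<in> A" "b' \<in> B" "mul a b = mul a' b'"
  have V: "a \<in> V" "b \<in> V" "a' \<in> V" "b' \<in> V" using ab A.mem_carrier B.mem_carrier by auto
  have "a = mul (mul a' b') (inv\<^bsub>VG\<^esub> b)"
    using VG.inv_solve_right[of a "mul a' b'" b] V ab(5) by simp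
  then have "mul (inv\<^bsub>VG\<^esub> a') a = mul (inv\<^bsub>VG\<^esub> a') (mul a' (mul b' (inv\<^bsub>VG\<^esub> b)))"
    using VG.m_assoc[of a' b' "inv\<^bsub>VG\<^esub> b"] V by simp
  then have eq: "mul (inv\<^bsub>VG\<^esub> a') a = mul b' (inv\<^bsub>VG\<^esub> b)"
    using VG.inv_mult_cancel(1)[of a' "mul b' (inv\<^bsub>VG\<^esub> b)"] V by simp
  have "mul (inv\<^bsub>VG\<^esub> a') a \<in> A" using A.m_closed[OF A.m_inv_closed[OF ab(3)] ab(1)] by simp
  moreover have "mul b' (inv\<^bsub>VG\<^esub> b) \<in> B" using B.m_closed[OF ab(4) B.m_inv_closed[OF ab(2)]] by simp
  ultimately have 0: "mul (inv\<^bsub>VG\<^esub> a') a = (\<lambda>_. 0)" using AB eq by auto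
  have "mul a' (mul (inv\<^bsub>VG\<^esub> a') a) = a" using VG.inv_mult_cancel(2)[of a' a] V by simp
  then have "a = a'" unfolding 0 using VG.r_one[of a'] V by simp
  moreover from this have "b = b'" using ab(5) V VG.inv_mult_cancel(1)[of a b] VG.inv_mult_cancel(1)[of a b'] by simp
  ultimately show "a = a' \<and> b = b'" by simp
qed

end

section \<open>Complementing N by a standard subgroup\<close>

context complemented
begin

text \<open>The label common to the special nodes of one depth is minus the branch sum there, so
  vanishing branch sums kill all labels below the zero word; constancy carries this to the other
  branches.\<close>

lemma zero_if_comp:
  assumes z: "z \<in> K k" "z \<in> std_comp k J" and const: "\<And>u w. u \<in> word k \<Longrightarrow> z (u @ w) = z (replicate k 0 @ w)"
    and lam: "\<And>i. lam (replicate k 0) i z = 0"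
  shows "z = (\<lambda>_. 0)"
proof (rule V_eqI)
  show zV: "z \<in> V" using z K_V by blast
  fix v j assume v: "j < n" "v \<in> word j"
  have "z v = 0"
  proof (cases "j < k")
    case True
    then show ?thesis using K_vanish[OF z(1)] v by (simp add: length_word)
  next
    case False
    then have tk: "take k v \<in> word k" using v word_take by simp
    have eq: "z v = z (replicate k 0 @ drop k v)" using const[OF tk, of "drop k v"] by simp
    show ?thesis
    proof (rule ccontr)
      assume nz: "z v \<noteq> 0"
      have o: "replicate k 0 \<in> word k" by simp
      have imp: "special w" if "z (replicate k 0 @ w) \<noteq> 0" for w
        using z(2) o that unfolding std_comp_def by blast
      have "special (drop k v)" using imp nz eq by simp
      then obtain i a where a: "a \<in> {1..<int p}" "drop k v = replicate i 0 @ [a]"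
        by (auto simp: special_def)
      let ?c = "z (replicate k 0 @ replicate i 0 @ [1])"
      have c: "z (replicate k 0 @ replicate i 0 @ [b]) = ?c" if "b \<in> {1..<int p}" for b
        using z(2) o that unfolding std_comp_def by blast
      have "[(\<Sum>w\<in>word (Suc i). z (replicate k 0 @ w)) = - ?c] (mod int p)"
      proof (rule sum_special)
        fix w assume w: "w \<in> word (Suc i)"
        show "z (replicate k 0 @ w) = (if special w then ?c else 0)"
        proof (cases "special w")
          case True
          then obtain m b where b: "b \<in> {1..<int p}" "w = replicate m 0 @ [b]" by (auto simp: special_def)
          then have "m = i" using w by (simp add: word_def)
          then have "z (replicate k 0 @ w) = ?c" using c[OF b(1)] b(2) by simp
          then show ?thesis using True by simp
        qed (use imp in auto)
      qed
      then have "[- ?c = 0] (mod int p)" using lam[of "Suc i"] by (simp add: lam_def cong_def)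
      then have "int p dvd ?c" by (simp add: cong_0_iff)
      then have "?c = 0" using V_range[OF zV] zdvd_imp_le by (metis V_mod dvd_imp_mod_0 zV)
      then show False using nz eq c[OF a(1)] a(2) by simp
    qed
  qed
  then show "[z v = 0] (mod int p)" by simp
qed simp

lemma mem_prodI: "m \<in> N \<Longrightarrow> c \<in> C \<Longrightarrow> mul m c \<in> N <#>\<^bsub>VG\<^esub> C"
  by (auto simp: set_mult_def)

text \<open>\<open>P J\<close> says that the image of \<open>N\<close> under the coordinates
  \<open>lam []\<close> meets the coordinate subspace of \<open>J\<close> trivially. For a maximal
  such \<open>J\<close> the product with \<open>std_comp k J\<close> is everything, by the exchange
  argument in the last case. Level \<open>k\<close> is left out of \<open>J\<close> because
  \<open>g0\<close> accounts for it.\<close>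

lemma complement_if_lam_nonzero:
  assumes g0: "g0 \<in> N" "lam [] k g0 \<noteq> 0"
  shows "\<exists>J. N \<inter> std_comp k J = {\<lambda>_. 0} \<and> N <#>\<^bsub>VG\<^esub> std_comp k J = V"
proof -
  define P where "P J \<longleftrightarrow> J \<subseteq> {k<..<n} \<and>
    (\<forall>m\<in>N. (\<forall>i. i \<notin> J \<longrightarrow> lam [] i m = 0) \<longrightarrow> (\<forall>i. lam [] i m = 0))" for J
  have "finite {J. P J}" by (rule finite_subset[of _ "Pow {k<..<n}"]) (auto simp: P_def)
  moreover have "P {}" by (simp add: P_def)
  ultimately obtain J where J: "P J" and max: "\<And>J'. P J' \<Longrightarrow> J \<subseteq> J' \<Longrightarrow> J' = J"
    using finite_has_maximal[of "{J. P J}"] by (metis empty_iff mem_Collect_eq)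
  have lowN: "lam [] j m = 0" if "m \<in> N" "j < k" for m j
  proof -
    have "m v = 0" if "v \<in> word j" for v
      using K_vanish[of m k v] \<open>m \<in> N\<close> N_K \<open>j < k\<close> that by (auto simp: length_word)
    then show ?thesis by (simp add: lam_def)
  qed
  have "N \<inter> std_comp k J = {\<lambda>_. 0}"
  proof (rule trivial_intersection[OF comp_subgroup])
    fix z m assume z: "z \<in> N \<inter> std_comp k J" and m: "m \<in> N" "\<And>i. lam [] (k + i) m = lam (replicate k 0) i z"
      and const: "\<And>u w. u \<in> word k \<Longrightarrow> z (u @ w) = z (replicate k 0 @ w)"
    have "lam [] j m = 0" if j: "j \<notin> J" for j
    proof (cases "j < k")
      case False
      then obtain i where i: "j = k + i" using le_Suc_ex by (metis not_less)
      have "z (replicate k 0 @ w) = 0" if "w \<in> word i" for w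
      proof (rule ccontr)
        have o: "replicate k 0 \<in> word k" by simp
        assume "z (replicate k 0 @ w) \<noteq> 0"
        then have "k + length w \<in> J" using z o unfolding std_comp_def by blast
        then show False using j i that by (simp add: length_word)
      qed
      then show ?thesis using m(2)[of i] i by (simp add: lam_def)
    qed (use lowN m in auto)
    then have "lam [] i m = 0" for i using J m(1) unfolding P_def by blast
    then have lamz: "lam (replicate k 0) i z = 0" for i using m(2) by metis
    show "z = (\<lambda>_. 0)"
      by (rule zero_if_comp[OF _ _ const lamz]) (use z N_K in blast)+
  qed (rule trans_comp, auto)
  moreover have "N <#>\<^bsub>VG\<^esub> std_comp k J = V"
  proof (rule subgroup_eq_V_if_lam)
    show "subgroup (N <#>\<^bsub>VG\<^esub> std_comp k J) VG" by (rule VG.mult_norm_subgroup[OF normal_N comp_subgroup])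
    interpret C: subgroup "std_comp k J" VG by (rule comp_subgroup)
    have C_prod: "c \<in> N <#>\<^bsub>VG\<^esub> std_comp k J" if "c \<in> std_comp k J" for c
      using mem_prodI[OF N.one_closed that] VG.l_one[of c] comp_V[OF that] by simp
    have N_prod: "m \<in> N <#>\<^bsub>VG\<^esub> std_comp k J" if "m \<in> N" for m
      using mem_prodI[OF that C.one_closed] VG.r_one[of m] N_V[OF that] by simp
    fix j assume j: "j < n"
    consider "j < k" | "j = k" | "k < j" "j \<in> J" | "k < j" "j \<notin> J" by linarith
    then show "\<exists>y\<in>N <#>\<^bsub>VG\<^esub> std_comp k J. (\<forall>i<j. lam [] i y = 0) \<and> lam [] j y \<noteq> 0"
    proof cases
      case 1
      let ?y = "lev j (\<lambda>v. of_bool (v = replicate j 0))"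
      have "lam [] i ?y = 0" if "i < j" for i
        using that by (simp add: lam_def lev_def) (auto simp: word_def)
      moreover have "lam [] j ?y = 1"
      proof -
        have "(\<Sum>v\<in>word j. ?y v) = (\<Sum>v\<in>word j. if v = replicate j 0 then 1 else 0)"
          using j p_gt_1 by (intro sum.cong) (auto simp: lev_def)
        then show ?thesis using p_gt_1 by (simp add: lam_def)
      qed
      ultimately show ?thesis using C_prod[OF lev_comp[OF 1]] by (metis zero_neq_one)
    next
      case 2
      then show ?thesis using g0 lowN N_prod by blast
    next
      case 3
      let ?y = "spread k J (\<lambda>i. of_bool (i = j))"
      have "[lam [] i ?y = 0] (mod int p)" if "i < j" for i
        using lam_spread[of i k J "\<lambda>i. of_bool (i = j)"] that by (auto split: if_splits)
      then have "lam [] i ?y = 0" if "i < j" for i using that by (simp add: cong_def)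
      moreover have "[lam [] j ?y = - 1] (mod int p)"
        using lam_spread[of j k J "\<lambda>i. of_bool (i = j)"] 3 j by simp
      then have "lam [] j ?y \<noteq> 0" using p_gt_1
        by (metis cong_0_iff cong_sym dvd_minus_iff int_dvd_int_iff nat_dvd_1_iff_1 of_nat_1 less_irrefl)
      ultimately show ?thesis using C_prod[OF spread_comp] by blast
    next
      case 4
      \<comment> \<open>Maximality yields an element of \<open>N\<close> supported on the
        coordinates \<open>insert j J\<close> with nonzero \<open>j\<close>-th one;
        \<open>?y\<close> then cancels its coordinates in \<open>J\<close>.\<close>
      have "\<not> P (insert j J)" using max[of "insert j J"] 4 by blast
      then obtain m where m: "m \<in> N" "\<And>i. i \<notin> insert j J \<Longrightarrow> lam [] i m = 0" "\<exists>i. lam [] i m \<noteq> 0"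
        using J 4 j unfolding P_def by auto
      have mj: "lam [] j m \<noteq> 0"
      proof
        assume "lam [] j m = 0"
        then have "\<forall>i. i \<notin> J \<longrightarrow> lam [] i m = 0" using m(2) by (metis insert_iff)
        then show False using m(1,3) J unfolding P_def by blast
      qed
      let ?y = "spread k J (\<lambda>i. lam [] i m)"
      have JS: "J \<subseteq> {k<..<n}" using J by (simp add: P_def)
      have prod: "[lam [] i (mul m ?y) = lam [] i m + (if i \<in> J then - lam [] i m else 0)] (mod int p)" for i
      proof -
        have "lam [] i (mul m ?y) = (lam [] i m + lam [] i ?y) mod int p"
          using N_V[OF m(1)] by (intro lam_Nil_mul) auto
        also have "[\<dots> = lam [] i m + (if i \<in> J then - lam [] i m else 0)] (mod int p)"
        proof -
          have "(k < i \<and> i < n \<and> i \<in> J) \<longleftrightarrow> i \<in> J" using JS by auto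
          then have "[lam [] i ?y = (if i \<in> J then - lam [] i m else 0)] (mod int p)"
            using lam_spread[of i k J "\<lambda>i. lam [] i m"] by presburger
          then show ?thesis by (simp only: cong_mod_left cong_add_lcancel)
        qed
        finally show ?thesis .
      qed
      have "lam [] i (mul m ?y) = 0" if "i < j" for i
        using prod[of i] m(2)[of i] that by (cases "i \<in> J") (auto simp: cong_def)
      moreover have "lam [] j (mul m ?y) \<noteq> 0" using prod[of j] 4 mj by (simp add: cong_def)
      ultimately show ?thesis using mem_prodI[OF m(1) spread_comp] by blast
    qed
  qed
  ultimately show ?thesis by blast
qed

lemma card_prod_NL: "card N * card L = card V"
proof -
  have "card N * card L = card ((\<lambda>(m, l). mul m l) ` (N \<times> L))"
    using inj_on_mul[OF N.subgroup_axioms sub_L int_NL] by (simp add: card_image card_cartesian_product)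
  also have "(\<lambda>(m, l). mul m l) ` (N \<times> L) = V"
    using prod_NL N_V L_V by force
  finally show ?thesis .
qed

text \<open>As \<open>a u = 0\<close>, \<open>a\<close> fixes the children of \<open>u\<close>,
  while \<open>b\<close> permutes them cyclically. Commuting forces the sums of \<open>a\<close>
  below all children to agree modulo \<open>p\<close>, so the whole branch sum is \<open>p\<close>
  times one of them.\<close>

lemma lam_zero_if_commute:
  assumes ab: "a \<in> K k" "b \<in> K k" "mul a b = mul b a" and u: "u \<in> word k" "a u = 0" "b u \<noteq> 0"
  shows "lam u j a = 0"
proof (cases j)
  case 0
  then show ?thesis using u(2) by (simp add: lam_def word_0)
next
  case (Suc i)
  have V: "a \<in> V" "b \<in> V" using ab K_V by auto
  define s where "s d = (\<Sum>v\<in>word i. a (u @ [d] @ v))" for d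
  have digit: "u @ [d] \<in> word (Suc k)" if "d \<in> {0..<int p}" for d
    using u(1) that by (auto simp: word_def)
  have step: "[s d = s ((d + b u) mod int p)] (mod int p)" if d: "d \<in> {0..<int p}" for d
  proof -
    let ?b = "\<lambda>v. b (u @ [d] @ v)" and ?a = "\<lambda>v. a (u @ [d] @ v)"
    let ?e = "(d + b u) mod int p"
    have acta: "act a (u @ [d]) = u @ [d]" using K_act[OF ab(1) u(1)] u(2) d by (simp add: act_snoc)
    have actb: "act b (u @ [d]) = u @ [?e]" using K_act[OF ab(2) u(1)] by (simp add: act_snoc)
    have "[(\<Sum>v\<in>word i. b (u @ [d] @ v) + a (u @ [?e] @ act ?b v)) =
        (\<Sum>v\<in>word i. a (u @ [d] @ v) + b (u @ [d] @ act ?a v))] (mod int p)"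
    proof (rule cong_sum)
      fix v assume v: "v \<in> word i"
      have x: "(u @ [d]) @ v \<in> word (Suc k + i)" by (rule word_append[OF digit[OF d] v])
      have "act b ((u @ [d]) @ v) = (u @ [?e]) @ act ?b v"
        "act a ((u @ [d]) @ v) = (u @ [d]) @ act ?a v"
        unfolding act_append[of _ "u @ [d]"] acta actb by simp_all
      with mul_eqD[OF ab(3) V(1) V(2) V(2) V(1) x]
      show "[b (u @ [d] @ v) + a (u @ [?e] @ act ?b v) = a (u @ [d] @ v) + b (u @ [d] @ act ?a v)] (mod int p)"
        by simp
    qed
    then have "[(\<Sum>v\<in>word i. b (u @ [d] @ v)) + s ?e = s d + (\<Sum>v\<in>word i. b (u @ [d] @ v))] (mod int p)"
      using sum_act[of "\<lambda>v. a (u @ [?e] @ v)" ?b i] sum_act[of "\<lambda>v. b (u @ [d] @ v)" ?a i]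
      by (simp add: sum.distrib s_def)
    then have "[s ?e = s d] (mod int p)"
      by (simp only: add.commute[of "s d"] cong_add_lcancel)
    then show ?thesis by (rule cong_sym)
  qed
  have chain: "[s ((int m * b u) mod int p) = s 0] (mod int p)" for m
  proof (induction m)
    case (Suc m)
    have "[s ((int m * b u) mod int p) = s (((int m * b u) mod int p + b u) mod int p)] (mod int p)"
      by (rule step) simp
    also have "((int m * b u) mod int p + b u) mod int p = (int (Suc m) * b u) mod int p"
      by (simp add: mod_simps algebra_simps)
    finally show ?case using Suc by (metis cong_sym cong_trans)
  qed simp
  have all: "[s d = s 0] (mod int p)" if d: "d \<in> {0..<int p}" for d
  proof -
    have "\<not> [b u = 0] (mod int p)" using u(3) V by (simp add: cong_def)
    from solve_mod[OF this, of d] obtain m :: nat where "[int m * b u = d] (mod int p)" by blast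
    then have "(int m * b u) mod int p = d" using d by (simp add: cong_def)
    then show ?thesis using chain[of m] by simp
  qed
  have "(\<Sum>v\<in>word j. a (u @ v)) = (\<Sum>x\<in>word 1. \<Sum>v\<in>word i. a (u @ x @ v))"
    using sum_word_append[of "\<lambda>v. a (u @ v)" i 1] Suc by simp
  also have "\<dots> = (\<Sum>d\<in>{0..<int p}. s d)"
    unfolding s_def
    by (rule sum.reindex_bij_witness[where i = "\<lambda>d. [d]" and j = hd])
      (auto simp: word_def length_Suc_conv)
  also have "[\<dots> = (\<Sum>d\<in>{0..<int p}. s 0)] (mod int p)"
    by (rule cong_sum) (rule all)
  also have "(\<Sum>d\<in>{0..<int p}. s 0) = int p * s 0" by simp
  finally show ?thesis by (simp add: lam_def cong_def)
qed

text \<open>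
  In this case \<open>L \<inter> K k\<close> is determined by its values on level \<open>k\<close>, which bounds the order of \<open>L\<close> by that
  of the quotient of \<open>V\<close> by \<open>K (Suc k)\<close>.
\<close>

lemma complement_if_lam_zero:
  assumes zero: "\<And>m. m \<in> N \<Longrightarrow> lam [] k m = 0"
  shows "N \<inter> std_comp (Suc k) {} = {\<lambda>_. 0} \<and> N <#>\<^bsub>VG\<^esub> std_comp (Suc k) {} = V"
proof
  let ?C = "std_comp (Suc k) {}"
  show int: "N \<inter> ?C = {\<lambda>_. 0}"
  proof (rule trivial_intersection[OF comp_subgroup])
    fix z m assume z: "z \<in> N \<inter> ?C" and m: "m \<in> N" "\<And>i. lam [] (k + i) m = lam (replicate k 0) i z"
      and const: "\<And>u w. u \<in> word k \<Longrightarrow> z (u @ w) = z (replicate k 0 @ w)"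
    have zV: "z \<in> V" using z N_V by blast
    have "z (replicate k 0) = 0"
      using m(2)[of 0] zero[OF m(1)] zV by (simp add: lam_def[of _ 0] word_0)
    then have zu: "z u = 0" if "u \<in> word k" for u using const[OF that, of "[]"] by simp
    show "z = (\<lambda>_. 0)"
    proof
      fix v :: "int list"
      consider "length v < k" | "length v = k" | "k < length v" by linarith
      then show "z v = 0"
      proof cases
        case 1 then show ?thesis using z N_K K_vanish by blast
      next
        case 2 then show ?thesis using zu nodesD[of v] V_nonnode[OF zV, of v] by blast
      next
        case 3 then show ?thesis using z unfolding comp_empty by auto
      qed
    qed
  qed (rule trans_comp, auto)
  interpret LK: subgroup "L \<inter> K k" VG by (rule subgroup_LK)
  \<comment> \<open>Both products have the same \<open>lam\<close> values, so their quotient lies in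
    \<open>N\<close>, and it lies in \<open>L\<close> as well.\<close>
  have comm: "mul a b = mul b a" if a: "a \<in> L \<inter> K k" and b: "b \<in> L \<inter> K k" for a b
  proof -
    have V: "a \<in> V" "b \<in> V" using a b K_V by auto
    have ab: "mul a b \<in> L \<inter> K k" "mul b a \<in> L \<inter> K k"
      using LK.m_closed[OF a b] LK.m_closed[OF b a] by auto
    have "mul (mul a b) (inv\<^bsub>VG\<^esub> (mul b a)) \<in> N"
    proof (rule eq_lam_N)
      fix u i assume u: "u \<in> word k"
      show "lam u i (mul a b) = lam u i (mul b a)"
        using lam_mul[OF V u K_act[of b k]] lam_mul[OF V(2,1) u K_act[of a k]] a b u by (simp add: add.commute)
    qed (use ab in auto)
    moreover have "mul (mul a b) (inv\<^bsub>VG\<^esub> (mul b a)) \<in> L"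
      using LK.m_closed[OF ab(1) LK.m_inv_closed[OF ab(2)]] by simp
    ultimately have "mul (mul a b) (inv\<^bsub>VG\<^esub> (mul b a)) = (\<lambda>_. 0)" using int_NL by blast
    moreover have "mul (mul (mul a b) (inv\<^bsub>VG\<^esub> (mul b a))) (mul b a) = mul a b"
      using VG.inv_solve_right[of "mul (mul a b) (inv\<^bsub>VG\<^esub> (mul b a))" "mul a b" "mul b a"] V by simp
    ultimately show ?thesis using VG.l_one[of "mul b a"] V by simp
  qed
  \<comment> \<open>The point mass \<open>?x\<close> has \<open>lam [] k\<close> equal to
    \<open>1\<close>. Since its \<open>N\<close>-part contributes nothing, its \<open>L\<close>-part
    has a nonzero label on level \<open>k\<close>.\<close>
  obtain b0 u0 where b0: "b0 \<in> L \<inter> K k" "u0 \<in> word k" "b0 u0 \<noteq> 0"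
  proof -
    let ?x = "lev k (\<lambda>v. of_bool (v = replicate k 0))"
    obtain m l where ml: "m \<in> N" "l \<in> L" "?x = mul m l" using prod_NL[of ?x] by auto
    have mK: "m \<in> K k" using ml N_K by blast
    have "l = mul (inv\<^bsub>VG\<^esub> m) ?x"
      using VG.inv_solve_left[of l m ?x] ml N_V L_V by auto
    then have lK: "l \<in> K k"
      using subgroup.m_closed[OF K_subgroup subgroup.m_inv_closed[OF K_subgroup mK] lev_K] by simp
    have "lam [] k ?x = (lam [] k m + lam [] k l) mod int p"
      using lam_Nil_mul[OF N_V[OF ml(1)] L_V[OF ml(2)]] ml(3) by simp
    moreover have "lam [] k ?x = 1"
    proof -
      have "(\<Sum>v\<in>word k. ?x v) = (\<Sum>v\<in>word k. if v = replicate k 0 then 1 else 0)"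
        using k_n p_gt_1 by (intro sum.cong) (auto simp: lev_def)
      then show ?thesis using p_gt_1 by (simp add: lam_def)
    qed
    ultimately have "lam [] k l \<noteq> 0" using zero[OF ml(1)] by auto
    then have "\<exists>u\<in>word k. l u \<noteq> 0" unfolding lam_def by (metis append_Nil mod_0 sum.neutral)
    then show thesis using that lK ml(2) by blast
  qed
  have top: "\<exists>b\<in>L \<inter> K k. b u \<noteq> 0" if u: "u \<in> word k" for u
  proof -
    obtain b where b: "b \<in> L \<inter> K k" "\<forall>x\<in>word k. \<forall>i. lam (act (move u0 u) x) i b = lam x i b0"
      using L_translates[OF b0(1), of "move u0 u"] by auto
    have "act (move u0 u) u0 = u" using act_move[OF b0(2) u] k_n by simp
    then have "lam u 0 b = lam u0 0 b0" using b(2) b0(2) by metis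
    moreover have "b \<in> V" "b0 \<in> V" using b b0 K_V by auto
    ultimately have "b u = b0 u0" by (simp add: lam_def word_0)
    then show ?thesis using b b0 by metis
  qed
  have triv: "a = (\<lambda>_. 0)" if a: "a \<in> L" "a \<in> K (Suc k)" for a
  proof -
    have aK: "a \<in> K k" using a K_mono[of k "Suc k"] by auto
    have "lam u i a = 0" if u: "u \<in> word k" for u i
    proof -
      obtain b where b: "b \<in> L \<inter> K k" "b u \<noteq> 0" using top[OF u] by blast
      have "a u = 0" using K_vanish[OF a(2), of u] u by (simp add: length_word)
      moreover have "a \<in> L \<inter> K k" "b \<in> K k" using a(1) aK b(1) by auto
      ultimately show ?thesis using lam_zero_if_commute[OF aK _ comm[OF _ b(1)] u _ b(2)] by blast
    qed
    then have "a \<in> N" using lam_kernel[OF aK] by blast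
    then show ?thesis using a int_NL by blast
  qed
  define cut where "cut l = (\<lambda>v. if length v \<le> k then l v else (0::int))" for l :: "int list \<Rightarrow> int"
  have cutC: "cut l \<in> ?C" if "l \<in> L" for l
    using L_V[OF that] unfolding comp_empty by (auto simp: cut_def V_def)
  have "inj_on cut L"
  proof (rule inj_onI)
    fix l l' assume l: "l \<in> L" "l' \<in> L" "cut l = cut l'"
    have eq: "l v = l' v" if "length v \<le> k" for v using fun_cong[OF l(3), of v] that by (simp add: cut_def)
    have V: "l \<in> V" "l' \<in> V" using l L_V by auto
    have "mul (inv\<^bsub>VG\<^esub> l') l = (\<lambda>_. 0)"
    proof (rule triv)
      show "mul (inv\<^bsub>VG\<^esub> l') l \<in> L" using L.m_closed[OF L.m_inv_closed[OF l(2)] l(1)] by simp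
      show "mul (inv\<^bsub>VG\<^esub> l') l \<in> K (Suc k)"
      proof (rule K_if_act_fix)
        fix v assume v: "v \<in> word (Suc k)"
        have "act l v = act l' v" by (rule act_cong) (use eq v in \<open>auto simp: length_word\<close>)
        then have "act (mul (inv\<^bsub>VG\<^esub> l') l) v = act (mul (inv\<^bsub>VG\<^esub> l') l') v"
          using act_mul[OF v] k_n by simp
        also have "mul (inv\<^bsub>VG\<^esub> l') l' = (\<lambda>_. 0)" using VG.l_inv[of l'] V by simp
        finally show "act (mul (inv\<^bsub>VG\<^esub> l') l) v = v" using act_0[OF v] by simp
      qed (use V k_n in auto)
    qed
    then have "l' = l" using VG.inv_mult_cancel(2)[of l' l] VG.r_one[of l'] V by simp
    then show "l = l'" by simp
  qed
  moreover have CV: "?C \<subseteq> V" using comp_V by blast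
  ultimately have "card L \<le> card ?C"
    using cutC by (intro card_inj_on_le[of cut]) (auto intro: finite_subset)
  then have "card V \<le> card N * card ?C" using card_prod_NL by (metis mult_le_mono2)
  also have "\<dots> = card ((\<lambda>(m, c). mul m c) ` (N \<times> ?C))"
    using inj_on_mul[OF N.subgroup_axioms comp_subgroup int] by (simp add: card_image card_cartesian_product)
  finally have "(\<lambda>(m, c). mul m c) ` (N \<times> ?C) = V"
    using N_V CV by (intro card_seteq) auto
  moreover have "(\<lambda>(m, c). mul m c) ` (N \<times> ?C) = N <#>\<^bsub>VG\<^esub> ?C"
    by (force simp: set_mult_def)
  ultimately show "N <#>\<^bsub>VG\<^esub> ?C = V" by simp
qed

end

context portraits
begin

text \<open>Whether \<open>lam [] k\<close> vanishes on \<open>N\<close> decides if the complement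
  keeps level \<open>k\<close>: \<open>std_comp k J\<close> has no labels on level \<open>k\<close>,
  as the empty word is not special, while \<open>std_comp (Suc k) {}\<close> allows all labels
  through level \<open>k\<close> and none deeper.\<close>

theorem standard_complement:
  assumes N: "N \<lhd> VG" and L: "complement_in L N VG"
  shows "\<exists>k J. complement_in (std_comp k J) N VG"
proof (cases "N = {\<lambda>_. 0}")
  case True
  \<comment> \<open>For trivial \<open>N\<close> the choice \<open>k = n\<close> leaves all labels
    free.\<close>
  have "std_comp n {} = V" unfolding comp_empty using V_nonnode nodesD by force
  moreover have "N <#>\<^bsub>VG\<^esub> V = V"
    using True VG.l_one by (auto simp: set_mult_def)
  ultimately show ?thesis
    using comp_subgroup[of n "{}"] True by (intro exI[of _ n] exI[of _ "{}"]) (auto simp: complement_in_def)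
next
  case False
  interpret N: normal N VG by (rule N)
  have "\<exists>k<n. N \<subseteq> K k \<and> \<not> N \<subseteq> K (Suc k)"
  proof (rule ccontr)
    assume no: "\<not> ?thesis"
    have "N \<subseteq> K k" if "k \<le> n" for k
      using that
    proof (induction k)
      case 0 then show ?case using N.subset K_0 by simp
    qed (use no in auto)
    from this[of n] show False using False N.one_closed K_n by auto
  qed
  then obtain k where k: "k < n" "N \<subseteq> K k" "\<not> N \<subseteq> K (Suc k)" by blast
  interpret complemented p n N L k
  proof (intro complemented.intro complemented_axioms.intro)
    show "portraits p" by (rule portraits_axioms)
    show "N \<lhd> VG" by (rule N)
    show "subgroup L VG" "N \<inter> L = {\<lambda>_. 0}" using L by (auto simp: complement_in_def)
    show "\<exists>m\<in>N. \<exists>l\<in>L. x = mul m l" if "x \<in> V" for x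
    proof -
      have "x \<in> N <#>\<^bsub>VG\<^esub> L" using that L by (simp add: complement_in_def)
      then show ?thesis by (auto simp: set_mult_def)
    qed
  qed (use k in auto)
  show ?thesis
  proof (cases "\<exists>g\<in>N. lam [] k g \<noteq> 0")
    case True
    then obtain J where "N \<inter> std_comp k J = {\<lambda>_. 0}" "N <#>\<^bsub>VG\<^esub> std_comp k J = V"
      using complement_if_lam_nonzero by blast
    then have "complement_in (std_comp k J) N VG" using comp_subgroup by (simp add: complement_in_def)
    then show ?thesis by blast
  next
    case False
    then have "\<And>m. m \<in> N \<Longrightarrow> lam [] k m = 0" by blast
    from complement_if_lam_zero[OF this] have "complement_in (std_comp (Suc k) {}) N VG"
      using comp_subgroup by (simp add: complement_in_def)
    then show ?thesis by blast
  qed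
qed

abbreviation AG where "AG \<equiv> AutoGroup VG"

section \<open>Automorphisms\<close>

lemma auto_closed: "\<alpha> \<in> auto VG \<Longrightarrow> a \<in> V \<Longrightarrow> \<alpha> a \<in> V"
  by (auto simp: auto_def hom_def)

lemma auto_mul: "\<alpha> \<in> auto VG \<Longrightarrow> a \<in> V \<Longrightarrow> b \<in> V \<Longrightarrow> \<alpha> (mul a b) = mul (\<alpha> a) (\<alpha> b)"
  by (auto simp: auto_def hom_def)

lemma auto_bij: "\<alpha> \<in> auto VG \<Longrightarrow> bij_betw \<alpha> V V"
  by (auto simp: auto_def Bij_def)

lemma auto_inj: "\<alpha> \<in> auto VG \<Longrightarrow> inj_on \<alpha> V"
  using auto_bij by (auto simp: bij_betw_def)

lemma auto_group_hom: "\<alpha> \<in> auto VG \<Longrightarrow> group_hom VG VG \<alpha>"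
  by (simp add: auto_def group_hom_def group_hom_axioms_def)

lemma auto_inv: "\<alpha> \<in> auto VG \<Longrightarrow> a \<in> V \<Longrightarrow> \<alpha> (inv\<^bsub>VG\<^esub> a) = inv\<^bsub>VG\<^esub> (\<alpha> a)"
  using group_hom.hom_inv[OF auto_group_hom, of \<alpha> a] by simp

lemma auto_conj: "\<alpha> \<in> auto VG \<Longrightarrow> a \<in> V \<Longrightarrow> b \<in> V \<Longrightarrow> \<alpha> (conjugate a b) = conjugate (\<alpha> a) (\<alpha> b)"
  by (simp add: conjugate_def auto_mul auto_inv)

lemma auto_iso: "\<alpha> \<in> auto VG \<Longrightarrow> \<alpha> \<in> iso VG VG"
  using auto_bij by (auto simp: iso_def auto_def)

lemma auto_image_normal: "\<alpha> \<in> auto VG \<Longrightarrow> N \<lhd> VG \<Longrightarrow> \<alpha> ` N \<lhd> VG"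
  by (rule iso_normal_subgroup[OF auto_iso]) (auto simp: VG_group)

lemma card_auto_image: "\<alpha> \<in> auto VG \<Longrightarrow> S \<subseteq> V \<Longrightarrow> card (\<alpha> ` S) = card S"
  by (rule card_image) (rule inj_on_subset[OF auto_inj])

lemma auto_image_eq: "\<alpha> \<in> auto VG \<Longrightarrow> S \<subseteq> V \<Longrightarrow> \<alpha> ` S \<subseteq> S \<Longrightarrow> \<alpha> ` S = S"
  using card_auto_image[of \<alpha> S] finite_subset[of S V] by (intro card_subset_eq) auto

section \<open>Invariance of the level stabilizers under automorphisms\<close>

lemma K_sub_V: "K k \<subseteq> V" using K_V by blast

lemma K_eq_mod:
  assumes "x \<in> K k" "y \<in> K k" "\<And>v. v \<in> word k \<Longrightarrow> [x v = y v] (mod int p)"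
  obtains z where "z \<in> K (Suc k)" "x = mul z y"
proof
  let ?z = "mul x (inv\<^bsub>VG\<^esub> y)"
  have V: "x \<in> V" "y \<in> V" using assms K_V by auto
  show eq: "x = mul ?z y" using VG.inv_solve_right[of ?z x y] V by simp
  have zK: "?z \<in> K k"
    using subgroup.m_closed[OF K_subgroup assms(1) subgroup.m_inv_closed[OF K_subgroup assms(2)]] by simp
  show "?z \<in> K (Suc k)"
  proof (rule K_SucI[OF zK])
    fix v assume v: "v \<in> word k"
    have "x v = (y v + ?z (act y v)) mod int p"
      using mul_apply[OF K_V[OF zK] V(2) v] eq by simp
    then have "[y v + 0 = y v + ?z v] (mod int p)"
      using assms(3)[OF v] K_act[OF assms(2) v] by (simp add: cong_def)
    then have "[0 = ?z v] (mod int p)" by (simp only: cong_add_lcancel)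
    then show "?z v = 0" using V by (simp add: cong_def)
  qed
qed

lemma mul_level: "x \<in> V \<Longrightarrow> y \<in> K k \<Longrightarrow> v \<in> word k \<Longrightarrow> mul x y v = (y v + x v) mod int p"
  using mul_apply[of x y v k] K_act[of y k v k] K_V by simp

lemma K_vanish_top: "z \<in> K (Suc k) \<Longrightarrow> v \<in> word j \<Longrightarrow> j \<le> k \<Longrightarrow> z v = 0"
  by (rule K_vanish) (auto simp: length_word)

text \<open>\<open>K k\<close> is abelian modulo \<open>K (Suc k)\<close>, so its image under
  \<open>\<alpha>\<close> is too; on levels up to \<open>k\<close> the factor from
  \<open>K (Suc k)\<close> is invisible.\<close>

lemma auto_K_commute:
  assumes \<alpha>: "\<alpha> \<in> auto VG" "\<alpha> ` K (Suc k) = K (Suc k)"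
    and xy: "x \<in> \<alpha> ` K k" "y \<in> \<alpha> ` K k" and v: "v \<in> word j" "j \<le> k"
  shows "[y v + x (act y v) = x v + y (act x v)] (mod int p)"
proof -
  obtain a b where ab: "a \<in> K k" "x = \<alpha> a" "b \<in> K k" "y = \<alpha> b" using xy by blast
  have V: "a \<in> V" "b \<in> V" using ab K_V by auto
  have "mul a b \<in> K k" "mul b a \<in> K k"
    using subgroup.m_closed[OF K_subgroup] ab by fastforce+
  then obtain z where z: "z \<in> K (Suc k)" "mul a b = mul z (mul b a)"
    by (rule K_eq_mod) (use mul_level V ab in \<open>simp add: add.commute\<close>)
  have zV: "\<alpha> z \<in> V" "\<alpha> z \<in> K (Suc k)" using z \<alpha> auto_closed K_V by blast+
  have xyV: "x \<in> V" "y \<in> V" using ab V auto_closed[OF \<alpha>(1)] by auto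
  have "mul x y = mul (\<alpha> z) (mul y x)"
    using arg_cong[OF z(2), of \<alpha>] ab V K_V[OF z(1)] by (simp add: auto_mul[OF \<alpha>(1)])
  from mul_eqD[OF this xyV zV(1) mul_closed[OF xyV(2,1)] v(1)]
  have "[y v + x (act y v) = mul y x v] (mod int p)"
    using K_vanish_top[OF zV(2) act_word[OF v(1)] v(2)] by simp
  then show ?thesis using xyV v by (simp add: mul_apply cong_def)
qed

text \<open>If \<open>a\<close> in the image moves \<open>w\<close>, the commutator
  \<open>?b\<close> of \<open>a\<close> with a point mass at \<open>w\<close> lies both in the image
  and in \<open>K k\<close>, with label \<open>1\<close> at \<open>act a w\<close> and
  \<open>-1\<close> at \<open>w\<close>. Commuting with \<open>a\<close> makes these labels equal,
  which is impossible for odd \<open>p\<close>.\<close>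

lemma auto_K_odd:
  assumes \<alpha>: "\<alpha> \<in> auto VG" "\<alpha> ` K (Suc k) = K (Suc k)" and k: "k < n" and odd: "p \<noteq> 2"
  shows "\<alpha> ` K k = K k"
proof -
  have A: "\<alpha> ` K k \<lhd> VG" by (rule auto_image_normal[OF \<alpha>(1) K_normal])
  interpret A: normal "\<alpha> ` K k" VG by (rule A)
  have "a \<in> K k" if a: "a \<in> \<alpha> ` K k" for a
  proof (rule K_if_act_fix)
    show aV: "a \<in> V" using a A.mem_carrier by simp
    fix w assume w: "w \<in> word k"
    let ?d = "lev k (\<lambda>v. of_bool (v = w))"
    let ?b = "mul (conjugate a ?d) (inv\<^bsub>VG\<^esub> ?d)"
    have bA: "?b \<in> \<alpha> ` K k" by (rule normal_commutator[OF A a]) simp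
    have "conjugate a ?d \<in> K k" "inv\<^bsub>VG\<^esub> ?d \<in> K k" using conj_K[OF aV lev_K] by (auto simp: inv_lev)
    then have bK: "?b \<in> K k" using subgroup.m_closed[OF K_subgroup] by fastforce
    show "act a w = w"
    proof (rule ccontr)
      assume neq: "act a w \<noteq> w"
      have "[?b w + a (act ?b w) = a w + ?b (act a w)] (mod int p)"
        by (rule auto_K_commute[OF \<alpha> a bA w]) simp
      then have "[a w + ?b w = a w + ?b (act a w)] (mod int p)"
        using K_act[OF bK w] by (simp add: add.commute)
      then have b1: "[?b w = ?b (act a w)] (mod int p)" by (simp only: cong_add_lcancel)
      have b2: "[?b w = - 1] (mod int p)"
        using commutator_lev_single[OF aV w w k] neq by simp
      have b3: "[?b (act a w) = 1] (mod int p)"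
        using commutator_lev_single[OF aV w act_word[OF w, of a] k] neq by simp
      have "[- 1 = (1 :: int)] (mod int p)" by (rule cong_trans[OF cong_trans[OF cong_sym[OF b2] b1] b3])
      then have "int p dvd 2" by (simp add: cong_iff_dvd_diff)
      then have "p dvd 2" using int_dvd_int_iff[of p 2] by simp
      then show False using odd p_gt_1 dvd_imp_le[of p 2] by auto
    qed
  qed (use k in simp)
  then show ?thesis by (intro auto_image_eq[OF \<alpha>(1) K_sub_V]) blast
qed

text \<open>
  For \<open>p = 2\<close> an automorphism may exchange \<open>K (Suc m)\<close> with \<open>twin m\<close>, as the outer automorphism of the
  dihedral group of order 8 does. An automorphism of odd order cannot.
\<close>

definition twin :: "nat \<Rightarrow> (int list \<Rightarrow> int) set" where
  "twin m = {g \<in> K m. \<forall>u\<in>word m. g (u @ [0]) = g (u @ [1])}"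

lemma card_twin:
  assumes p: "p = 2" and m: "Suc m < n"
  shows "card (twin m) \<le> card (K (Suc m))"
proof -
  \<comment> \<open>The label of \<open>g\<close> at \<open>u\<close> is stored at
    \<open>u @ [1]\<close>, where \<open>g\<close> only repeats its label at
    \<open>u @ [0]\<close>.\<close>
  define F where "F g = (\<lambda>v. if length v = m then 0
     else if length v = Suc m \<and> last v = 1 then g (butlast v) else g v)" for g :: "int list \<Rightarrow> int"
  have FK: "F g \<in> K (Suc m)" if g: "g \<in> twin m" for g
  proof -
    have gV: "g \<in> V" and gK: "g \<in> K m" using g K_V by (auto simp: twin_def)
    have "F g \<in> V" unfolding V_def
    proof (intro CollectI conjI ballI allI impI)
      show "F g v \<in> {0..<int p}" for v using V_range[OF gV] by (simp add: F_def)
      show "F g v = 0" if v: "v \<notin> nodes" for v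
      proof (cases "length v = Suc m \<and> last v = 1")
        case True
        have "butlast v \<notin> nodes"
        proof
          assume "butlast v \<in> nodes"
          then have "set (butlast v) \<subseteq> {0..<int p}" using nodesD word_def by auto
          moreover have "v = butlast v @ [1]" using True append_butlast_last_id[of v] by (metis length_0_conv nat.distinct(1))
          moreover have "set (butlast v @ [1]) \<subseteq> {0..<int p}" if "set (butlast v) \<subseteq> {0..<int p}"
            using that p by simp
          ultimately have "set v \<subseteq> {0..<int p}" by metis
          then have "v \<in> word (Suc m)" using True by (simp add: word_def)
          then show False using v m word_nodes by blast
        qed
        then show ?thesis using V_nonnode[OF gV, of "butlast v"] True by (simp add: F_def)
      qed (use V_nonnode[OF gV v] in \<open>auto simp: F_def\<close>)
    qed
    moreover have "F g v = 0" if "length v < Suc m" for v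
      using K_vanish[OF gK, of v] that by (auto simp: F_def)
    ultimately show ?thesis by (simp add: K_def)
  qed
  have "inj_on F (twin m)"
  proof (rule inj_onI)
    fix g h assume g: "g \<in> twin m" and h: "h \<in> twin m" and eq: "F g = F h"
    have V: "g \<in> V" "h \<in> V" and K: "g \<in> K m" "h \<in> K m" using g h K_V by (auto simp: twin_def)
    have Fv: "F g v = F h v" for v using eq by simp
    show "g = h"
    proof (rule V_eqI[OF V])
      fix v j assume v: "v \<in> word j"
      consider "j < m" | "j = m" | "j = Suc m" | "Suc m < j" by linarith
      then have "g v = h v"
      proof cases
        case 1 then show ?thesis using K_vanish[OF K(1)] K_vanish[OF K(2)] v by (simp add: length_word)
      next
        case 2 then show ?thesis using Fv[of "v @ [1]"] v by (simp add: F_def length_word)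
      next
        case 3
        then obtain u d where u: "v = u @ [d]" using v by (metis length_word length_0_conv nat.distinct(1) rev_exhaust)
        have "length (u @ [d]) = Suc m" "set (u @ [d]) \<subseteq> {0..<int p}" using v u 3 by (auto simp: word_def)
        then have uw: "u \<in> word m" and "d \<in> {0..<int p}" by (auto simp: word_def)
        then have d: "d = 0 \<or> d = 1" using p by auto
        have "g (u @ [0]) = h (u @ [0])" using Fv[of "u @ [0]"] uw by (simp add: F_def length_word)
        then show ?thesis using g h uw d u by (auto simp: twin_def)
      next
        case 4 then show ?thesis using Fv[of v] v by (simp add: F_def length_word)
      qed
      then show "[g v = h v] (mod int p)" by simp
    qed
  qed
  then show ?thesis
    using FK finite_subset[OF K_sub_V finite_V] by (intro card_inj_on_le[of F]) auto
qed

text \<open>For \<open>p = 2\<close> the commutator argument only shows that the image moves each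
  word of level \<open>k\<close> in at most one way. That confines it to \<open>K m\<close> and
  makes the labels of sibling nodes agree; counting with \<open>card_twin\<close> gives
  equality.\<close>

lemma auto_K_even:
  assumes \<alpha>: "\<alpha> \<in> auto VG" "\<alpha> ` K (Suc k) = K (Suc k)" and k: "k < n" and p: "p = 2"
    and neq: "\<alpha> ` K k \<noteq> K k"
  shows "\<exists>m. k = Suc m \<and> \<alpha> ` K k = twin m"
proof -
  have p2: "x mod int p = x mod 2" for x using p by simp
  have bin: "g v = 0 \<or> g v = 1" if "g \<in> V" for g v using V_range[OF that, of v] p by auto
  let ?A = "\<alpha> ` K k"
  have A: "?A \<lhd> VG" by (rule auto_image_normal[OF \<alpha>(1) K_normal])
  interpret A: normal ?A VG by (rule A)
  have AV: "a \<in> V" if "a \<in> ?A" for a using that A.mem_carrier by simp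
  have "k \<noteq> 0"
  proof
    assume "k = 0"
    then show False using neq K_0 auto_bij[OF \<alpha>(1)] by (simp add: bij_betw_def)
  qed
  then obtain m where m: "k = Suc m" by (cases k) auto
  have not_sub: "\<not> ?A \<subseteq> K k"
    using neq auto_image_eq[OF \<alpha>(1) K_sub_V] by blast
  have move2: "act c w = w \<or> act c w = act a w"
    if a: "a \<in> ?A" and c: "c \<in> ?A" and w: "w \<in> word k" and aw: "act a w \<noteq> w" for a c w
  proof -
    let ?d = "lev k (\<lambda>v. of_bool (v = w))"
    let ?b = "mul (conjugate a ?d) (inv\<^bsub>VG\<^esub> ?d)"
    have bA: "?b \<in> ?A" by (rule normal_commutator[OF A a]) simp
    have "conjugate a ?d \<in> K k" "inv\<^bsub>VG\<^esub> ?d \<in> K k" using conj_K[OF AV[OF a] lev_K] by (auto simp: inv_lev)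
    then have bK: "?b \<in> K k" using subgroup.m_closed[OF K_subgroup] by fastforce
    have "[?b w + c (act ?b w) = c w + ?b (act c w)] (mod int p)"
      by (rule auto_K_commute[OF \<alpha> c bA w]) simp
    then have "[c w + ?b w = c w + ?b (act c w)] (mod int p)"
      using K_act[OF bK w] by (simp add: add.commute)
    then have c1: "[?b w = ?b (act c w)] (mod int p)" by (simp only: cong_add_lcancel)
    have c2: "[?b w = of_bool (w = act a w) - 1] (mod int p)"
      using commutator_lev_single[OF AV[OF a] w w k] by simp
    have c3: "[?b (act c w) = of_bool (act c w = act a w) - of_bool (act c w = w)] (mod int p)"
      by (rule commutator_lev_single[OF AV[OF a] w act_word[OF w] k])
    have "[of_bool (w = act a w) - 1 = of_bool (act c w = act a w) - (of_bool (act c w = w) :: int)] (mod int p)"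
      by (rule cong_trans[OF cong_trans[OF cong_sym[OF c2] c1] c3])
    then show ?thesis using aw p_gt_1 by (auto simp: cong_iff_dvd_diff intro: ccontr)
  qed
  \<comment> \<open>Otherwise conjugating \<open>a\<close> by \<open>t\<close>, which fixes
    \<open>w\<close> but flips the last digit of \<open>act a w\<close>, would give a second
    nontrivial image of \<open>w\<close>.\<close>
  have A_m: "?A \<subseteq> K m"
  proof
    fix a assume a: "a \<in> ?A"
    have fixpre: "take m (act a w) = take m w" if w: "w \<in> word k" for w
    proof (rule ccontr)
      let ?x = "take m (act a w)"
      assume neq: "?x \<noteq> take m w"
      then have aw: "act a w \<noteq> w" by auto
      have xw: "?x \<in> word m" using word_take[OF act_word[OF w]] m by simp
      define t where "t = lev m (\<lambda>v. of_bool (v = ?x))"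
      have t: "t \<in> V" by (simp add: t_def)
      have t0: "t v = 0" if "v \<noteq> ?x" for v using that by (simp add: t_def lev_def)
      have tx: "t ?x = 1" using xw k m p_gt_1 by (simp add: t_def lev_def)
      have tw: "act t w = w"
      proof (rule act_fix[OF w])
        fix i assume i: "i < k"
        have "take i w \<noteq> ?x"
        proof
          assume eq: "take i w = ?x"
          have "length (take i w) = i" using w i by (simp add: length_word)
          moreover have "length ?x = m" using xw by (rule length_word)
          ultimately have "i = m" using eq by simp
          then show False using eq neq by simp
        qed
        then show "t (take i w) = 0" by (rule t0)
      qed
      have c: "conjugate t a \<in> ?A" by (rule normal_conj[OF A t a])
      have "mul (conjugate t a) t = mul t a" by (rule mul_conj[OF t AV[OF a]])
      then have "act (conjugate t a) (act t w) = act t (act a w)"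
        using act_mul[OF w, of "conjugate t a" t] act_mul[OF w, of t a] k by simp
      then have cw: "act (conjugate t a) w = act t (act a w)" using tw by simp
      have "act t (act a w) \<noteq> w"
      proof
        assume "act t (act a w) = w"
        then have "act t (act a w) = act t w" using tw by simp
        then show False using aw act_inj[OF act_word[OF w] w] by blast
      qed
      then have eq: "act t (act a w) = act a w" using move2[OF a c w aw] cw by simp
      have len: "length (act a w) = Suc m" using w m by (simp add: length_word)
      define d where "d = act a w ! m"
      have awd: "act a w = ?x @ [d]"
        using len take_Suc_conv_app_nth[of m "act a w"] by (simp add: d_def)
      have H: "act t (?x @ [d]) = ?x @ [(d + 1) mod int p]"
        using tx K_act[of t m ?x m] xw lev_K by (simp add: act_snoc t_def)
      have "act t (act a w) = ?x @ [(d + 1) mod int p]" using H unfolding awd[symmetric] .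
      from trans[OF awd[symmetric] trans[OF eq[symmetric] this]]
      have "(d + 1) mod int p = d" by simp
      then have "(d + 1) mod 2 = d" using p2 by simp
      then show False by presburger
    qed
    show "a \<in> K m"
    proof (rule K_if_act_fix[OF AV[OF a]])
      fix v assume v: "v \<in> word m"
      have "v @ [0] \<in> word k" using v m p_pos by (auto simp: word_def)
      from fixpre[OF this] show "act a v = v" using v act_take[of m a "v @ [0]"] by (simp add: length_word)
    qed (use k m in simp)
  qed
  obtain a0 u0 where a0: "a0 \<in> ?A" "u0 \<in> word m" "a0 u0 \<noteq> 0"
    using not_sub A_m K_SucI[of _ m] m by blast
  have top: "\<exists>a\<in>?A. a u = 1" if u: "u \<in> word m" for u
  proof (intro bexI)
    let ?t = "move u0 u"
    show "conjugate ?t a0 \<in> ?A" by (rule normal_conj[OF A _ a0(1)]) simp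
    have "act ?t u0 = u" using act_move[OF a0(2) u] k m by simp
    then have "conjugate ?t a0 u = a0 u0" using conj_level[of ?t a0 m u0 m] A_m a0 by auto
    then show "conjugate ?t a0 u = 1" using a0(3) bin[OF AV[OF a0(1)], of u0] by simp
  qed
  have sub: "?A \<subseteq> twin m"
  proof
    fix b assume b: "b \<in> ?A"
    have "b (u @ [0]) = b (u @ [1])" if u: "u \<in> word m" for u
    proof -
      obtain a where a: "a \<in> ?A" "a u = 1" using top[OF u] by blast
      have u0: "u @ [0] \<in> word k" using u m by (auto simp: word_def)
      have acta: "act a (u @ [0]) = u @ [1]"
        using subsetD[OF A_m a(1)] K_act[of a m u m] a(2) u by (simp add: act_snoc p2)
      have bu: "act b u = u" using K_act[of b m u m] A_m b u by blast
      have "b u = 0 \<or> b u = 1" by (rule bin[OF AV[OF b]])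
      then show ?thesis
      proof
        assume "b u = 0"
        then have "act b (u @ [0]) = u @ [0]" using bu by (simp add: act_snoc p2)
        then have "[b (u @ [0]) + a (u @ [0]) = a (u @ [0]) + b (u @ [1])] (mod int p)"
          using auto_K_commute[OF \<alpha> a(1) b u0] acta by simp
        then have "[b (u @ [0]) = b (u @ [1])] (mod int p)"
          by (simp only: add.commute[of "b (u @ [0])"] cong_add_lcancel)
        then show ?thesis using AV[OF b] by (simp add: cong_def)
      next
        assume "b u = 1"
        then have actb: "act b (u @ [0]) = u @ [1]" using bu by (simp add: act_snoc p2)
        obtain c where c: "c \<in> K k" "b = \<alpha> c" using b by blast
        have cV: "c \<in> V" using c K_V by blast
        \<comment> \<open>Squares of elements of \<open>K k\<close> lie in \<open>K (Suc k)\<close>,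
          so \<open>mul b b\<close> does too. As \<open>b\<close> swaps the two children of
          \<open>u\<close>, the label of its square there is the sum of both labels of
          \<open>b\<close>.\<close>
        have "mul c c \<in> K (Suc k)"
        proof (rule K_SucI)
          show "mul c c \<in> K k" using subgroup.m_closed[OF K_subgroup c(1) c(1)] by simp
          show "mul c c v = 0" if "v \<in> word k" for v
            using mul_level[OF cV c(1) that] p2 by simp
        qed
        then have "mul b b \<in> K (Suc k)" using \<alpha>(2) auto_mul[OF \<alpha>(1) cV cV] c(2) by (metis image_eqI)
        then have "mul b b (u @ [0]) = 0" using K_vanish_top u0 by blast
        then have "(b (u @ [0]) + b (u @ [1])) mod 2 = 0"
          using mul_apply[OF AV[OF b] AV[OF b] u0] actb p2 by simp
        then show ?thesis using bin[OF AV[OF b], of "u @ [0]"] bin[OF AV[OF b], of "u @ [1]"] by auto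
      qed
    qed
    then show "b \<in> twin m" using b A_m by (auto simp: twin_def)
  qed
  have "card (twin m) \<le> card ?A"
    using card_twin[OF p] k m card_auto_image[OF \<alpha>(1) K_sub_V] by simp
  moreover have "finite (twin m)"
    by (rule finite_subset[of _ V]) (use K_V in \<open>auto simp: twin_def\<close>)
  ultimately have "?A = twin m" using sub card_seteq by blast
  then show ?thesis using m by blast
qed

lemma AutoGroup_carrier [simp]: "carrier AG = auto VG"
  by (simp add: AutoGroup_def)

lemma AutoGroup_mult: "\<alpha> \<in> auto VG \<Longrightarrow> \<beta> \<in> auto VG \<Longrightarrow> \<alpha> \<otimes>\<^bsub>AG\<^esub> \<beta> = compose V \<alpha> \<beta>"
  by (simp add: AutoGroup_def BijGroup_def auto_def)

lemma AutoGroup_one: "\<one>\<^bsub>AG\<^esub> = (\<lambda>x\<in>V. x)"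
  by (simp add: AutoGroup_def BijGroup_def)

lemma AutoGroup_group: "group (AutoGroup VG)"
  by (rule VG.AutoGroup)

lemma AutoGroup_apply:
  "\<alpha> \<in> auto VG \<Longrightarrow> \<beta> \<in> auto VG \<Longrightarrow> x \<in> V \<Longrightarrow> (\<alpha> \<otimes>\<^bsub>AG\<^esub> \<beta>) x = \<alpha> (\<beta> x)"
  by (simp add: AutoGroup_mult compose_eq)

lemma AutoGroup_image:
  "\<alpha> \<in> auto VG \<Longrightarrow> \<beta> \<in> auto VG \<Longrightarrow> S \<subseteq> V \<Longrightarrow> (\<alpha> \<otimes>\<^bsub>AG\<^esub> \<beta>) ` S = \<alpha> ` (\<beta> ` S)"
  using AutoGroup_apply by (auto simp: image_image subset_iff intro!: image_eqI)

lemma auto_eqI: "\<alpha> \<in> auto VG \<Longrightarrow> \<beta> \<in> auto VG \<Longrightarrow> (\<And>x. x \<in> V \<Longrightarrow> \<alpha> x = \<beta> x) \<Longrightarrow> \<alpha> = \<beta>"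
  by (rule extensionalityI[where A = V]) (auto simp: auto_def Bij_def)

lemma auto_image_cancel:
  "\<alpha> \<in> auto VG \<Longrightarrow> A \<subseteq> V \<Longrightarrow> B \<subseteq> V \<Longrightarrow> \<alpha> ` A = \<alpha> ` B \<Longrightarrow> A = B"
  using inj_on_image_eq_iff[OF auto_inj, of \<alpha> A B] by simp

lemma finite_auto: "finite (auto VG)"
proof (rule finite_subset)
  show "auto VG \<subseteq> V \<rightarrow>\<^sub>E V" by (auto simp: auto_def Bij_def PiE_def hom_def)
  show "finite (V \<rightarrow>\<^sub>E V)" by (intro finite_PiE) auto
qed

sublocale AG: group "AutoGroup VG" by (rule AutoGroup_group)

text \<open>In the exceptional case the square of \<open>\<alpha>\<close> cannot also send
  \<open>K k\<close> to \<open>twin m\<close>, as \<open>\<alpha>\<close> is injective, so it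
  preserves \<open>K k\<close>. Since the order is odd, \<open>\<alpha>\<close> is the inverse of an
  even power of itself.\<close>

lemma coprime_auto_K:
  assumes G: "subgroup G (AutoGroup VG)" "coprime (card G) p" and \<alpha>: "\<alpha> \<in> G" and k: "k \<le> n"
  shows "\<alpha> ` K k = K k"
proof -
  interpret G: subgroup G "AutoGroup VG" by (rule G(1))
  have Ga: "\<beta> \<in> auto VG" if "\<beta> \<in> G" for \<beta> using G.mem_carrier[OF that] by simp
  have "\<forall>\<alpha>\<in>G. \<alpha> ` K k = K k" using k
  proof (induction "n - k" arbitrary: k)
    case 0
    then have "k = n" by simp
    then show ?case
      using Ga group_hom.hom_one[OF auto_group_hom] K_n by simp
  next
    case (Suc x)
    then have k: "k < n" and "x = n - Suc k" by auto
    then have IH: "\<And>\<alpha>. \<alpha> \<in> G \<Longrightarrow> \<alpha> ` K (Suc k) = K (Suc k)" using Suc.hyps(1)[of "Suc k"] by auto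
    show ?case
    proof
      fix \<alpha> assume \<alpha>: "\<alpha> \<in> G"
      show "\<alpha> ` K k = K k"
      proof (cases "p = 2")
        case False
        then show ?thesis using auto_K_odd[OF Ga[OF \<alpha>] IH[OF \<alpha>] k] by simp
      next
        case True
        show ?thesis
        proof (rule ccontr)
          assume neq: "\<alpha> ` K k \<noteq> K k"
          then obtain m where m: "k = Suc m" "\<alpha> ` K k = twin m"
            using auto_K_even[OF Ga[OF \<alpha>] IH[OF \<alpha>] k True] by blast
          let ?b = "\<alpha> \<otimes>\<^bsub>AG\<^esub> \<alpha>"
          have b: "?b \<in> G" using \<alpha> G.m_closed by blast
          have bK: "?b ` K k = \<alpha> ` (\<alpha> ` K k)" by (rule AutoGroup_image[OF Ga[OF \<alpha>] Ga[OF \<alpha>] K_sub_V])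
          have sq: "?b ` K k = K k"
          proof (rule ccontr)
            assume "?b ` K k \<noteq> K k"
            then have "?b ` K k = \<alpha> ` K k"
              using auto_K_even[OF Ga[OF b] IH[OF b] k True] m by auto
            then have "\<alpha> ` (\<alpha> ` K k) = \<alpha> ` K k" using bK by simp
            moreover have "\<alpha> ` K k \<subseteq> V" using K_sub_V auto_closed[OF Ga[OF \<alpha>]] by blast
            ultimately have "\<alpha> ` K k = K k"
              by (intro auto_image_cancel[OF Ga[OF \<alpha>] _ K_sub_V])
            then show False using neq by simp
          qed
          have pow: "\<alpha> [^]\<^bsub>AG\<^esub> (2 * i) \<in> G \<and> (\<alpha> [^]\<^bsub>AG\<^esub> (2 * i)) ` K k = K k" for i :: nat
          proof (induction i)
            case 0
            have "\<one>\<^bsub>AG\<^esub> ` K k = K k" using K_sub_V by (auto simp: AutoGroup_one)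
            then show ?case using G.one_closed by simp
          next
            case (Suc i)
            have ac: "\<alpha> \<in> carrier AG" using Ga[OF \<alpha>] by simp
            have "\<alpha> [^]\<^bsub>AG\<^esub> (2 * Suc i) = \<alpha> [^]\<^bsub>AG\<^esub> (2 * i) \<otimes>\<^bsub>AG\<^esub> ?b"
              using AG.nat_pow_mult[OF ac, of "2 * i" 2] ac by (simp add: numeral_2_eq_2 AG.m_assoc)
            moreover have "(\<alpha> [^]\<^bsub>AG\<^esub> (2 * i) \<otimes>\<^bsub>AG\<^esub> ?b) ` K k = K k"
              using Suc sq AutoGroup_image[OF Ga Ga[OF b] K_sub_V] by simp
            ultimately show ?case using Suc b G.m_closed by simp
          qed
          have "odd (card G)" using G(2) True by (metis coprime_right_2_iff_odd)
          then obtain i where i: "card G = Suc (2 * i)" by (auto elim: oddE)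
          let ?G = "AG\<lparr>carrier := G\<rparr>"
          interpret GG: group ?G using G(1) by (rule AG.subgroup_imp_group)
          have "\<alpha> [^]\<^bsub>AG\<^esub> card G = \<one>\<^bsub>AG\<^esub>"
            using GG.pow_order_eq_1[of \<alpha>] \<alpha> AG.nat_pow_consistent[of \<alpha> "card G" G] by (simp add: order_def)
          then have "\<alpha> [^]\<^bsub>AG\<^esub> (2 * i) \<otimes>\<^bsub>AG\<^esub> \<alpha> = \<one>\<^bsub>AG\<^esub>"
            using i by simp
          then have one: "\<gamma> \<otimes>\<^bsub>AG\<^esub> \<alpha> = \<one>\<^bsub>AG\<^esub>"
            if "\<gamma> = \<alpha> [^]\<^bsub>AG\<^esub> (2 * i)" for \<gamma> using that by simp
          obtain \<gamma> where \<gamma>: "\<gamma> \<in> G" "\<gamma> ` K k = K k" "\<gamma> = \<alpha> [^]\<^bsub>AG\<^esub> (2 * i)"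
            using pow[of i] by blast
          have "\<gamma> ` (\<alpha> ` K k) = (\<gamma> \<otimes>\<^bsub>AG\<^esub> \<alpha>) ` K k"
            by (rule AutoGroup_image[OF Ga[OF \<gamma>(1)] Ga[OF \<alpha>] K_sub_V, symmetric])
          also have "\<dots> = \<one>\<^bsub>AG\<^esub> ` K k" by (simp only: one[OF \<gamma>(3)])
          also have "\<dots> = K k" using K_sub_V by (auto simp: AutoGroup_one)
          also have "\<dots> = \<gamma> ` K k" by (rule \<gamma>(2)[symmetric])
          finally have "\<gamma> ` (\<alpha> ` K k) = \<gamma> ` K k" .
          moreover have "\<alpha> ` K k \<subseteq> V" using K_sub_V auto_closed[OF Ga[OF \<alpha>]] by blast
          ultimately have "\<alpha> ` K k = K k"
            by (intro auto_image_cancel[OF Ga[OF \<gamma>(1)] _ K_sub_V])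
          then show False using neq by simp
        qed
      qed
    qed
  qed
  then show ?thesis using \<alpha> by blast
qed

section \<open>Automorphisms preserving the flag of level stabilizers\<close>

definition flagAut :: "((int list \<Rightarrow> int) \<Rightarrow> int list \<Rightarrow> int) set" where
  "flagAut = {\<alpha> \<in> auto VG. \<forall>k\<le>n. \<alpha> ` K k = K k}"

text \<open>These automorphisms act unipotently on the coordinates \<open>lam [] j\<close>,
  triangularly with respect to the flag of the \<open>K j\<close>.\<close>

definition uniAut :: "((int list \<Rightarrow> int) \<Rightarrow> int list \<Rightarrow> int) set" where
  "uniAut = {\<alpha> \<in> flagAut. \<forall>j<n. \<forall>h\<in>K j. lam [] j (\<alpha> h) = lam [] j h}"

definition scale :: "(nat \<Rightarrow> int) \<Rightarrow> int list \<Rightarrow> int list" where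
  "scale t v = map (\<lambda>i. (t i * v ! i) mod int p) [0..<length v]"

text \<open>The relation says that \<open>\<alpha> g\<close> acts on the tree as \<open>g\<close>
  does after digits at position \<open>i\<close> are rescaled by \<open>t i\<close>. Stating it at
  \<open>scale t v\<close> avoids the inverse scaling.\<close>

definition torus :: "((int list \<Rightarrow> int) \<Rightarrow> int list \<Rightarrow> int) set" where
  "torus = {\<alpha> \<in> auto VG. \<exists>t. (\<forall>i. t i \<in> {1..<int p}) \<and>
     (\<forall>g\<in>V. \<forall>v\<in>nodes. \<alpha> g (scale t v) = (t (length v) * g v) mod int p)}"

lemma flagAut_auto: "\<alpha> \<in> flagAut \<Longrightarrow> \<alpha> \<in> auto VG" by (simp add: flagAut_def)
lemma flagAut_K: "\<alpha> \<in> flagAut \<Longrightarrow> k \<le> n \<Longrightarrow> \<alpha> ` K k = K k" by (simp add: flagAut_def)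
lemma flagAut_mem_K: "\<alpha> \<in> flagAut \<Longrightarrow> k \<le> n \<Longrightarrow> h \<in> K k \<Longrightarrow> \<alpha> h \<in> K k" using flagAut_K by blast

lemma flagAut_subgroup: "subgroup flagAut (AutoGroup VG)"
proof (rule AG.subgroup_if_finite_closed)
  show "finite (carrier AG)" using finite_auto by simp
  show "flagAut \<subseteq> carrier AG" using flagAut_auto by auto
  have "\<one>\<^bsub>AG\<^esub> ` K k = K k" for k using K_sub_V by (auto simp: AutoGroup_one)
  then show "\<one>\<^bsub>AG\<^esub> \<in> flagAut" using AG.one_closed by (simp add: flagAut_def)
  fix \<alpha> \<beta> assume ab: "\<alpha> \<in> flagAut" "\<beta> \<in> flagAut"
  have "(\<alpha> \<otimes>\<^bsub>AG\<^esub> \<beta>) ` K k = K k" if "k \<le> n" for k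
    using AutoGroup_image[OF flagAut_auto[OF ab(1)] flagAut_auto[OF ab(2)] K_sub_V] ab that
    by (simp add: flagAut_K)
  moreover have "\<alpha> \<otimes>\<^bsub>AG\<^esub> \<beta> \<in> auto VG"
    using AG.m_closed[of \<alpha> \<beta>] ab flagAut_auto by simp
  ultimately show "\<alpha> \<otimes>\<^bsub>AG\<^esub> \<beta> \<in> flagAut" by (simp add: flagAut_def)
qed

abbreviation FG where "FG \<equiv> AG\<lparr>carrier := flagAut\<rparr>"

sublocale FG: group FG by (rule AG.subgroup_imp_group[OF flagAut_subgroup])

lemma FG_apply: "\<alpha> \<in> flagAut \<Longrightarrow> \<beta> \<in> flagAut \<Longrightarrow> x \<in> V \<Longrightarrow> (\<alpha> \<otimes>\<^bsub>AG\<^esub> \<beta>) x = \<alpha> (\<beta> x)"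
  using AutoGroup_apply flagAut_auto by blast

lemma lam_vanish_low: "h \<in> K j \<Longrightarrow> i < j \<Longrightarrow> lam [] i h = 0"
  unfolding lam_def using K_vanish[of h j] length_word by (auto intro!: sum.neutral)

lemma single_lam: "j < n \<Longrightarrow> w \<in> word j \<Longrightarrow> lam [] j (lev j (\<lambda>v. of_bool (v = w))) = 1"
proof -
  assume j: "j < n" "w \<in> word j"
  have "(\<Sum>v\<in>word j. lev j (\<lambda>v. of_bool (v = w)) v) = (\<Sum>v\<in>word j. if v = w then 1 else 0)"
    using j p_gt_1 by (intro sum.cong) (auto simp: lev_def)
  then show ?thesis using p_gt_1 j by (simp add: lam_def)
qed

text \<open>\<open>\<alpha>\<close> descends to \<open>K j\<close> modulo \<open>K (Suc j)\<close>,
  where elements are functions on level \<open>j\<close>.\<close>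

lemma flagAut_lam_cong:
  assumes \<alpha>: "\<alpha> \<in> flagAut" and j: "j < n" and xy: "x \<in> K j" "y \<in> K j"
    "\<And>v. v \<in> word j \<Longrightarrow> [x v = y v] (mod int p)"
  shows "lam [] j (\<alpha> x) = lam [] j (\<alpha> y)"
proof -
  obtain z where z: "z \<in> K (Suc j)" "x = mul z y" using K_eq_mod[OF xy] by blast
  have zV: "z \<in> V" and yV: "y \<in> V" using z xy K_V by auto
  have az: "\<alpha> z \<in> K (Suc j)" using flagAut_mem_K[OF \<alpha> _ z(1)] j by simp
  have "lam [] j (\<alpha> x) = (lam [] j (\<alpha> z) + lam [] j (\<alpha> y)) mod int p"
    using auto_mul[OF flagAut_auto[OF \<alpha>] zV yV] z(2) auto_closed[OF flagAut_auto[OF \<alpha>]] zV yV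
    by (simp add: lam_Nil_mul)
  then show ?thesis using lam_vanish_low[OF az] by simp
qed

text \<open>Point masses on level \<open>j\<close> are conjugate modulo \<open>K (Suc j)\<close>, so
  by \<open>lam_conj\<close> their images share one value \<open>t\<close>; additivity does the
  rest. Invariantly, \<open>lam [] j\<close> is the coordinate on the one-dimensional coinvariants
  of the permutation module.\<close>

lemma flagAut_lam:
  assumes \<alpha>: "\<alpha> \<in> flagAut" and j: "j < n"
  shows "\<exists>t. \<forall>h\<in>K j. lam [] j (\<alpha> h) = (t * lam [] j h) mod int p"
proof -
  let ?e = "\<lambda>w. lev j (\<lambda>v. of_bool (v = w))"
  have aa: "\<alpha> \<in> auto VG" using \<alpha> by (rule flagAut_auto)
  define t where "t = lam [] j (\<alpha> (?e (replicate j 0)))"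
  have single: "lam [] j (\<alpha> (?e w)) = t" if w: "w \<in> word j" for w
  proof -
    let ?m = "move (replicate j 0) w"
    have mw: "act ?m (replicate j 0) = w" using act_move[OF zeros_word w] j by simp
    have "lam [] j (\<alpha> (?e w)) = lam [] j (\<alpha> (conjugate ?m (?e (replicate j 0))))"
    proof (rule flagAut_lam_cong[OF \<alpha> j lev_K conj_K[OF move_V lev_K]])
      fix v assume v: "v \<in> word j"
      show "[?e w v = conjugate ?m (?e (replicate j 0)) v] (mod int p)"
        using conj_lev_single[OF move_V zeros_word v j, of "replicate j 0" w] mw v j p_gt_1
        by (simp add: lev_def)
    qed
    also have "\<dots> = lam (act (\<alpha> ?m) []) j (conjugate (\<alpha> ?m) (\<alpha> (?e (replicate j 0))))"
      using auto_conj[OF aa] by simp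
    also have "\<dots> = lam [] j (\<alpha> (?e (replicate j 0)))"
      by (rule lam_conj[where k = 0]) (use aa auto_closed in \<open>auto simp: word_0\<close>)
    finally show ?thesis by (simp add: t_def)
  qed
  have add: "lam [] j (\<alpha> (lev j (\<lambda>v. f v + f' v))) = (lam [] j (\<alpha> (lev j f)) + lam [] j (\<alpha> (lev j f'))) mod int p" for f f'
    using auto_closed[OF aa] by (simp add: lev_add[symmetric] auto_mul[OF aa] lam_Nil_mul)
  have zero: "lam [] j (\<alpha> (lev j (\<lambda>_. 0))) = 0"
  proof -
    have "lev j (\<lambda>_. 0) = (\<lambda>_. 0)" by (auto simp: lev_def)
    then show ?thesis using group_hom.hom_one[OF auto_group_hom[OF aa]] by simp
  qed
  have mult: "lam [] j (\<alpha> (lev j (\<lambda>v. int m * of_bool (v = w)))) = (t * int m) mod int p" if w: "w \<in> word j" for m w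
  proof (induction m)
    case (Suc m)
    have "lam [] j (\<alpha> (lev j (\<lambda>v. int m * of_bool (v = w) + of_bool (v = w)))) = (t * int m + t) mod int p"
      using add[of "\<lambda>v. int m * of_bool (v = w)" "\<lambda>v. of_bool (v = w)"] Suc single[OF w] by (simp add: mod_simps)
    moreover have "(\<lambda>v. int m * of_bool (v = w) + of_bool (v = w)) = (\<lambda>v. int (Suc m) * of_bool (v = w))"
      by (auto simp: algebra_simps)
    ultimately show ?case by (simp add: algebra_simps)
  qed (simp add: zero)
  have sum: "lam [] j (\<alpha> (lev j (\<lambda>v. \<Sum>w\<in>S. int (c w) * of_bool (v = w)))) = (t * (\<Sum>w\<in>S. int (c w))) mod int p"
    if "finite S" "S \<subseteq> word j" for S and c :: "int list \<Rightarrow> nat"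
    using that
  proof (induction S)
    case (insert w S)
    let ?f = "\<lambda>S v. \<Sum>w\<in>S. int (c w) * of_bool (v = w)"
    have eq: "?f (insert w S) = (\<lambda>v. int (c w) * of_bool (v = w) + ?f S v)"
      by (intro ext sum.insert[OF insert.hyps])
    have IH: "lam [] j (\<alpha> (lev j (?f S))) = (t * (\<Sum>w\<in>S. int (c w))) mod int p"
      using insert by blast
    have "lam [] j (\<alpha> (lev j (?f (insert w S)))) =
        ((t * int (c w)) mod int p + (t * (\<Sum>w\<in>S. int (c w))) mod int p) mod int p"
      unfolding eq add IH using mult[of w "c w"] insert.prems by simp
    also have "\<dots> = (t * (\<Sum>w\<in>insert w S. int (c w))) mod int p"
      using insert.hyps by (simp add: mod_simps distrib_left)
    finally show ?case .
  qed (simp add: zero)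
  show ?thesis
  proof (intro exI[of _ t] ballI)
    fix h assume h: "h \<in> K j"
    have pos: "0 \<le> h w" for w using V_range[OF K_V[OF h], of w] by simp
    define F where "F = (\<lambda>v. \<Sum>w\<in>word j. int (nat (h w)) * of_bool (v = w))"
    have "lam [] j (\<alpha> h) = lam [] j (\<alpha> (lev j F))"
    proof (rule flagAut_lam_cong[OF \<alpha> j h lev_K])
      fix v assume v: "v \<in> word j"
      have "F v = (\<Sum>w\<in>word j. if v = w then h w else 0)"
        unfolding F_def by (rule sum.cong) (auto simp: pos)
      also have "\<dots> = h v" using v by simp
      finally have "F v = h v" .
      then show "[h v = lev j F v] (mod int p)"
        using v j by (simp add: lev_def cong_def)
    qed
    also have "\<dots> = (t * (\<Sum>w\<in>word j. int (nat (h w)))) mod int p"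
      unfolding F_def by (rule sum) auto
    also have "\<dots> = (t * lam [] j h) mod int p"
      using pos by (simp add: lam_def mod_simps)
    finally show "lam [] j (\<alpha> h) = (t * lam [] j h) mod int p" .
  qed
qed

lemma inv_flagAut: "\<alpha> \<in> flagAut \<Longrightarrow> inv\<^bsub>AG\<^esub> \<alpha> \<in> flagAut"
  by (rule subgroup.m_inv_closed[OF flagAut_subgroup])

lemma auto_inv_apply:
  assumes "\<alpha> \<in> auto VG" "x \<in> V"
  shows "\<alpha> ((inv\<^bsub>AG\<^esub> \<alpha>) x) = x" "(inv\<^bsub>AG\<^esub> \<alpha>) (\<alpha> x) = x"
proof -
  have i: "inv\<^bsub>AG\<^esub> \<alpha> \<in> auto VG" using AG.inv_closed[of \<alpha>] assms by simp
  show "\<alpha> ((inv\<^bsub>AG\<^esub> \<alpha>) x) = x"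
    using AutoGroup_apply[OF assms(1) i assms(2)] AG.r_inv[of \<alpha>] assms by (simp add: AutoGroup_one)
  show "(inv\<^bsub>AG\<^esub> \<alpha>) (\<alpha> x) = x"
    using AutoGroup_apply[OF i assms(1,2)] AG.l_inv[of \<alpha>] assms by (simp add: AutoGroup_one)
qed

lemma uniAut_subgroup: "subgroup uniAut FG"
proof (rule FG.subgroup_if_finite_closed)
  show "finite (carrier FG)" using finite_auto by (auto simp: flagAut_def)
  show "uniAut \<subseteq> carrier FG" by (auto simp: uniAut_def)
  have "\<one>\<^bsub>AG\<^esub> \<in> flagAut" by (rule subgroup.one_closed[OF flagAut_subgroup])
  then show "\<one>\<^bsub>FG\<^esub> \<in> uniAut" using K_V by (simp add: uniAut_def AutoGroup_one)
  fix \<alpha> \<beta> assume ab: "\<alpha> \<in> uniAut" "\<beta> \<in> uniAut"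
  then have f: "\<alpha> \<in> flagAut" "\<beta> \<in> flagAut" by (auto simp: uniAut_def)
  have "lam [] j ((\<alpha> \<otimes>\<^bsub>AG\<^esub> \<beta>) h) = lam [] j h" if "j < n" "h \<in> K j" for j h
    using ab flagAut_mem_K[OF f(2) _ that(2)] that FG_apply[OF f K_V[OF that(2)]] by (simp add: uniAut_def)
  then show "\<alpha> \<otimes>\<^bsub>FG\<^esub> \<beta> \<in> uniAut"
    using subgroup.m_closed[OF flagAut_subgroup f] by (simp add: uniAut_def)
qed

text \<open>\<open>\<alpha>\<close> multiplies \<open>lam [] j\<close> on \<open>K j\<close> by a
  scalar, which sees no difference between an element and its image under \<open>u\<close>.\<close>

lemma uniAut_normal: "uniAut \<lhd> FG"
proof -
  have "\<alpha> \<otimes>\<^bsub>FG\<^esub> u \<otimes>\<^bsub>FG\<^esub> inv\<^bsub>FG\<^esub> \<alpha> \<in> uniAut" if \<alpha>: "\<alpha> \<in> flagAut" and u: "u \<in> uniAut" for \<alpha> u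
  proof -
    have uf: "u \<in> flagAut" using u by (simp add: uniAut_def)
    let ?i = "inv\<^bsub>AG\<^esub> \<alpha>"
    have i: "?i \<in> flagAut" by (rule inv_flagAut[OF \<alpha>])
    have ieq: "inv\<^bsub>FG\<^esub> \<alpha> = ?i" using AG.m_inv_consistent[OF flagAut_subgroup \<alpha>] .
    have au: "\<alpha> \<otimes>\<^bsub>AG\<^esub> u \<in> flagAut" using subgroup.m_closed[OF flagAut_subgroup \<alpha> uf] .
    have "lam [] j ((\<alpha> \<otimes>\<^bsub>AG\<^esub> u \<otimes>\<^bsub>AG\<^esub> ?i) h) = lam [] j h" if j: "j < n" and h: "h \<in> K j" for j h
    proof -
      let ?h = "?i h"
      have hK: "?h \<in> K j" using flagAut_mem_K[OF i _ h] j by simp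
      have hV: "h \<in> V" "?h \<in> V" using h hK K_V by auto
      have uK: "u ?h \<in> K j" using flagAut_mem_K[OF uf _ hK] j by simp
      have "lam [] j (u ?h) = lam [] j ?h" using u j hK by (simp add: uniAut_def)
      moreover obtain t where t: "\<forall>h\<in>K j. lam [] j (\<alpha> h) = (t * lam [] j h) mod int p"
        using flagAut_lam[OF \<alpha> j] by blast
      ultimately have "lam [] j (\<alpha> (u ?h)) = lam [] j (\<alpha> ?h)" using uK hK by simp
      also have "\<alpha> ?h = h" by (rule auto_inv_apply[OF flagAut_auto[OF \<alpha>] hV(1)])
      finally show ?thesis
        using FG_apply[OF au i hV(1)] FG_apply[OF \<alpha> uf hV(2)] by simp
    qed
    then show ?thesis
      using subgroup.m_closed[OF flagAut_subgroup au i] by (simp add: uniAut_def ieq)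
  qed
  then show ?thesis using uniAut_subgroup by (simp add: FG.normal_inv_iff)
qed

text \<open>The set is a coset of the kernel of \<open>lam [] j\<close> on \<open>K j\<close>, and
  that kernel is a \<open>p\<close>-group.\<close>

lemma card_lam_one:
  assumes j: "j < n"
  shows "\<exists>l. card {v \<in> K j. lam [] j v = 1} = p ^ l"
proof -
  let ?S0 = "{v \<in> K j. lam [] j v = 0}" and ?S1 = "{v \<in> K j. lam [] j v = 1}"
  let ?e = "lev j (\<lambda>v. of_bool (v = replicate j 0))"
  have e: "lam [] j ?e = 1" by (rule single_lam[OF j]) simp
  have sub: "subgroup ?S0 VG"
  proof (rule VG.subgroup_if_finite_closed)
    fix x y assume xy: "x \<in> ?S0" "y \<in> ?S0"
    then have "mul x y \<in> K j" using subgroup.m_closed[OF K_subgroup, of x j y] by simp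
    then show "x \<otimes>\<^bsub>VG\<^esub> y \<in> ?S0" using xy K_V[of x j] K_V[of y j] by (simp add: lam_Nil_mul)
  qed (use K_V subgroup.one_closed[OF K_subgroup] in auto)
  obtain l where l: "card ?S0 = p ^ l" using VG.order_subgroup_prime_power[OF prime_p order_VG sub] by blast
  have "bij_betw (mul ?e) ?S0 ?S1"
  proof (rule bij_betw_byWitness[where f' = "mul (inv\<^bsub>VG\<^esub> ?e)"])
    show "\<forall>a\<in>?S0. mul (inv\<^bsub>VG\<^esub> ?e) (mul ?e a) = a"
      using VG.inv_mult_cancel(1)[of ?e] K_V by auto
    show "\<forall>a\<in>?S1. mul ?e (mul (inv\<^bsub>VG\<^esub> ?e) a) = a"
      using VG.inv_mult_cancel(2)[of ?e] K_V by auto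
    show "mul ?e ` ?S0 \<subseteq> ?S1"
    proof (rule image_subsetI)
      fix x assume "x \<in> ?S0"
      then have x: "x \<in> K j" "lam [] j x = 0" by auto
      then have "mul ?e x \<in> K j" using subgroup.m_closed[OF K_subgroup lev_K x(1)] by simp
      then show "mul ?e x \<in> ?S1" using x e K_V[OF x(1)] p_gt_1 by (simp add: lam_Nil_mul)
    qed
    show "mul (inv\<^bsub>VG\<^esub> ?e) ` ?S1 \<subseteq> ?S0"
    proof (rule image_subsetI)
      fix x assume "x \<in> ?S1"
      then have x: "x \<in> K j" "lam [] j x = 1" by auto
      have ie: "inv\<^bsub>VG\<^esub> ?e \<in> K j" by (simp add: inv_lev lev_K)
      have xK: "mul (inv\<^bsub>VG\<^esub> ?e) x \<in> K j" using subgroup.m_closed[OF K_subgroup ie x(1)] by simp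
      have "lam [] j (mul ?e (mul (inv\<^bsub>VG\<^esub> ?e) x)) = (1 + lam [] j (mul (inv\<^bsub>VG\<^esub> ?e) x)) mod int p"
        using lam_Nil_mul[OF lev_V K_V[OF xK]] e by simp
      then have "[1 + 0 = 1 + lam [] j (mul (inv\<^bsub>VG\<^esub> ?e) x)] (mod int p)"
        using VG.inv_mult_cancel(2)[of ?e x] K_V[OF x(1)] x(2) p_gt_1 by (simp add: cong_def)
      then have "[0 = lam [] j (mul (inv\<^bsub>VG\<^esub> ?e) x)] (mod int p)" by (simp only: cong_add_lcancel)
      then have "lam [] j (mul (inv\<^bsub>VG\<^esub> ?e) x) = 0" by (simp add: cong_def)
      with xK show "mul (inv\<^bsub>VG\<^esub> ?e) x \<in> ?S0" by simp
    qed
  qed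
  then have "card ?S0 = card ?S1" by (rule bij_betw_same_card)
  then show ?thesis using l by metis
qed

text \<open>\<open>uniAut\<close> acts freely on the tuples counted here, because each of them generates \<open>V\<close>.\<close>

lemma card_uniAut: "\<exists>e. card uniAut = p ^ e"
proof -
  let ?S = "\<lambda>j. {v \<in> K j. lam [] j v = 1}"
  let ?E = "PiE {..<n} ?S"
  let ?f = "\<lambda>\<alpha> x. \<lambda>j\<in>{..<n}. \<alpha> (x j)"
  let ?U = "FG\<lparr>carrier := uniAut\<rparr>"
  interpret UG: group ?U using uniAut_subgroup by (rule FG.subgroup_imp_group)
  have finS: "finite (?S j)" for j using finite_subset[OF K_sub_V finite_V, of j] by simp
  have flag: "\<alpha> \<in> flagAut" if "\<alpha> \<in> uniAut" for \<alpha> using that by (simp add: uniAut_def)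
  have S_V: "x j \<in> V" "x j \<in> K j" "lam [] j (x j) = 1" if "x \<in> ?E" "j < n" for x j
    using PiE_mem[OF that(1), of j] that(2) K_V by auto
  have "order ?U dvd card ?E"
  proof (rule UG.order_dvd_card_if_free[where f = ?f])
    show "finite ?E" by (rule finite_PiE) (use finS in auto)
  next
    fix g x assume g: "g \<in> carrier ?U" and x: "x \<in> ?E"
    then have gu: "g \<in> uniAut" by simp
    show "?f g x \<in> ?E"
    proof (rule PiE_I)
      fix j assume j: "j \<in> {..<n}"
      then have "g (x j) \<in> K j" "lam [] j (g (x j)) = lam [] j (x j)"
        using flagAut_mem_K[OF flag[OF gu]] S_V[OF x, of j] gu by (auto simp: uniAut_def)
      then show "?f g x j \<in> ?S j" using j S_V[OF x, of j] by simp
    qed simp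
  next
    fix g h x assume "g \<in> carrier ?U" "h \<in> carrier ?U" and x: "x \<in> ?E"
    then have "g \<in> flagAut" "h \<in> flagAut" using flag by auto
    then show "?f (g \<otimes>\<^bsub>?U\<^esub> h) x = ?f g (?f h x)"
      using S_V(1)[OF x] by (auto simp: FG_apply restrict_def)
  next
    fix x assume x: "x \<in> ?E"
    show "?f \<one>\<^bsub>?U\<^esub> x = x"
    proof
      fix j show "?f \<one>\<^bsub>?U\<^esub> x j = x j"
        using S_V(1)[OF x, of j] PiE_arb[OF x, of j] by (cases "j < n") (auto simp: AutoGroup_one)
    qed
  next
    fix g x assume "g \<in> carrier ?U" and x: "x \<in> ?E" and fx: "?f g x = x"
    then have gf: "g \<in> flagAut" using flag by simp
    then have ga: "g \<in> auto VG" by (rule flagAut_auto)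
    have gx: "g (x j) = x j" if "j < n" for j using fun_cong[OF fx, of j] that by simp
    \<comment> \<open>The fixed points of \<open>g\<close> contain the entries of the tuple, which
      are triangular in the coordinates \<open>lam []\<close>.\<close>
    have "{v \<in> V. g v = v} = V"
    proof (rule subgroup_eq_V_if_lam)
      show "subgroup {v \<in> V. g v = v} VG"
      proof (rule VG.subgroup_if_finite_closed)
        show "\<one>\<^bsub>VG\<^esub> \<in> {v \<in> V. g v = v}" using group_hom.hom_one[OF auto_group_hom[OF ga]] by simp
      qed (use auto_mul[OF ga] in auto)
      fix j assume j: "j < n"
      have "lam [] i (x j) = 0" if "i < j" for i using lam_vanish_low[OF S_V(2)[OF x j] that] .
      then show "\<exists>y\<in>{v \<in> V. g v = v}. (\<forall>i<j. lam [] i y = 0) \<and> lam [] j y \<noteq> 0"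
        using S_V[OF x j] gx[OF j] by (intro bexI[of _ "x j"]) auto
    qed
    then have "g v = v" if "v \<in> V" for v using that by blast
    then show "g = \<one>\<^bsub>?U\<^esub>"
      using AG.one_closed by (intro auto_eqI[OF ga]) (auto simp: AutoGroup_one)
  qed
  moreover have "\<exists>e. card ?E = p ^ e"
  proof -
    obtain l where l: "\<And>j. j < n \<Longrightarrow> card (?S j) = p ^ l j" using card_lam_one by metis
    have "card ?E = (\<Prod>j<n. p ^ l j)" by (simp add: card_PiE l)
    also have "\<dots> = p ^ (\<Sum>j<n. l j)" by (simp add: power_sum)
    finally show ?thesis by blast
  qed
  ultimately obtain e where "card uniAut dvd p ^ e" by (auto simp: order_def)
  then show ?thesis using divides_primepow_nat[OF prime_p] by blast
qed

section \<open>Digit scaling and the torus\<close>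

lemma length_scale [simp]: "length (scale t v) = length v"
  by (simp add: scale_def)

lemma scale_snoc: "scale t (v @ [d]) = scale t v @ [(t (length v) * d) mod int p]"
  by (auto simp: scale_def nth_append intro!: nth_equalityI)

lemma nth_scale: "i < length v \<Longrightarrow> scale t v ! i = (t i * v ! i) mod int p"
  by (simp add: scale_def)

lemma scale_word [intro]: "v \<in> word j \<Longrightarrow> scale t v \<in> word j"
  by (auto simp: word_def scale_def)

lemma scale_append: "scale t (u @ v) = scale t u @ scale (\<lambda>i. t (length u + i)) v"
  by (rule nth_equalityI) (auto simp: nth_append nth_scale)

lemma word_nth: "v \<in> word j \<Longrightarrow> i < j \<Longrightarrow> v ! i \<in> {0..<int p}"
  by (auto simp: word_def dest!: nth_mem)

lemma scale_scale:
  assumes v: "v \<in> word j" and t: "\<And>i. [t i * s i = 1] (mod int p)"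
  shows "scale t (scale s v) = v"
proof (rule nth_equalityI)
  fix i assume i: "i < length (scale t (scale s v))"
  have "scale t (scale s v) ! i = (t i * s i * v ! i) mod int p"
    using i by (simp add: nth_scale mod_simps mult.assoc)
  also have "[t i * s i * v ! i = 1 * v ! i] (mod int p)" using t by (rule cong_scalar_right)
  then have "(t i * s i * v ! i) mod int p = v ! i"
    using word_nth[OF v, of i] i v by (simp add: cong_def length_word)
  finally show "scale t (scale s v) ! i = v ! i" .
qed simp

lemma inverses_mod:
  assumes "\<And>i. t i \<in> {1..<int p}"
  obtains s where "\<And>i. s i \<in> {1..<int p}" "\<And>i. [t i * s i = 1] (mod int p)" "\<And>i. [s i * t i = 1] (mod int p)"
proof -
  have "\<exists>x\<in>{1..<int p}. [a * x = 1] (mod int p)" if a: "a \<in> {1..<int p}" for a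
  proof -
    have "\<not> [a = 0] (mod int p)" using a by (simp add: cong_def)
    from solve_mod[OF this, of 1] obtain m :: nat where m: "[int m * a = 1] (mod int p)" by blast
    let ?x = "int m mod int p"
    have "[a * ?x = a * int m] (mod int p)" by (simp add: cong_def mod_simps)
    also have "[a * int m = 1] (mod int p)" using m by (simp add: mult.commute)
    finally have x: "[a * ?x = 1] (mod int p)" .
    have "?x \<noteq> 0"
    proof
      assume "?x = 0"
      then show False using x p_gt_1 by (simp add: cong_def)
    qed
    moreover have "0 \<le> ?x" "?x < int p" by auto
    ultimately have "?x \<in> {1..<int p}" unfolding atLeastLessThan_iff by linarith
    then show ?thesis using x by blast
  qed
  then obtain f where f: "\<And>a. a \<in> {1..<int p} \<Longrightarrow> f a \<in> {1..<int p} \<and> [a * f a = 1] (mod int p)" by metis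
  show thesis
    by (rule that[of "\<lambda>i. f (t i)"]) (use f assms in \<open>auto simp: mult.commute\<close>)
qed

lemma bij_scale:
  assumes "\<And>i. t i \<in> {1..<int p}"
  shows "bij_betw (scale t) (word j) (word j)"
proof -
  obtain s where "\<And>i. s i \<in> {1..<int p}"
    and s: "\<And>i. [t i * s i = 1] (mod int p)" "\<And>i. [s i * t i = 1] (mod int p)"
    using assms by (rule inverses_mod) (rule that)
  show ?thesis
    by (rule bij_betw_byWitness[where f' = "scale s"]) (use scale_scale s in auto)
qed

lemma scale_surj:
  assumes "\<And>i. t i \<in> {1..<int p}" "w \<in> word j"
  shows "\<exists>v\<in>word j. scale t v = w"
proof -
  have "w \<in> scale t ` word j"
    using bij_scale[where t = t and j = j, OF assms(1)] assms(2) by (simp add: bij_betw_def)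
  then show ?thesis by blast
qed

lemma act_scale:
  assumes g: "g \<in> V" "h \<in> V" and eq: "\<And>v. v \<in> nodes \<Longrightarrow> h (scale t v) = (t (length v) * g v) mod int p"
    and v: "v \<in> word j" "j \<le> n"
  shows "act h (scale t v) = scale t (act g v)"
  using v
proof (induction v arbitrary: j rule: rev_induct)
  case (snoc d v)
  have v: "v \<in> word (length v)" "length v < n" using snoc.prems by (auto simp: word_def)
  then have "v \<in> nodes" by (simp add: word_nodes)
  then show ?case using snoc.IH[OF v(1)] v eq[of v]
    by (simp add: act_snoc scale_snoc mod_simps algebra_simps)
qed (simp add: scale_def)

text \<open>\<open>A g\<close> is \<open>g\<close> transported along the scaling: it reads
  \<open>g\<close> at \<open>scale s w\<close>, with \<open>s\<close> the inverse units, and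
  multiplies the shift by the unit of that depth.\<close>

lemma torus_exists:
  assumes t: "\<And>i. t i \<in> {1..<int p}"
  shows "\<exists>\<alpha>\<in>auto VG. \<forall>g\<in>V. \<forall>v\<in>nodes. \<alpha> g (scale t v) = (t (length v) * g v) mod int p"
proof -
  obtain s where s: "\<And>i. s i \<in> {1..<int p}" "\<And>i. [t i * s i = 1] (mod int p)" "\<And>i. [s i * t i = 1] (mod int p)"
    using t by (rule inverses_mod) (rule that)
  define A where "A g = (\<lambda>w. if w \<in> nodes then (t (length w) * g (scale s w)) mod int p else 0)"
    for g :: "int list \<Rightarrow> int"
  have AV: "A g \<in> V" for g by (auto simp: A_def V_def)
  have nodes: "scale t v \<in> nodes" if "v \<in> nodes" for v
    using nodesD[OF that] word_nodes[OF scale_word, of v "length v"] by simp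
  have A: "A g (scale t v) = (t (length v) * g v) mod int p" if "v \<in> nodes" for g v
    using nodes[OF that] scale_scale[of v "length v" s t] s nodesD[OF that] by (simp add: A_def)
  have hom: "A (mul g h) = mul (A g) (A h)" if gh: "g \<in> V" "h \<in> V" for g h
  proof (rule V_eqI)
    fix w j assume w: "j < n" "w \<in> word j"
    then obtain v where v: "v \<in> word j" "w = scale t v" using bij_scale[where t = t and j = j, OF t] by (auto simp: bij_betw_def)
    have vn: "v \<in> nodes" and avn: "act h v \<in> nodes" using word_nodes[OF v(1)] word_nodes[OF act_word[OF v(1)]] w by auto
    have "mul (A g) (A h) w = (A h w + A g (act (A h) w)) mod int p"
      by (rule mul_apply[OF AV AV w(2)])
    also have "act (A h) w = scale t (act h v)"
      using act_scale[OF gh(2) AV[of h] A v(1)] w v(2) by simp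
    also have "A h w = (t j * h v) mod int p" using A[OF vn, of h] v by (simp add: length_word)
    also have "A g (scale t (act h v)) = (t j * g (act h v)) mod int p" using A[OF avn, of g] v by (simp add: length_word)
    finally have 1: "mul (A g) (A h) w = (t j * (h v + g (act h v))) mod int p" by (simp add: mod_simps algebra_simps)
    have "A (mul g h) w = (t j * mul g h v) mod int p" using A[OF vn, of "mul g h"] v by (simp add: length_word)
    also have "\<dots> = (t j * (h v + g (act h v))) mod int p" using mul_apply[OF gh v(1)] by (simp add: mod_simps)
    finally show "[A (mul g h) w = mul (A g) (A h) w] (mod int p)" using 1 by simp
  qed (use AV gh in auto)
  have inj: "inj_on A V"
  proof (rule inj_onI)
    fix g h assume gh: "g \<in> V" "h \<in> V" "A g = A h"
    show "g = h"
    proof (rule V_eqI[OF gh(1,2)])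
      fix v j assume v: "j < n" "v \<in> word j"
      then have "v \<in> nodes" by (simp add: word_nodes)
      then have "[t j * g v = t j * h v] (mod int p)"
        using A[of v g] A[of v h] gh(3) v by (simp add: length_word cong_def)
      then have "[s j * (t j * g v) = s j * (t j * h v)] (mod int p)" by (rule cong_scalar_left)
      then have "[(s j * t j) * g v = (s j * t j) * h v] (mod int p)" by (simp add: mult.assoc)
      moreover have "[(s j * t j) * x = 1 * x] (mod int p)" for x by (rule cong_scalar_right[OF s(3)])
      ultimately show "[g v = h v] (mod int p)" by (metis cong_sym cong_trans mult_1)
    qed
  qed
  have "A ` V = V" by (rule endo_inj_surj) (use AV inj in auto)
  then have "restrict A V \<in> auto VG"
    using inj hom AV by (auto simp: auto_def hom_def Bij_def bij_betw_def inj_on_def)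
  moreover have "\<forall>g\<in>V. \<forall>v\<in>nodes. restrict A V g (scale t v) = (t (length v) * g v) mod int p"
    using A by simp
  ultimately show ?thesis by blast
qed

lemma torusE:
  assumes "\<alpha> \<in> torus"
  obtains t where "\<alpha> \<in> auto VG" "\<And>i. t i \<in> {1..<int p}"
    "\<And>g v. g \<in> V \<Longrightarrow> v \<in> nodes \<Longrightarrow> \<alpha> g (scale t v) = (t (length v) * g v) mod int p"
  using assms unfolding torus_def by blast

lemma torus_flagAut: "torus \<subseteq> flagAut"
proof
  fix \<alpha> assume "\<alpha> \<in> torus"
  then obtain t where t: "\<alpha> \<in> auto VG" "\<And>i. t i \<in> {1..<int p}"
    "\<And>g v. g \<in> V \<Longrightarrow> v \<in> nodes \<Longrightarrow> \<alpha> g (scale t v) = (t (length v) * g v) mod int p"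
    by (rule torusE) blast
  have "\<alpha> ` K k \<subseteq> K k" for k
  proof (rule image_subsetI)
    fix g assume g: "g \<in> K k"
    have aV: "\<alpha> g \<in> V" using auto_closed[OF t(1) K_V[OF g]] .
    have "\<alpha> g w = 0" if w: "length w < k" for w
    proof (cases "w \<in> nodes")
      case True
      then obtain v where v: "v \<in> word (length w)" "w = scale t v"
        using scale_surj[where t = t and w = w, OF t(2)] nodesD[OF True] by blast
      then have "v \<in> nodes" using word_nodes[OF v(1)] nodesD[OF True] by simp
      moreover have "g v = 0" using K_vanish[OF g] length_word[OF v(1)] w by simp
      ultimately show ?thesis using t(3)[OF K_V[OF g], of v] v(2) by simp
    qed (use V_nonnode[OF aV] in simp)
    then show "\<alpha> g \<in> K k" using aV by (simp add: K_def)
  qed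
  then show "\<alpha> \<in> flagAut" using t(1) auto_image_eq[OF t(1) K_sub_V] by (simp add: flagAut_def)
qed

lemma torus_subgroup: "subgroup torus FG"
proof (rule FG.subgroup_if_finite_closed)
  show "finite (carrier FG)" using finite_auto by (auto simp: flagAut_def)
  show "torus \<subseteq> carrier FG" using torus_flagAut by simp
  have "scale (\<lambda>_. 1) v = v" if "v \<in> nodes" for v
    using scale_scale[of v "length v" "\<lambda>_. 1" "\<lambda>_. 1"] nodesD[OF that] word_nth[of v "length v"]
    by (auto intro!: nth_equalityI simp: nth_scale)
  moreover have "\<one>\<^bsub>AG\<^esub> \<in> auto VG" using AG.one_closed by simp
  ultimately show "\<one>\<^bsub>FG\<^esub> \<in> torus"
    using p_gt_1 by (auto simp: torus_def AutoGroup_one intro!: exI[of _ "\<lambda>_. 1"])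
  fix \<alpha> \<beta> assume ab: "\<alpha> \<in> torus" "\<beta> \<in> torus"
  obtain t where t: "\<alpha> \<in> auto VG" "\<And>i. t i \<in> {1..<int p}"
    "\<And>g v. g \<in> V \<Longrightarrow> v \<in> nodes \<Longrightarrow> \<alpha> g (scale t v) = (t (length v) * g v) mod int p"
    using ab(1) by (rule torusE) blast
  obtain s where s: "\<beta> \<in> auto VG" "\<And>i. s i \<in> {1..<int p}"
    "\<And>g v. g \<in> V \<Longrightarrow> v \<in> nodes \<Longrightarrow> \<beta> g (scale s v) = (s (length v) * g v) mod int p"
    using ab(2) by (rule torusE) blast
  define r where "r i = (t i * s i) mod int p" for i
  have r: "r i \<in> {1..<int p}" for i
  proof -
    have "\<not> int p dvd t i" "\<not> int p dvd s i"
      using t(2)[of i] s(2)[of i] zdvd_not_zless by auto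
    then have "\<not> int p dvd t i * s i"
      using prime_p by (simp add: prime_dvd_mult_iff)
    then have "r i \<noteq> 0" by (auto simp: r_def)
    moreover have "0 \<le> r i" "r i < int p" by (auto simp: r_def)
    ultimately show ?thesis unfolding atLeastLessThan_iff by linarith
  qed
  have sc: "scale r v = scale t (scale s v)" for v
    by (rule nth_equalityI) (auto simp: nth_scale r_def mod_simps mult.assoc)
  have nodes: "scale s v \<in> nodes" if "v \<in> nodes" for v
    using nodesD[OF that] word_nodes[OF scale_word, of v "length v"] by simp
  have "(\<alpha> \<otimes>\<^bsub>AG\<^esub> \<beta>) g (scale r v) = (r (length v) * g v) mod int p"
    if "g \<in> V" "v \<in> nodes" for g v
    using AutoGroup_apply[OF t(1) s(1) that(1)] t(3)[OF auto_closed[OF s(1) that(1)] nodes[OF that(2)]]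
      s(3)[OF that] by (simp add: sc r_def mod_simps mult.assoc)
  moreover have "\<alpha> \<otimes>\<^bsub>AG\<^esub> \<beta> \<in> auto VG" using AG.m_closed[of \<alpha> \<beta>] t(1) s(1) by simp
  ultimately show "\<alpha> \<otimes>\<^bsub>FG\<^esub> \<beta> \<in> torus" using r by (auto simp: torus_def)
qed

lemma torus_lam:
  assumes t: "\<And>i. t i \<in> {1..<int p}"
    "\<And>g v. g \<in> V \<Longrightarrow> v \<in> nodes \<Longrightarrow> \<alpha> g (scale t v) = (t (length v) * g v) mod int p"
    and g: "g \<in> V" and j: "j < n"
  shows "lam [] j (\<alpha> g) = (t j * lam [] j g) mod int p"
proof -
  have "(\<Sum>w\<in>word j. \<alpha> g w) = (\<Sum>v\<in>word j. \<alpha> g (scale t v))"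
    by (rule sum.reindex_bij_betw[OF bij_scale[OF t(1)], symmetric])
  also have "\<dots> = (\<Sum>v\<in>word j. (t j * g v) mod int p)"
    by (rule sum.cong) (use t(2)[OF g] j in \<open>auto simp: word_nodes length_word\<close>)
  finally show ?thesis by (simp add: lam_def mod_sum_eq sum_distrib_left mod_simps)
qed

lemma torus_uniAut: "torus \<inter> uniAut = {\<one>\<^bsub>FG\<^esub>}"
proof -
  have "\<alpha> = \<one>\<^bsub>FG\<^esub>" if \<alpha>: "\<alpha> \<in> torus" "\<alpha> \<in> uniAut" for \<alpha>
  proof -
    obtain t where t: "\<alpha> \<in> auto VG" "\<And>i. t i \<in> {1..<int p}"
      "\<And>g v. g \<in> V \<Longrightarrow> v \<in> nodes \<Longrightarrow> \<alpha> g (scale t v) = (t (length v) * g v) mod int p"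
      using \<alpha>(1) by (rule torusE) blast
    have t1: "t j = 1" if j: "j < n" for j
    proof -
      let ?e = "lev j (\<lambda>v. of_bool (v = replicate j 0))"
      have e: "lam [] j ?e = 1" by (rule single_lam[OF j]) simp
      have "lam [] j (\<alpha> ?e) = 1" using \<alpha>(2) j lev_K e by (simp add: uniAut_def)
      moreover have "lam [] j (\<alpha> ?e) = (t j * 1) mod int p"
        using torus_lam[OF t(2,3) lev_V j, of j] e by simp
      ultimately show ?thesis using t(2)[of j] by simp
    qed
    have scfix: "scale t v = v" if v: "v \<in> nodes" for v
      using nodesD[OF v] word_nth[of v "length v"] t1 by (auto intro!: nth_equalityI simp: nth_scale)
    have "\<alpha> g = g" if g: "g \<in> V" for g
    proof (rule V_eqI[OF auto_closed[OF t(1) g] g])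
      fix v j assume "j < n" "v \<in> word j"
      then have "v \<in> nodes" "t (length v) = 1" using t1 by (auto simp: word_nodes length_word)
      then show "[\<alpha> g v = g v] (mod int p)" using t(3)[OF g, of v] scfix g by simp
    qed
    then show ?thesis
      using AG.one_closed by (intro auto_eqI[OF t(1)]) (auto simp: AutoGroup_one)
  qed
  then show ?thesis
    using subgroup.one_closed[OF torus_subgroup] subgroup.one_closed[OF uniAut_subgroup] by blast
qed

text \<open>Dividing \<open>\<alpha>\<close> by the torus element with the same scalars leaves an
  automorphism that preserves every \<open>lam [] j\<close> on \<open>K j\<close>.\<close>

lemma flagAut_decompose:
  assumes \<alpha>: "\<alpha> \<in> flagAut"
  shows "\<exists>u\<in>uniAut. \<exists>\<tau>\<in>torus. \<alpha> = u \<otimes>\<^bsub>FG\<^esub> \<tau>"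
proof -
  obtain c where c: "\<And>j h. j < n \<Longrightarrow> h \<in> K j \<Longrightarrow> lam [] j (\<alpha> h) = (c j * lam [] j h) mod int p"
    using flagAut_lam[OF \<alpha>] by metis
  \<comment> \<open>For \<open>j < n\<close> the scalar \<open>c j\<close> is a unit because
    \<open>\<alpha>\<close> maps \<open>K j\<close> onto itself; from \<open>n\<close> on the
    default \<open>1\<close> keeps \<open>t\<close> a family of units.\<close>
  define t where "t j = (if j < n then c j mod int p else 1)" for j
  have t: "t j \<in> {1..<int p}" for j
  proof (cases "j < n")
    case True
    let ?e = "lev j (\<lambda>v. of_bool (v = replicate j 0))"
    have "?e \<in> \<alpha> ` K j" using flagAut_K[OF \<alpha>, of j] True lev_K by simp
    then obtain h where h: "h \<in> K j" "\<alpha> h = ?e" by force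
    have "c j * lam [] j h mod int p = 1" using c[OF True h(1)] h(2) single_lam[OF True, of "replicate j 0"] by simp
    then have "c j mod int p \<noteq> 0" by (metis mod_mult_left_eq mult_zero_left mod_0 zero_neq_one)
    moreover have "0 \<le> c j mod int p" "c j mod int p < int p" by auto
    ultimately show ?thesis unfolding t_def atLeastLessThan_iff using True by (simp; linarith)
  qed (use p_gt_1 in \<open>simp add: t_def\<close>)
  obtain \<tau> where \<tau>: "\<tau> \<in> auto VG"
    "\<And>g v. g \<in> V \<Longrightarrow> v \<in> nodes \<Longrightarrow> \<tau> g (scale t v) = (t (length v) * g v) mod int p"
    using torus_exists[of t, OF t] by blast
  have \<tau>T: "\<tau> \<in> torus" using \<tau> t by (auto simp: torus_def)
  have \<tau>f: "\<tau> \<in> flagAut" using \<tau>T torus_flagAut by blast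
  let ?i = "inv\<^bsub>AG\<^esub> \<tau>"
  have i: "?i \<in> flagAut" by (rule inv_flagAut[OF \<tau>f])
  let ?u = "\<alpha> \<otimes>\<^bsub>AG\<^esub> ?i"
  have uf: "?u \<in> flagAut" by (rule subgroup.m_closed[OF flagAut_subgroup \<alpha> i])
  have "lam [] j (?u h) = lam [] j h" if j: "j < n" and h: "h \<in> K j" for j h
  proof -
    have hV: "h \<in> V" using h K_V by blast
    have iK: "?i h \<in> K j" using flagAut_mem_K[OF i _ h] j by simp
    have "lam [] j (?u h) = (c j * lam [] j (?i h)) mod int p"
      using FG_apply[OF \<alpha> i hV] c[OF j iK] by simp
    also have "\<dots> = (t j * lam [] j (?i h)) mod int p" using j by (simp add: t_def mod_simps)
    also have "\<dots> = lam [] j (\<tau> (?i h))"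
      by (rule torus_lam[OF t \<tau>(2) K_V[OF iK] j, symmetric])
    also have "\<tau> (?i h) = h" by (rule auto_inv_apply[OF \<tau>(1) hV])
    finally show ?thesis .
  qed
  then have "?u \<in> uniAut" using uf by (simp add: uniAut_def)
  moreover have "\<alpha> = ?u \<otimes>\<^bsub>FG\<^esub> \<tau>"
    using AG.inv_solve_right[of ?u \<alpha> \<tau>] flagAut_auto \<alpha> \<tau>(1) uf by simp
  ultimately show ?thesis using \<tau>T by blast
qed

text \<open>Coprimality first puts \<open>G\<close> into \<open>flagAut\<close>; the conjugacy
  theorem is then applied inside \<open>FG\<close>, where \<open>uniAut\<close> is normal with
  complement \<open>torus\<close>.\<close>

lemma conjugate_into_torus:
  assumes G: "subgroup G (AutoGroup VG)" "coprime (card G) p"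
  shows "\<exists>u\<in>auto VG. \<forall>\<alpha>\<in>G. u \<otimes>\<^bsub>AG\<^esub> \<alpha> \<otimes>\<^bsub>AG\<^esub> inv\<^bsub>AG\<^esub> u \<in> torus"
proof -
  have GF: "G \<subseteq> flagAut"
    using coprime_auto_K[OF G] subgroup.subset[OF G(1)] by (auto simp: flagAut_def)
  have GS: "subgroup G FG" by (rule AG.subgroup_incl[OF G(1) flagAut_subgroup GF])
  obtain e where e: "card uniAut = p ^ e" using card_uniAut by blast
  have fin: "finite (carrier FG)" using finite_auto by (auto simp: flagAut_def)
  have "\<exists>u\<in>uniAut. \<forall>x\<in>G. u \<otimes>\<^bsub>FG\<^esub> x \<otimes>\<^bsub>FG\<^esub> inv\<^bsub>FG\<^esub> u \<in> torus"
    by (rule FG.coprime_conjugate_into_complement[OF prime_p fin uniAut_normal e GS G(2) torus_subgroup torus_uniAut])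
      (use GF flagAut_decompose in blast)
  then obtain u where u: "u \<in> uniAut" "\<forall>x\<in>G. u \<otimes>\<^bsub>FG\<^esub> x \<otimes>\<^bsub>FG\<^esub> inv\<^bsub>FG\<^esub> u \<in> torus" by blast
  then have "u \<in> flagAut" by (simp add: uniAut_def)
  then show ?thesis
    using u(2) AG.m_inv_consistent[OF flagAut_subgroup, of u] flagAut_auto by (intro bexI[of _ u]) auto
qed

section \<open>Torus-invariance of the standard complements\<close>

lemma special_scale:
  assumes "special w" "\<And>i. t i \<in> {1..<int p}"
  shows "special (scale t w)"
proof -
  obtain i a where a: "a \<in> {1..<int p}" "w = replicate i 0 @ [a]" using assms(1) by (auto simp: special_def)
  have z: "scale t (replicate i 0) = replicate i 0" by (rule nth_equalityI) (auto simp: nth_scale)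
  have "\<not> int p dvd t i" "\<not> int p dvd a" using a assms(2)[of i] zdvd_not_zless by auto
  then have "\<not> int p dvd t i * a" using prime_p by (simp add: prime_dvd_mult_iff)
  then have "(t i * a) mod int p \<noteq> 0" by auto
  moreover have "0 \<le> (t i * a) mod int p" "(t i * a) mod int p < int p" by auto
  ultimately have "(t i * a) mod int p \<in> {1..<int p}" unfolding atLeastLessThan_iff by linarith
  moreover have "scale t w = replicate i 0 @ [(t i * a) mod int p]" using a z by (simp add: scale_snoc)
  ultimately show ?thesis unfolding special_def by blast
qed

text \<open>Scaling by units fixes zero words and permutes the nonzero last digits, so special words
  and their depths are preserved, while labels of one depth are multiplied by a common unit.\<close>

lemma torus_comp:
  assumes "\<alpha> \<in> torus"
  shows "\<alpha> ` std_comp k J = std_comp k J"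
proof -
  obtain t where t: "\<alpha> \<in> auto VG" "\<And>i. t i \<in> {1..<int p}"
    "\<And>g v. g \<in> V \<Longrightarrow> v \<in> nodes \<Longrightarrow> \<alpha> g (scale t v) = (t (length v) * g v) mod int p"
    using assms by (rule torusE) blast
  have sub: "std_comp k J \<subseteq> V" using comp_V by blast
  have "\<alpha> ` std_comp k J \<subseteq> std_comp k J"
  proof (rule image_subsetI)
    fix g assume g: "g \<in> std_comp k J"
    have gV: "g \<in> V" using g comp_V by blast
    have aV: "\<alpha> g \<in> V" by (rule auto_closed[OF t(1) gV])
    have split: "\<exists>u'\<in>word k. \<exists>w'. u @ w = scale t (u' @ w') \<and> u' @ w' \<in> nodes \<and> length w' = length w \<and>
        scale (\<lambda>i. t (k + i)) w' = w \<and> scale t u' = u"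
      if u: "u \<in> word k" and n: "u @ w \<in> nodes" for u w
    proof -
      obtain x where x: "x \<in> word (length (u @ w))" "scale t x = u @ w"
        using scale_surj[where t = t and w = "u @ w", OF t(2)] nodesD[OF n] by blast
      have lu: "length u = k" using u by (rule length_word)
      have tk: "take k x \<in> word k" using word_take[OF x(1), of k] lu by simp
      have lx: "length x = k + length w" using x(1) lu by (simp add: length_word)
      have lt: "length (take k x) = k" using lx by simp
      have "scale t x = scale t (take k x) @ scale (\<lambda>i. t (k + i)) (drop k x)"
        using scale_append[of t "take k x" "drop k x"] unfolding append_take_drop_id lt .
      then have eq: "scale t (take k x) @ scale (\<lambda>i. t (k + i)) (drop k x) = u @ w" unfolding x(2) by (rule sym)
      have len: "length (scale t (take k x)) = length u" using lt lu by simp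
      have "scale t (take k x) = u \<and> scale (\<lambda>i. t (k + i)) (drop k x) = w"
        by (rule iffD1[OF append_eq_append_conv[OF disjI1[OF len]] eq])
      then have "scale t (take k x) = u" "scale (\<lambda>i. t (k + i)) (drop k x) = w" by auto
      moreover have "x \<in> nodes" using word_nodes[OF x(1)] nodesD[OF n] by simp
      moreover have "take k x @ drop k x = x" "length (drop k x) = length w" using lx by auto
      ultimately show ?thesis using tk x(2) by metis
    qed
    show "\<alpha> g \<in> std_comp k J"
      unfolding std_comp_def
    proof (intro CollectI conjI ballI allI impI)
      show "\<alpha> g \<in> V" by (rule aV)
      fix u assume u: "u \<in> word k"
      {
        fix w assume nz: "\<alpha> g (u @ w) \<noteq> 0"
        then have "u @ w \<in> nodes" using V_nonnode[OF aV] by blast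
        then obtain u' w' where *: "u' \<in> word k" "u @ w = scale t (u' @ w')" "u' @ w' \<in> nodes"
          "length w' = length w" "scale (\<lambda>i. t (k + i)) w' = w" using split[OF u] by blast
        have "\<alpha> g (u @ w) = (t (length (u' @ w')) * g (u' @ w')) mod int p" using t(3)[OF gV *(3)] *(2) by simp
        then have "g (u' @ w') \<noteq> 0" using nz by auto
        then have "special w' \<and> k + length w' \<in> J" using g *(1) unfolding std_comp_def by blast
        then show "special w" "k + length w \<in> J"
          using special_scale[of w' "\<lambda>i. t (k + i)"] t(2) *(4,5) by auto
      }
      fix i and a assume a: "a \<in> {1..<int p}"
      have one: "1 \<in> {1..<int p}" using p_gt_1 by simp
      obtain u' where u': "u' \<in> word k" "scale t u' = u" using scale_surj[where t = t, OF t(2) u] by blast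
      have val: "\<alpha> g (u @ replicate i 0 @ [b]) =
          (if k + Suc i < n then (t (k + i + 1) * g (u' @ replicate i 0 @ [1])) mod int p else 0)"
        if b: "b \<in> {1..<int p}" for b
      proof -
        have "special (replicate i 0 @ [b])" using b by (auto simp: special_def)
        note sw = special_word[OF this]
        have iff: "u @ replicate i 0 @ [b] \<in> nodes \<longleftrightarrow> k + Suc i < n" using word_nodes[OF word_append[OF u sw]] by simp
        show ?thesis
        proof (cases "k + Suc i < n")
          case True
          then obtain x w' where *: "x \<in> word k" "u @ replicate i 0 @ [b] = scale t (x @ w')" "x @ w' \<in> nodes"
            "length w' = Suc i" "scale (\<lambda>i. t (k + i)) w' = replicate i 0 @ [b]" "scale t x = u"
            using split[OF u, of "replicate i 0 @ [b]"] iff by auto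
          have xu: "x = u'" using bij_scale[where t = t and j = k, OF t(2)] *(1,6) u' by (auto simp: bij_betw_def inj_on_def)
          \<comment> \<open>\<open>w'\<close> ends in a digit depending on \<open>b\<close>; since
            labels of \<open>g\<close> do not depend on the last digit of a special word, that
            dependence disappears.\<close>
          have "g (x @ w') = g (u' @ replicate i 0 @ [1])"
          proof -
            obtain s where s: "\<And>i. s i \<in> {1..<int p}" "\<And>i. [t (k + i) * s i = 1] (mod int p)"
              "\<And>i. [s i * t (k + i) = 1] (mod int p)"
              by (rule inverses_mod[of "\<lambda>i. t (k + i)"]) (rule t(2), rule that)
            have "w' \<in> word (length w')" using word_appendD nodesD[OF *(3)] by blast
            then have "w' = scale s (replicate i 0 @ [b])"
              using scale_scale[of w' "length w'" s "\<lambda>i. t (k + i)"] s(3) *(5) by simp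
            then have "special w'"
              using special_scale[of "replicate i 0 @ [b]" s] s(1) b by (auto simp: special_def)
            then obtain m d where d: "d \<in> {1..<int p}" "w' = replicate m 0 @ [d]" by (auto simp: special_def)
            then have "m = i" using *(4) by simp
            then show ?thesis using g u'(1) d xu unfolding std_comp_def by blast
          qed
          moreover have "\<alpha> g (u @ replicate i 0 @ [b]) = (t (length (x @ w')) * g (x @ w')) mod int p"
            using t(3)[OF gV *(3)] *(2) by simp
          moreover have "length (x @ w') = k + i + 1" using *(1,4) by (simp add: length_word)
          ultimately show ?thesis using True by simp
        qed (use iff V_nonnode[OF aV] in auto)
      qed
      show "\<alpha> g (u @ replicate i 0 @ [a]) = \<alpha> g (u @ replicate i 0 @ [1])"
        using val[OF a] val[OF one] by simp
    qed
  qed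
  then show ?thesis by (rule auto_image_eq[OF t(1) sub])
qed

end

section \<open>Transport of complements along isomorphisms\<close>

lemma complement_in_iso:
  assumes A: "group A" and B: "group B" and h: "h \<in> iso A B"
    and N: "N \<subseteq> carrier A" and L: "complement_in L N A"
  shows "complement_in (h ` L) (h ` N) B"
  unfolding complement_in_def
proof (intro conjI)
  have LA: "subgroup L A" "N <#>\<^bsub>A\<^esub> L = carrier A" "N \<inter> L = {\<one>\<^bsub>A\<^esub>}"
    using L by (auto simp: complement_in_def)
  have Lc: "L \<subseteq> carrier A" using LA(1) by (rule subgroup.subset)
  have bij: "inj_on h (carrier A)" "h ` carrier A = carrier B" and hom: "h \<in> hom A B"
    using h by (auto simp: iso_def bij_betw_def)
  have mult: "h (x \<otimes>\<^bsub>A\<^esub> y) = h x \<otimes>\<^bsub>B\<^esub> h y" if "x \<in> carrier A" "y \<in> carrier A" for x y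
    using hom that by (simp add: hom_def)
  show "subgroup (h ` L) B" by (rule subgroup.iso_subgroup[OF LA(1) A B h])
  have "h ` N <#>\<^bsub>B\<^esub> h ` L = h ` (N <#>\<^bsub>A\<^esub> L)"
    using mult N Lc by (force simp: set_mult_def)
  then show "h ` N <#>\<^bsub>B\<^esub> h ` L = carrier B" using LA(2) bij(2) by simp
  have "h ` N \<inter> h ` L = h ` (N \<inter> L)" by (rule inj_on_image_Int[OF bij(1) N Lc, symmetric])
  also have "\<dots> = {\<one>\<^bsub>B\<^esub>}"
    using LA(3) group_hom.hom_one[of A B h] A B hom by (simp add: group_hom_def group_hom_axioms_def)
  finally show "h ` N \<inter> h ` L = {\<one>\<^bsub>B\<^esub>}" .
qed

context portraits
begin

text \<open>The automorphism \<open>u\<close> that moves \<open>G\<close> into the torus need not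
  preserve \<open>N\<close>, so the standard complement is taken for the image of \<open>N\<close>
  under \<open>u\<close> and pulled back.\<close>

theorem invariant_complement:
  assumes G: "subgroup G (AutoGroup VG)" "coprime (card G) p"
    and N: "N \<lhd> VG" and L: "complement_in L N VG"
  shows "\<exists>L'. complement_in L' N VG \<and> (\<forall>\<alpha>\<in>G. \<alpha> ` L' = L')"
proof -
  obtain u where u: "u \<in> auto VG"
    and torus: "\<And>\<alpha>. \<alpha> \<in> G \<Longrightarrow> u \<otimes>\<^bsub>AG\<^esub> \<alpha> \<otimes>\<^bsub>AG\<^esub> inv\<^bsub>AG\<^esub> u \<in> torus"
    using conjugate_into_torus[OF G] by blast
  let ?i = "inv\<^bsub>AG\<^esub> u"
  have i: "?i \<in> auto VG" using AG.inv_closed[of u] u by simp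
  have NV: "N \<subseteq> V" using normal_imp_subgroup[OF N] subgroup.subset by fastforce
  have LV: "L \<subseteq> V" using L subgroup.subset by (fastforce simp: complement_in_def)
  have iu: "?i ` (u ` S) = S" "u ` (?i ` S) = S" if "S \<subseteq> V" for S
    using auto_inv_apply[OF u] that by (auto simp: image_image subset_iff intro!: image_eqI)
  have "complement_in (u ` L) (u ` N) VG"
    by (rule complement_in_iso[OF VG_group VG_group auto_iso[OF u] _ L]) (use NV in simp)
  then obtain k J where C: "complement_in (std_comp k J) (u ` N) VG"
    using standard_complement[OF auto_image_normal[OF u N]] by blast
  have CV: "std_comp k J \<subseteq> V" using comp_V by blast
  let ?L = "?i ` std_comp k J"
  have "complement_in ?L (?i ` (u ` N)) VG"
    by (rule complement_in_iso[OF VG_group VG_group auto_iso[OF i] _ C]) (use NV auto_closed[OF u] in auto)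
  then have "complement_in ?L N VG" using iu(1)[OF NV] by simp
  moreover have "\<alpha> ` ?L = ?L" if \<alpha>: "\<alpha> \<in> G" for \<alpha>
  proof -
    have a: "\<alpha> \<in> auto VG" using subgroup.mem_carrier[OF G(1) \<alpha>] by simp
    have ua: "u \<otimes>\<^bsub>AG\<^esub> \<alpha> \<in> auto VG" using AG.m_closed[of u \<alpha>] u a by simp
    have LV: "?L \<subseteq> V" using CV auto_closed[OF i] by blast
    have "u ` (\<alpha> ` ?L) = (u \<otimes>\<^bsub>AG\<^esub> \<alpha> \<otimes>\<^bsub>AG\<^esub> ?i) ` std_comp k J"
      using AutoGroup_image[OF ua i CV] AutoGroup_image[OF u a LV] by simp
    also have "\<dots> = std_comp k J" by (rule torus_comp[OF torus[OF \<alpha>]])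
    also have "\<dots> = u ` ?L" by (rule iu(2)[OF CV, symmetric])
    finally have eq: "u ` (\<alpha> ` ?L) = u ` ?L" .
    have "\<alpha> ` ?L \<subseteq> V" using LV auto_closed[OF a] by blast
    then show ?thesis by (rule auto_image_cancel[OF u _ LV eq])
  qed
  ultimately show ?thesis by blast
qed

section \<open>The portrait group inside the symmetric group\<close>

lemma V_embeds_in_sym_group: "\<exists>Q. subgroup Q (sym_group (p ^ n)) \<and> card Q = card V \<and>
    (\<exists>h. h \<in> iso VG ((sym_group (p ^ n))\<lparr>carrier := Q\<rparr>))"
proof -
  let ?S = "sym_group (p ^ n)"
  interpret S: group ?S by (rule sym_group_is_group)
  obtain b where b: "bij_betw b (word n) {1..p ^ n}"
    using finite_same_card_bij[of "word n" "{1..p ^ n}"] card_word by auto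
  define c where "c = inv_into (word n) b"
  have c: "bij_betw c {1..p ^ n} (word n)" unfolding c_def by (rule bij_betw_inv_into[OF b])
  have cb: "c (b v) = v" if "v \<in> word n" for v
    using that b by (auto simp: c_def bij_betw_def)
  have cw: "c i \<in> word n" if "i \<in> {1..p ^ n}" for i using c that by (auto simp: bij_betw_def)
  have bw: "b v \<in> {1..p ^ n}" if "v \<in> word n" for v using b that by (auto simp: bij_betw_def)
  define e where "e g i = (if i \<in> {1..p ^ n} then b (act g (c i)) else i)" for g i
  have e_perm: "e g \<in> carrier ?S" for g
  proof -
    have "bij_betw (b \<circ> (act g \<circ> c)) {1..p ^ n} {1..p ^ n}"
      by (intro bij_betw_trans[OF bij_betw_trans[OF c bij_act] b])
    then have "bij_betw (e g) {1..p ^ n} {1..p ^ n}"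
      by (rule bij_betw_cong[THEN iffD1, rotated]) (auto simp: e_def)
    then have "e g permutes {1..p ^ n}" by (rule bij_imp_permutes) (auto simp: e_def)
    then show ?thesis by (simp add: sym_group_carrier)
  qed
  have e_mul: "e (mul g h) = e g \<circ> e h" if "g \<in> V" "h \<in> V" for g h
  proof
    fix i show "e (mul g h) i = (e g \<circ> e h) i"
    proof (cases "i \<in> {1..p ^ n}")
      case True
      have "b (act h (c i)) \<in> {1..p ^ n}" using bw[OF act_word[OF cw[OF True]]] .
      then show ?thesis
        using True act_mul[OF cw[OF True], of g h] cb[OF act_word[OF cw[OF True], of h]] by (simp add: e_def)
    qed (auto simp: e_def)
  qed
  have hom: "e \<in> hom VG ?S"
    using e_perm e_mul by (auto simp: hom_def sym_group_mult)
  have inj: "inj_on e V"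
  proof (rule inj_onI)
    fix g h assume gh: "g \<in> V" "h \<in> V" "e g = e h"
    have eq: "act g v = act h v" if v: "v \<in> word n" for v
    proof -
      have "b (act g v) = b (act h v)"
        using fun_cong[OF gh(3), of "b v"] bw[OF v] cb[OF v] by (simp add: e_def)
      then show ?thesis using b act_word[OF v] by (auto simp: bij_betw_def inj_on_def)
    qed
    have "mul (inv\<^bsub>VG\<^esub> h) g \<in> K n"
    proof (rule K_if_act_fix)
      fix v assume v: "v \<in> word n"
      have "act (mul (inv\<^bsub>VG\<^esub> h) g) v = act (mul (inv\<^bsub>VG\<^esub> h) h) v"
        using act_mul[OF v] eq[OF v] by simp
      also have "mul (inv\<^bsub>VG\<^esub> h) h = (\<lambda>_. 0)" using VG.l_inv[of h] gh by simp
      finally show "act (mul (inv\<^bsub>VG\<^esub> h) g) v = v" using act_0[OF v] by simp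
    qed (use gh in auto)
    then have "mul (inv\<^bsub>VG\<^esub> h) g = (\<lambda>_. 0)" using K_n by simp
    then have "h = g" using VG.inv_mult_cancel(2)[of h g] VG.r_one[of h] gh by simp
    then show "g = h" by simp
  qed
  interpret e: group_hom VG ?S e using hom by unfold_locales
  have sub: "subgroup (e ` V) ?S" using e.img_is_subgroup by simp
  have "e \<in> iso VG (?S\<lparr>carrier := e ` V\<rparr>)"
    using hom inj by (auto simp: iso_def hom_def bij_betw_def)
  moreover have "card (e ` V) = card V" using inj by (rule card_image)
  ultimately show ?thesis using sub by blast
qed

end

section \<open>Sylow subgroups of symmetric groups\<close>

text \<open>Among the factors from \<open>p * m + 1\<close> to \<open>p * m + p\<close> only the
  last is divisible by \<open>p\<close>, contributing one more than \<open>Suc m\<close>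
  does.\<close>

lemma multiplicity_fact_prime_mult:
  fixes p :: nat
  assumes p: "Factorial_Ring.prime p"
  shows "multiplicity p (fact (p * m) :: nat) = m + multiplicity p (fact m :: nat)"
proof (induction m)
  case (Suc m)
  have pe: "prime_elem p" using p by simp
  have p1: "1 < p" using p by (rule prime_gt_1_nat)
  have part: "multiplicity p (fact (p * m + i) :: nat) = multiplicity p (fact (p * m) :: nat)" if "i < p" for i
    using that
  proof (induction i)
    case (Suc i)
    have "\<not> p dvd p * m + Suc i"
    proof
      assume "p dvd p * m + Suc i"
      then have "p dvd Suc i" by (rule iffD1[OF dvd_add_right_iff[OF dvd_triv_left]])
      then show False using Suc.prems dvd_imp_le by fastforce
    qed
    then have 0: "multiplicity p (p * m + Suc i) = 0" by (rule not_dvd_imp_multiplicity_0)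
    have "multiplicity p (fact (p * m + Suc i) :: nat) = multiplicity p ((p * m + Suc i) * fact (p * m + i))"
      by simp
    also have "\<dots> = multiplicity p (p * m + Suc i) + multiplicity p (fact (p * m + i) :: nat)"
      by (rule prime_elem_multiplicity_mult_distrib[OF pe]) auto
    finally show ?case using Suc 0 by simp
  qed simp
  have "p * Suc m = Suc (p * m + (p - 1))" using p1 by simp
  then have "(fact (p * Suc m) :: nat) = (p * Suc m) * fact (p * m + (p - 1))" by (metis fact_Suc of_nat_id)
  also have "multiplicity p \<dots> = multiplicity p (p * Suc m) + multiplicity p (fact (p * m + (p - 1)) :: nat)"
    by (rule prime_elem_multiplicity_mult_distrib[OF pe]) (use p1 in auto)
  also have "multiplicity p (p * Suc m) = 1 + multiplicity p (Suc m)"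
    using prime_elem_multiplicity_mult_distrib[OF pe, of p "Suc m"] multiplicity_self[of p] p1 by simp
  also have "multiplicity p (fact (p * m + (p - 1)) :: nat) = m + multiplicity p (fact m :: nat)"
    using part[of "p - 1"] p1 Suc.IH by simp
  also have "1 + multiplicity p (Suc m) + (m + multiplicity p (fact m :: nat)) = Suc m + (multiplicity p (Suc m) + multiplicity p (fact m :: nat))"
    by simp
  also have "multiplicity p (Suc m) + multiplicity p (fact m :: nat) = multiplicity p (fact (Suc m) :: nat)"
    using prime_elem_multiplicity_mult_distrib[OF pe, of "Suc m" "fact m"] by simp
  finally show ?case .
qed simp

lemma multiplicity_fact_prime_power:
  fixes p :: nat
  assumes p: "Factorial_Ring.prime p"
  shows "multiplicity p (fact (p ^ n) :: nat) = (\<Sum>j<n. p ^ j)"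
proof (induction n)
  case (Suc n)
  then show ?case using multiplicity_fact_prime_mult[OF p, of "p ^ n"] by simp
qed simp

text \<open>The image is isomorphic to a quotient of \<open>G\<close>. Coprimality of the order thus
  survives for actions that are not faithful.\<close>

lemma (in group_hom) card_image_dvd_order:
  assumes "finite (carrier G)"
  shows "card (h ` carrier G) dvd order G"
proof -
  let ?H = "H\<lparr>carrier := h ` carrier G\<rparr>"
  interpret I: group ?H using img_is_subgroup by (rule H.subgroup_imp_group)
  have hom: "h \<in> hom G ?H" using homh by (auto simp: hom_def)
  interpret h: group_hom G ?H h by (rule group_hom.intro[OF G.is_group I.is_group]) (unfold_locales, rule hom)
  have "G Mod kernel G ?H h \<cong> ?H" by (rule h.FactGroup_iso) simp
  then have "card (carrier (G Mod kernel G ?H h)) = card (h ` carrier G)"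
    using iso_same_card by fastforce
  then show ?thesis
    using G.lagrange[OF h.subgroup_kernel] by (simp add: FactGroup_def) (metis dvd_triv_left)
qed

theorem theorem1p2:
  fixes p n :: nat and P :: "(nat \<Rightarrow> nat) set"
  assumes "Factorial_Ring.prime p" and "n \<ge> 1"
    and "sylow_subgroup p P (sym_group (p ^ n))"
  shows "maschke_property TYPE('g) {p} ((sym_group (p ^ n))\<lparr>carrier := P\<rparr>)"
proof -
  interpret portraits p n by unfold_locales (rule assms(1))
  let ?S = "sym_group (p ^ n)"
  let ?P = "?S\<lparr>carrier := P\<rparr>"
  interpret S: group ?S by (rule sym_group_is_group)
  have P: "subgroup P ?S" "card P = p ^ multiplicity p (order ?S)"
    using assms(3) by (auto simp: sylow_subgroup_def)
  have ordS: "order ?S = fact (p ^ n)" by (simp add: order_def sym_group_card_carrier)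
  have finS: "finite (carrier ?S)" using ordS S.order_gt_0_iff_finite by simp
  interpret PG: group ?P using P(1) by (rule S.subgroup_imp_group)
  obtain Q e where Q: "subgroup Q ?S" "card Q = card V" "e \<in> iso VG (?S\<lparr>carrier := Q\<rparr>)"
    using V_embeds_in_sym_group by blast
  \<comment> \<open>Both exponents are the sum of \<open>p ^ j\<close> over \<open>j < n\<close>, so
    \<open>Q\<close> is a Sylow subgroup too.\<close>
  have "card Q = p ^ multiplicity p (order ?S)"
    using Q(2) card_V ordS multiplicity_fact_prime_power[OF assms(1)] by simp
  then have "?S\<lparr>carrier := Q\<rparr> \<cong> ?P" by (rule S.sylow_subgroups_iso[OF assms(1) finS P Q(1)])
  then have "VG \<cong> ?P" using Q(3) iso_trans is_isoI by blast
  then obtain r where r: "r \<in> iso VG ?P" by (auto simp: is_iso_def)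
  define s where "s = inv_into V r"
  have s: "s \<in> iso ?P VG" using VG.iso_set_sym[OF r] by (simp add: s_def)
  have rbij: "bij_betw r V P" and rhom: "r \<in> hom VG ?P" using r by (auto simp: iso_def)
  have sbij: "bij_betw s P V" and shom: "s \<in> hom ?P VG" using s by (auto simp: iso_def)
  have rs: "r (s x) = x" if "x \<in> P" for x
    using that rbij by (simp add: s_def bij_betw_def f_inv_into_f)
  have sr: "s (r x) = x" if "x \<in> V" for x
    using that rbij by (simp add: s_def bij_betw_def)
  have sV: "s x \<in> V" if "x \<in> P" for x using sbij that by (auto simp: bij_betw_def)
  have rP: "r x \<in> P" if "x \<in> V" for x using rbij that by (auto simp: bij_betw_def)
  have pi: "pi_group {p} ?P"
    unfolding pi_group_def
  proof (intro conjI allI impI)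
    show "group ?P" by (rule PG.is_group)
    show "finite (carrier ?P)" using finS subgroup.subset[OF P(1)] finite_subset by auto
    fix q assume "Factorial_Ring.prime q \<and> q dvd order ?P"
    then show "q \<in> {p}"
      using P(2) assms(1) by (auto simp: order_def dest: prime_dvd_power primes_dvd_imp_eq)
  qed
  have "\<exists>L. complement_in L N ?P \<and> action_invariant G \<phi> L"
    if G: "pi_group ({q. Factorial_Ring.prime q} - {p}) G" and \<phi>: "acts_by_automorphisms G ?P \<phi>"
      and N: "N \<lhd> ?P" and L: "complement_in L N ?P"
    for G :: "'g monoid" and \<phi> N L
  proof -
    have Gg: "group G" "finite (carrier G)" using G by (auto simp: pi_group_def)
    interpret \<phi>: group_hom G "AutoGroup ?P" \<phi> using \<phi> by (simp add: acts_by_automorphisms_def)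
    have auto: "\<phi> g \<in> hom ?P ?P" "bij_betw (\<phi> g) P P" if "g \<in> carrier G" for g
      using \<phi>.hom_closed[OF that] by (auto simp: AutoGroup_def auto_def Bij_def)
    have \<phi>P: "\<phi> g x \<in> P" if "g \<in> carrier G" "x \<in> P" for g x
      using auto(2)[OF that(1)] that(2) by (auto simp: bij_betw_def)
    \<comment> \<open>The action is transported to \<open>V\<close> along \<open>r\<close> and
      \<open>s\<close>; restriction to \<open>V\<close> makes it extensional, as members of
      \<open>AutoGroup VG\<close> must be.\<close>
    define \<Phi> where "\<Phi> g = (\<lambda>x\<in>V. s (\<phi> g (r x)))" for g
    have \<Phi>auto: "\<Phi> g \<in> auto VG" if g: "g \<in> carrier G" for g
    proof -
      have "bij_betw (s \<circ> (\<phi> g \<circ> r)) V V"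
        by (intro bij_betw_trans[OF bij_betw_trans[OF rbij auto(2)[OF g]] sbij])
      then have "bij_betw (\<Phi> g) V V"
        by (rule bij_betw_cong[THEN iffD1, rotated]) (auto simp: \<Phi>_def)
      moreover have "\<Phi> g \<in> hom VG VG"
      proof -
        have "\<Phi> g (mul x y) = mul (\<Phi> g x) (\<Phi> g y)" if "x \<in> V" "y \<in> V" for x y
          using that rhom shom auto(1)[OF g] rP \<phi>P[OF g] by (simp add: \<Phi>_def hom_def Pi_iff)
        then show ?thesis using sV \<phi>P[OF g] rP by (auto simp: hom_def \<Phi>_def)
      qed
      ultimately show ?thesis by (auto simp: auto_def Bij_def \<Phi>_def)
    qed
    have "\<Phi> \<in> hom G (AutoGroup VG)"
    proof (rule homI)
      show "\<Phi> g \<in> carrier AG" if "g \<in> carrier G" for g using \<Phi>auto[OF that] by simp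
      fix g h assume gh: "g \<in> carrier G" "h \<in> carrier G"
      have "\<phi> (g \<otimes>\<^bsub>G\<^esub> h) x = \<phi> g (\<phi> h x)" if "x \<in> P" for x
        using \<phi>.hom_mult[OF gh] \<phi>.hom_closed[OF gh(1)] \<phi>.hom_closed[OF gh(2)] that
        by (simp add: AutoGroup_def BijGroup_def auto_def compose_def)
      then have "\<Phi> (g \<otimes>\<^bsub>G\<^esub> h) x = \<Phi> g (\<Phi> h x)" if "x \<in> V" for x
        using that rP[OF that] rs \<phi>P gh sV by (simp add: \<Phi>_def)
      then have "\<Phi> (g \<otimes>\<^bsub>G\<^esub> h) = compose V (\<Phi> g) (\<Phi> h)"
        by (auto simp: compose_def \<Phi>_def fun_eq_iff restrict_def)
      then show "\<Phi> (g \<otimes>\<^bsub>G\<^esub> h) = \<Phi> g \<otimes>\<^bsub>AG\<^esub> \<Phi> h"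
        using AutoGroup_mult \<Phi>auto gh by simp
    qed
    then interpret \<Phi>: group_hom G "AutoGroup VG" \<Phi>
      by (intro group_hom.intro group_hom_axioms.intro Gg AutoGroup_group)
    have sub: "subgroup (\<Phi> ` carrier G) (AutoGroup VG)" by (rule \<Phi>.img_is_subgroup)
    have "\<not> p dvd order G" using G assms(1) by (auto simp: pi_group_def)
    then have "coprime (order G) p" using assms(1) by (metis coprime_commute prime_imp_coprime)
    then have cop: "coprime (card (\<Phi> ` carrier G)) p"
      using \<Phi>.card_image_dvd_order[OF Gg(2)] by (rule coprime_divisors[OF _ dvd_refl, rotated])
    have NP: "N \<subseteq> P" using normal_imp_subgroup[OF N] subgroup.subset by fastforce
    have sN: "s ` N \<lhd> VG" by (rule iso_normal_subgroup[OF s PG.is_group VG_group N])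
    have sL: "complement_in (s ` L) (s ` N) VG"
      by (rule complement_in_iso[OF PG.is_group VG_group s _ L]) (use NP in simp)
    obtain L' where L': "complement_in L' (s ` N) VG"
      "\<And>\<alpha>. \<alpha> \<in> \<Phi> ` carrier G \<Longrightarrow> \<alpha> ` L' = L'"
      using invariant_complement[OF sub cop sN sL] by blast
    have L'V: "L' \<subseteq> V" using L'(1) subgroup.subset by (fastforce simp: complement_in_def)
    have "complement_in (r ` L') (r ` (s ` N)) ?P"
      by (rule complement_in_iso[OF VG_group PG.is_group r _ L'(1)]) (use NP sV in auto)
    moreover have "r ` (s ` N) = N" using rs NP by (auto simp: image_image subset_iff intro!: image_eqI)
    moreover have "\<phi> g ` (r ` L') = r ` L'" if g: "g \<in> carrier G" for g
    proof -
      have "\<phi> g (r x) = r (\<Phi> g x)" if "x \<in> L'" for x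
        using that L'V rs[OF \<phi>P[OF g rP]] by (auto simp: \<Phi>_def)
      then have "\<phi> g ` (r ` L') = r ` (\<Phi> g ` L')" by (simp add: image_image)
      also have "\<Phi> g ` L' = L'" using L'(2) g by blast
      finally show ?thesis .
    qed
    ultimately show ?thesis by (intro exI[of _ "r ` L'"]) (simp add: action_invariant_def)
  qed
  then show ?thesis using pi unfolding maschke_property_def by blast
qed

end
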